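(* For all $\varepsilon\in(0,1)$ there exists $\nu>0$ such that for any vector field $k=(k_1,k_2)\in\mathcal{B}_{0,3+\varepsilon}$ on $\mathbb{R}^2$ satisfying $$\|k;\mathcal{B}_{0,3+\varepsilon}\|\le\nu,\qquad \int_{\mathbb{R}^2}k=0,$$ there exists $a=(a_1,a_2)\in\mathbb{R}^2$ such that there exist $u$ and $p$ satisfying $$\Delta u-\nabla p-u\cdot\nabla u=f,\qquad \nabla\cdot u=0\quad\text{in }\mathbb{R}^2,\qquad \lim_{|x|\to\infty}u=0,$$ with $$f(x)=k(x)+\frac{e^{-|x|^2}}{\pi}\bigl[a_1(x_1,-x_2)+a_2(x_2,x_1)\bigr].$$ Moreover, as $r=|x|\to\infty$, $$u=-\frac{M}{4\pi r}e_\theta+O(r^{-1-\varepsilon}),\qquad\text{where}\quad M=\int_{\mathbb{R}^2}x\wedge k=\int_{\mathbb{R}^2}x\wedge f .$$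
   Context: $(r,\theta)$ are polar coordinates in $\mathbb{R}^2$, $e_\theta=(-\sin\theta,\cos\theta)$, and $x\wedge k=x_1k_2-x_2k_1$. For $q>0$ let $w_q(x)=1+|x|^q$. The space $\mathcal{B}_{0,q}$ consists of the (componentwise, vector valued) functions $g\in C^0(\mathbb{R}^2)$ with $w_qg\in L^\infty(\mathbb{R}^2)$, with norm $\|g;\mathcal{B}_{0,q}\|=\sup_xw_q(x)|g(x)|$. Since $k$ is only continuous, the equations are understood in the sense of distributions with $u\in C^1(\mathbb{R}^2)$ and $p\in C^0(\mathbb{R}^2)$. *)

theory Defs
  imports "HOL-Analysis.Analysis" "HOL-Library.Landau_Symbols"
begin

definition weight :: "real \<Rightarrow> real^2 \<Rightarrow> real" where
  "weight q x = 1 + norm x powr q"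

text \<open>For a continuous function the essential supremum in the \<open>L\<close>-infinity condition is the
  supremum, so membership is boundedness everywhere.\<close>

definition B0 :: "real \<Rightarrow> (real^2 \<Rightarrow> real^2) set" where
  "B0 q = {g. continuous_on UNIV g \<and> bounded (range (\<lambda>x. weight q x *\<^sub>R g x))}"

definition B0_norm :: "real \<Rightarrow> (real^2 \<Rightarrow> real^2) \<Rightarrow> real" where
  "B0_norm q g = (SUP x. weight q x * norm (g x))"

definition wedge :: "real^2 \<Rightarrow> real^2 \<Rightarrow> real" where
  "wedge x y = x $ 1 * y $ 2 - x $ 2 * y $ 1"

definition polar_angle :: "real^2 \<Rightarrow> real" where
  "polar_angle x = Arg (Complex (x $ 1) (x $ 2))"

definition e_theta :: "real^2 \<Rightarrow> real^2" where
  "e_theta x = vector [- sin (polar_angle x), cos (polar_angle x)]"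

definition partial :: "2 \<Rightarrow> (real^2 \<Rightarrow> real) \<Rightarrow> real^2 \<Rightarrow> real" where
  "partial i g x = frechet_derivative g (at x) (axis i 1)"

fun Ck :: "nat \<Rightarrow> (real^2 \<Rightarrow> real) \<Rightarrow> bool" where
  "Ck 0 g \<longleftrightarrow> continuous_on UNIV g"
| "Ck (Suc n) g \<longleftrightarrow> (\<forall>x. g differentiable (at x)) \<and> (\<forall>i. Ck n (partial i g))"

definition test_functions :: "(real^2 \<Rightarrow> real) set" where
  "test_functions = {\<phi>. (\<forall>n. Ck n \<phi>) \<and> compact (closure {x. \<phi> x \<noteq> 0})}"

text \<open>Distributions are represented by functionals that are only ever evaluated on
  \<^const>\<open>test_functions\<close>; the only ones needed are those induced by continuous functions
  and their distributional derivatives.\<close>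

type_synonym distr = "(real^2 \<Rightarrow> real) \<Rightarrow> real"

definition regular_distr :: "(real^2 \<Rightarrow> real) \<Rightarrow> distr" where
  "regular_distr g \<phi> = (LINT x|lborel. g x * \<phi> x)"

definition distr_partial :: "2 \<Rightarrow> distr \<Rightarrow> distr" where
  "distr_partial i T \<phi> = - T (partial i \<phi>)"

definition distr_laplacian :: "distr \<Rightarrow> distr" where
  "distr_laplacian T \<phi> = (\<Sum>j\<in>UNIV. distr_partial j (distr_partial j T) \<phi>)"

definition convection :: "(real^2 \<Rightarrow> real^2) \<Rightarrow> 2 \<Rightarrow> real^2 \<Rightarrow> real" where
  "convection u i x = (\<Sum>j\<in>UNIV. u x $ j * partial j (\<lambda>y. u y $ i) x)"

text \<open>Since \<open>u\<close> is \<open>C\<^sup>1\<close>, the convective term is a continuous function; all other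
  derivatives are distributional.\<close>

definition navier_stokes_solution ::
    "(real^2 \<Rightarrow> real^2) \<Rightarrow> (real^2 \<Rightarrow> real^2) \<Rightarrow> (real^2 \<Rightarrow> real) \<Rightarrow> bool" where
  "navier_stokes_solution f u p \<longleftrightarrow>
     (\<forall>i. Ck 1 (\<lambda>x. u x $ i)) \<and> Ck 0 p \<and>
     (\<forall>i. \<forall>\<phi>\<in>test_functions.
        distr_laplacian (regular_distr (\<lambda>x. u x $ i)) \<phi>
        - distr_partial i (regular_distr p) \<phi>
        - regular_distr (convection u i) \<phi>
        = regular_distr (\<lambda>x. f x $ i) \<phi>) \<and>
     (\<forall>\<phi>\<in>test_functions. (\<Sum>i\<in>UNIV. distr_partial i (regular_distr (\<lambda>x. u x $ i)) \<phi>) = 0)"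

definition forcing :: "(real^2 \<Rightarrow> real^2) \<Rightarrow> real^2 \<Rightarrow> real^2 \<Rightarrow> real^2" where
  "forcing k a x = k x + (exp (- (norm x)\<^sup>2) / pi) *\<^sub>R
     (a $ 1 *\<^sub>R vector [x $ 1, - (x $ 2)] + a $ 2 *\<^sub>R vector [x $ 2, x $ 1])"

end

theory Submission
  imports Defs
begin

text \<open>
  Identify the plane with the complex numbers. The swirl \<open>Q = i z / (1 + |z|\<^sup>2)\<close> behaves like
  \<open>e_theta / r\<close>, its self-advection is a gradient, and its Laplacian is the fast decaying field
  \<open>- 8 i z / (1 + |z|\<^sup>2)\<^sup>3\<close>, whose angular momentum is \<open>- 4 \<pi>\<close>. Write
  \<open>u = \<kappa> Q + v\<close> with \<open>\<kappa> = - M / (4 \<pi>)\<close>. Then \<open>v\<close> solves a Stokes system whose source \<open>G\<close> collects \<open>k\<close>,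
  the Laplacian of \<open>\<kappa> Q\<close>, the remaining quadratic terms and the Gaussian compensator, and decays like
  \<open>r\<^sup>-\<^sup>3\<^sup>-\<^sup>\<epsilon>\<close>. The Stokes velocity of \<open>G\<close> is \<open>O(r\<^sup>-\<^sup>1\<^sup>-\<^sup>\<epsilon>)\<close>, with gradient \<open>O(r\<^sup>-\<^sup>2\<^sup>-\<^sup>\<epsilon>)\<close>, as soon as
  \<open>\<integral> G\<close>, \<open>\<integral> z G\<close> and \<open>Im \<integral> cnj z G\<close> vanish: the first and the last vanish because the quadratic
  terms are divergences of symmetric tensors and by the choice of \<open>\<kappa>\<close>, the second one fixes \<open>a\<close>. For small
  \<open>k\<close> the map sending \<open>G\<close> to the source generated by its own velocity is therefore a contraction in
  the weighted sup norm.

  In complex notation the velocity has \<open>z\<close>-derivative \<open>(X - cnj X) / (8 \<pi>)\<close> and pressure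
  \<open>- Re X / (2 \<pi>)\<close>, where \<open>X\<close> is the convolution of \<open>G\<close> with \<open>1/z\<close>; hence the weak momentum
  equation reduces to the Cauchy--Pompeiu formula.
\<close>

section \<open>Planar kernels\<close>

text \<open>The obstacle is the tail of order 1/r. For such a velocity u . grad u is of order r^-3,
  whose first moments need not converge, so the tail cannot come out of a Stokes inversion of the
  nonlinearity. It must be split off in a form whose self-advection is exactly a gradient. A swirl
  has this property, and its products with a remainder of order r^(-1-\<epsilon>) decay like
  r^(-3-\<epsilon>), which keeps first moments finite.

  The 1/r part of a plane Stokes flow without net force is linear in the four real first moments of
  its source. The trace Re \<integral> cnj z G does not reach the velocity. The torque is matched by
  the swirl. The two components of \<integral> z G are generated by the quadratic terms with no
  structure forcing them to vanish, which is why exactly two parameters \<open>a\<close> appear.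

  The iteration acts on the source and not on the velocity: the moment conditions are closed linear
  conditions on sources, and the Stokes velocity of a decaying continuous source is C^1 with
  quantitative decay, just what the advection terms require.\<close>

text \<open>Division by zero yields zero, so these conditions force the kernels to vanish at the origin.\<close>

definition kernel_growth :: "(complex \<Rightarrow> complex) \<Rightarrow> bool" where
  "kernel_growth K \<longleftrightarrow> K \<in> borel_measurable borel \<and>
     (\<exists>c\<ge>0. \<forall>z. norm (K z) \<le> c * (norm z + 1 / norm z))"

text \<open>The increment bound is modelled on 1/(z - w) - 1/z = w / (z (z - w)). Keeping both |z|
  and |z - w| in the denominator makes it valid for large w as well as for small w.\<close>

definition kernel_singular :: "(complex \<Rightarrow> complex) \<Rightarrow> bool" where
  "kernel_singular K \<longleftrightarrow> K \<in> borel_measurable borel \<and>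
     (\<exists>c\<ge>0. \<forall>z. norm (K z) \<le> c / norm z) \<and>
     (\<exists>c\<ge>0. \<forall>z w. z \<noteq> 0 \<longrightarrow> z \<noteq> w \<longrightarrow>
        norm (K (z - w) - K z) \<le> c * norm w / (norm z * norm (z - w)))"

text \<open>The remainder bound is global in \<open>w\<close>: small \<open>w\<close> gives differentiability of convolutions, and
  taking for \<open>w\<close> the variable of integration gives their decay at infinity.\<close>

definition kernel_taylor :: "nat \<Rightarrow> (complex \<Rightarrow> complex) \<Rightarrow> (complex \<Rightarrow> complex) \<Rightarrow> (complex \<Rightarrow> complex) \<Rightarrow> bool" where
  "kernel_taylor n K \<alpha> \<beta> \<longleftrightarrow> (\<exists>c\<ge>0. \<forall>z w. z \<noteq> 0 \<longrightarrow> z \<noteq> w \<longrightarrow>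
     norm (K (z - w) - (K z - \<alpha> z * w - \<beta> z * cnj w))
       \<le> c * (norm w)\<^sup>2 / (norm z ^ n * norm (z - w)))"

text \<open>\<open>ker_log\<close> and \<open>ker_phase\<close>, the latter being e^(2i\<theta>),
  are the two parts of the plane Stokeslet in complex notation. The other three are the kernels that
  its first derivatives produce.\<close>

definition ker_log :: "complex \<Rightarrow> complex" where "ker_log z = of_real (ln (norm z))"
definition ker_phase :: "complex \<Rightarrow> complex" where "ker_phase z = z / cnj z"
definition ker_inv :: "complex \<Rightarrow> complex" where "ker_inv z = 1 / z"
definition ker_cinv :: "complex \<Rightarrow> complex" where "ker_cinv z = 1 / cnj z"
definition ker_strain :: "complex \<Rightarrow> complex" where "ker_strain z = z / (cnj z)\<^sup>2"

lemma measurable_cnj[measurable]: "cnj \<in> borel_measurable borel"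
  by (intro borel_measurable_continuous_onI continuous_intros)

lemma kernel_singular_imp_growth: "kernel_singular K \<Longrightarrow> kernel_growth K"
  unfolding kernel_singular_def kernel_growth_def
proof (elim conjE exE, intro conjI exI allI)
  fix c z assume "\<forall>z. norm (K z) \<le> c / norm z" and c: "0 \<le> c"
  hence "norm (K z) \<le> c * (1 / norm z)" by simp
  also have "\<dots> \<le> c * (norm z + 1 / norm z)" using c by (intro mult_left_mono) auto
  finally show "norm (K z) \<le> c * (norm z + 1 / norm z)" .
qed

section \<open>First-order expansions of the kernels with global remainder bounds\<close>

text \<open>The factor 1/|1 - t| pays for the logarithmic singularity at t = 1, so the quadratic
  bound holds for every other t. With s = |1 - t|, both halves replace ln s by a rational bound, s -
  1 from above and 1 - 1/s from below; the relation s^2 = 1 - 2 Re t + |t|^2 then leaves a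
  polynomial inequality.\<close>

lemma log_plus_Re_bound:
  fixes t :: complex
  assumes "t \<noteq> 1"
  shows "\<bar>ln (norm (1 - t)) + Re t\<bar> \<le> 2 * (norm t)\<^sup>2 / norm (1 - t)"
proof -
  define s where "s = norm (1 - t)"
  define a where "a = Re t"
  define n where "n = norm t"
  have s: "s > 0" using assms by (simp add: s_def)
  have n0: "n \<ge> 0" by (simp add: n_def)
  have sq: "s\<^sup>2 = 1 - 2 * a + n\<^sup>2"
    unfolding s_def a_def n_def cmod_power2 by (simp add: power2_eq_square algebra_simps)
  have an: "\<bar>a\<bar> \<le> n" unfolding a_def n_def by (rule abs_Re_le_cmod)
  have sn: "\<bar>s - 1\<bar> \<le> n"
    unfolding s_def n_def
    using norm_triangle_ineq3[of "1 - t" 1] by simp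
  have prod: "\<bar>a * (s - 1)\<bar> \<le> n\<^sup>2"
    unfolding abs_mult power2_eq_square by (intro mult_mono an sn) (auto simp: n0)
  have "ln s \<le> s - 1" using ln_le_minus_one[OF s] .
  have n2: "n\<^sup>2 = s\<^sup>2 - 1 + 2 * a" using sq by simp
  have up: "ln s + a \<le> 2 * n\<^sup>2 / s"
  proof -
    have "(s - 1 + a) * (s + 1) = n\<^sup>2 + a * (s - 1)"
      unfolding n2 by (simp add: algebra_simps power2_eq_square)
    also have "\<dots> \<le> 2 * n\<^sup>2" using prod by linarith
    finally have "s - 1 + a \<le> 2 * n\<^sup>2 / (s + 1)"
      using s by (simp add: pos_le_divide_eq)
    also have "\<dots> \<le> 2 * n\<^sup>2 / s" using s by (intro divide_left_mono) auto
    finally show ?thesis using \<open>ln s \<le> s - 1\<close> by linarith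
  qed
  have lo: "- (2 * n\<^sup>2 / s) \<le> ln s + a"
  proof -
    have "ln (1 / s) \<le> 1 / s - 1" using s by (intro ln_le_minus_one) simp
    hence l: "1 - 1 / s \<le> ln s" using s by (simp add: ln_div)
    have e: "(1 - 1 / s + a) * (s * (s + 1)) = n\<^sup>2 + (a * (s - 1)) * (s + 2)"
      unfolding n2 using s by (simp add: field_simps power2_eq_square)
    have "- (n\<^sup>2 * (s + 2)) \<le> (a * (s - 1)) * (s + 2)"
    proof -
      have "- n\<^sup>2 \<le> a * (s - 1)" using prod by linarith
      from mult_right_mono[OF this, of "s + 2"] s show ?thesis by simp
    qed
    hence "- (2 * n\<^sup>2 * (s + 1)) \<le> (1 - 1 / s + a) * (s * (s + 1))"
    proof -
      have "0 \<le> n\<^sup>2 * s" "0 \<le> n\<^sup>2" using s by auto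
      moreover have "n\<^sup>2 + - (n\<^sup>2 * (s + 2)) - (- (2 * n\<^sup>2 * (s + 1))) = n\<^sup>2 * s + n\<^sup>2"
        by (simp add: algebra_simps)
      ultimately have "- (2 * n\<^sup>2 * (s + 1)) \<le> n\<^sup>2 + - (n\<^sup>2 * (s + 2))" by linarith
      also have "\<dots> \<le> n\<^sup>2 + (a * (s - 1)) * (s + 2)"
        using \<open>- (n\<^sup>2 * (s + 2)) \<le> (a * (s - 1)) * (s + 2)\<close> by (rule add_left_mono)
      finally show ?thesis unfolding e .
    qed
    hence "- (2 * n\<^sup>2 * (s + 1)) / (s * (s + 1)) \<le> 1 - 1 / s + a"
      using s by (subst pos_divide_le_eq) auto
    also have "- (2 * n\<^sup>2 * (s + 1)) / (s * (s + 1)) = - (2 * n\<^sup>2 / s)"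
      using s by simp
    finally show ?thesis using l by linarith
  qed
  show ?thesis using up lo unfolding s_def a_def n_def by (simp add: abs_le_iff)
qed

text \<open>Since log|z| is half the sum of log z and its conjugate, its Wirtinger derivatives are
  1/(2z) and 1/(2 cnj z). Scaling by z reduces the estimate to the single variable t = w/z.\<close>

lemma kernel_taylor_log: "kernel_taylor 1 ker_log (\<lambda>z. 1 / 2 * ker_inv z) (\<lambda>z. 1 / 2 * ker_cinv z)"
  unfolding kernel_taylor_def
proof (intro exI[of _ 2] conjI allI impI)
  fix z w :: complex assume z: "z \<noteq> 0" and zw: "z \<noteq> w"
  define t where "t = w / z"
  have t1: "t \<noteq> 1" using z zw by (auto simp: t_def)
  have zt: "z - w = z * (1 - t)" using z by (simp add: t_def algebra_simps)
  have nn: "norm (z - w) = norm z * norm (1 - t)" unfolding zt norm_mult ..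
  have "ker_log (z - w) - (ker_log z - 1 / 2 * ker_inv z * w - 1 / 2 * ker_cinv z * cnj w)
      = of_real (ln (norm (1 - t)) + Re t)"
  proof -
    have l: "ker_log (z - w) = ker_log z + of_real (ln (norm (1 - t)))"
      using z t1 unfolding ker_log_def nn by (simp add: ln_mult)
    have "1 / 2 * ker_inv z * w + 1 / 2 * ker_cinv z * cnj w = 1 / 2 * (t + cnj t)"
      unfolding ker_inv_def ker_cinv_def t_def by (simp add: algebra_simps)
    also have "\<dots> = of_real (Re t)" unfolding complex_add_cnj by simp
    finally show ?thesis unfolding l by (simp add: algebra_simps)
  qed
  hence "norm (ker_log (z - w) - (ker_log z - 1 / 2 * ker_inv z * w - 1 / 2 * ker_cinv z * cnj w))
     \<le> 2 * (norm t)\<^sup>2 / norm (1 - t)"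
    using log_plus_Re_bound[OF t1] by (metis norm_of_real real_norm_def)
  also have "\<dots> = 2 * (norm w)\<^sup>2 / (norm z ^ 1 * norm (z - w))"
    unfolding nn using z by (simp add: t_def norm_divide field_simps power2_eq_square)
  finally show "norm (ker_log (z - w) - (ker_log z - 1 / 2 * ker_inv z * w - 1 / 2 * ker_cinv z * cnj w))
     \<le> 2 * (norm w)\<^sup>2 / (norm z ^ 1 * norm (z - w))" .
qed simp

text \<open>The remainder is an explicit rational function. Its numerator contains z cnj w - w cnj
  z, of size at most 2 |z| |w|, which cancels one of the two powers of |z| in the
  denominator.\<close>

lemma phase_taylor:
  assumes z: "z \<noteq> 0" and zw: "z \<noteq> w"
  shows "norm (ker_phase (z - w) - (ker_phase z - ker_cinv z * w - (- ker_strain z) * cnj w))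
       \<le> 2 * (norm w)\<^sup>2 / (norm z * norm (z - w))"
proof -
  have nz: "cnj z \<noteq> 0" "cnj (z - w) \<noteq> 0" "cnj z - cnj w \<noteq> 0" using z zw
    by (auto simp flip: complex_cnj_diff)
  have "ker_phase (z - w) - (ker_phase z - ker_cinv z * w - (- ker_strain z) * cnj w)
     = (z * cnj w - w * cnj z) * cnj w / ((cnj z)\<^sup>2 * cnj (z - w))"
    unfolding ker_phase_def ker_cinv_def ker_strain_def using nz
    by (simp add: field_simps power2_eq_square)
  also have "norm \<dots> = norm (z * cnj w - w * cnj z) * norm w / ((norm z)\<^sup>2 * norm (z - w))"
    by (simp add: norm_mult norm_divide norm_power flip: complex_cnj_diff)
  also have "\<dots> \<le> (2 * norm z * norm w) * norm w / ((norm z)\<^sup>2 * norm (z - w))"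
    by (intro divide_right_mono mult_right_mono order_trans[OF norm_triangle_ineq4]) (auto simp: norm_mult)
  also have "\<dots> = 2 * (norm w)\<^sup>2 / (norm z * norm (z - w))"
    using z zw by (simp add: field_simps power2_eq_square)
  finally show ?thesis .
qed

lemma kernel_taylor_phase: "kernel_taylor 1 ker_phase ker_cinv (\<lambda>z. - ker_strain z)"
  unfolding kernel_taylor_def using phase_taylor by (intro exI[of _ 2]) simp

text \<open>The numerator z cnj w - w cnj z does not change when z is replaced by z - w, so either
  factor of the denominator can be cancelled. Both variants are needed for the product
  \<open>ker_strain\<close>.\<close>

lemma phase_diff:
  assumes z: "z \<noteq> 0" and zw: "z \<noteq> w"
  shows "norm (ker_phase (z - w) - ker_phase z) \<le> 2 * norm w / norm (z - w)"
    and "norm (ker_phase (z - w) - ker_phase z) \<le> 2 * norm w / norm z"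
proof -
  have nz: "cnj z \<noteq> 0" "cnj z - cnj w \<noteq> 0" using z zw
    by (auto simp flip: complex_cnj_diff)
  have e: "ker_phase (z - w) - ker_phase z = (z * cnj w - w * cnj z) / (cnj z * cnj (z - w))"
    unfolding ker_phase_def using nz by (simp add: field_simps)
  have e2: "z * cnj w - w * cnj z = (z - w) * cnj w - w * cnj (z - w)"
    by (simp add: algebra_simps)
  have n: "norm (ker_phase (z - w) - ker_phase z)
      = norm (z * cnj w - w * cnj z) / (norm z * norm (z - w))"
    unfolding e by (simp add: norm_mult norm_divide flip: complex_cnj_diff)
  have "norm (z * cnj w - w * cnj z) / (norm z * norm (z - w))
      \<le> (2 * norm z * norm w) / (norm z * norm (z - w))"
    by (intro divide_right_mono order_trans[OF norm_triangle_ineq4]) (auto simp: norm_mult)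
  thus "norm (ker_phase (z - w) - ker_phase z) \<le> 2 * norm w / norm (z - w)"
    unfolding n using z by simp
  have "norm (z * cnj w - w * cnj z) / (norm z * norm (z - w))
      \<le> (2 * norm (z - w) * norm w) / (norm z * norm (z - w))"
    unfolding e2 by (intro divide_right_mono order_trans[OF norm_triangle_ineq4])
      (auto simp: norm_mult simp flip: complex_cnj_diff)
  thus "norm (ker_phase (z - w) - ker_phase z) \<le> 2 * norm w / norm z"
    unfolding n using zw by simp
qed

lemma norm_phase_le: "norm (ker_phase z) \<le> 1"
  by (simp add: ker_phase_def norm_divide)

lemma cinv_diff:
  assumes z: "z \<noteq> 0" and zw: "z \<noteq> w"
  shows "ker_cinv (z - w) - ker_cinv z = cnj w / (cnj z * cnj (z - w))"
    and "ker_cinv (z - w) - ker_cinv z - cnj w / (cnj z)\<^sup>2 = (cnj w)\<^sup>2 / ((cnj z)\<^sup>2 * cnj (z - w))"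
proof -
  have nz: "cnj z \<noteq> 0" "cnj z - cnj w \<noteq> 0" using z zw
    by (auto simp flip: complex_cnj_diff)
  thus "ker_cinv (z - w) - ker_cinv z = cnj w / (cnj z * cnj (z - w))"
    and "ker_cinv (z - w) - ker_cinv z - cnj w / (cnj z)\<^sup>2 = (cnj w)\<^sup>2 / ((cnj z)\<^sup>2 * cnj (z - w))"
    unfolding ker_cinv_def by (simp_all add: field_simps power2_eq_square)
qed

text \<open>Kernels of degree -1 have remainder exponent 2, those of degree 0 only 1. This is the
  extra power of decay of the velocity gradient compared with the velocity.\<close>

lemma kernel_taylor_cinv: "kernel_taylor 2 ker_cinv (\<lambda>z. 0) (\<lambda>z. - 1 / (cnj z)\<^sup>2)"
  unfolding kernel_taylor_def
proof (intro exI[of _ 1] conjI allI impI)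
  fix z w :: complex assume z: "z \<noteq> 0" and zw: "z \<noteq> w"
  have "ker_cinv (z - w) - (ker_cinv z - 0 * w - - 1 / (cnj z)\<^sup>2 * cnj w) = (cnj w)\<^sup>2 / ((cnj z)\<^sup>2 * cnj (z - w))"
    using cinv_diff(2)[OF z zw] by (simp add: algebra_simps)
  thus "norm (ker_cinv (z - w) - (ker_cinv z - 0 * w - - 1 / (cnj z)\<^sup>2 * cnj w))
     \<le> 1 * (norm w)\<^sup>2 / (norm z ^ 2 * norm (z - w))"
    by (simp add: norm_mult norm_divide norm_power del: complex_cnj_diff)
qed simp

lemma kernel_taylor_inv: "kernel_taylor 2 ker_inv (\<lambda>z. - 1 / z\<^sup>2) (\<lambda>z. 0)"
  unfolding kernel_taylor_def
proof (intro exI[of _ 1] conjI allI impI)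
  fix z w :: complex assume z: "z \<noteq> 0" and zw: "z \<noteq> w"
  have "ker_inv (z - w) - (ker_inv z - - 1 / z\<^sup>2 * w - 0 * cnj w) = w\<^sup>2 / (z\<^sup>2 * (z - w))"
    using z zw unfolding ker_inv_def by (simp add: field_simps power2_eq_square)
  thus "norm (ker_inv (z - w) - (ker_inv z - - 1 / z\<^sup>2 * w - 0 * cnj w))
     \<le> 1 * (norm w)\<^sup>2 / (norm z ^ 2 * norm (z - w))"
    by (simp add: norm_mult norm_divide norm_power)
qed simp

lemma strain_eq: "ker_strain z = ker_phase z * ker_cinv z"
  by (simp add: ker_strain_def ker_phase_def ker_cinv_def power2_eq_square)

text \<open>Product rule for remainders applied to \<open>ker_phase\<close> times
  \<open>ker_cinv\<close>. The three error terms contribute 1, 2 and 2, which gives the constant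
  5.\<close>

lemma kernel_taylor_strain:
  "kernel_taylor 2 ker_strain (\<lambda>z. 1 / (cnj z)\<^sup>2) (\<lambda>z. - 2 * z / (cnj z)^3)"
  unfolding kernel_taylor_def
proof (intro exI[of _ 5] conjI allI impI)
  fix z w :: complex assume z: "z \<noteq> 0" and zw: "z \<noteq> w"
  define Z' R1 where "Z' = ker_phase (z - w)"
    and "R1 = ker_phase (z - w) - (ker_phase z - ker_cinv z * w - (- ker_strain z) * cnj w)"
  define R2 where "R2 = ker_cinv (z - w) - ker_cinv z - cnj w / (cnj z)\<^sup>2"
  have cz: "cnj z \<noteq> 0" using z by simp
  have a: "ker_strain (z - w) - (ker_strain z - 1 / (cnj z)\<^sup>2 * w - - 2 * z / (cnj z)^3 * cnj w)
     = Z' * R2 + (Z' - ker_phase z) * (cnj w / (cnj z)\<^sup>2) + R1 * ker_cinv z"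
    unfolding strain_eq R1_def R2_def Z'_def
    unfolding ker_phase_def[of z] ker_cinv_def[of z]
    using cz by (simp add: field_simps power2_eq_square power3_eq_cube)
  let ?b = "(norm w)\<^sup>2 / (norm z ^ 2 * norm (z - w))"
  have R2n: "norm R2 = ?b"
    unfolding R2_def cinv_diff(2)[OF z zw] by (simp add: norm_mult norm_divide norm_power del: complex_cnj_diff)
  have b1: "norm (Z' * R2) \<le> ?b"
    unfolding norm_mult R2n Z'_def using mult_right_mono[OF norm_phase_le, of ?b "z - w"] by simp
  have "norm ((Z' - ker_phase z) * (cnj w / (cnj z)\<^sup>2)) \<le> (2 * norm w / norm (z - w)) * (norm w / (norm z)\<^sup>2)"
    unfolding norm_mult Z'_def using phase_diff(1)[OF z zw]
    by (intro mult_mono) (auto simp: norm_divide norm_power)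
  also have "\<dots> = 2 * ?b" by (simp add: power2_eq_square mult_ac)
  finally have b2: "norm ((Z' - ker_phase z) * (cnj w / (cnj z)\<^sup>2)) \<le> 2 * ?b" .
  have "norm (R1 * ker_cinv z) \<le> (2 * (norm w)\<^sup>2 / (norm z * norm (z - w))) * (1 / norm z)"
    unfolding norm_mult R1_def using phase_taylor[OF z zw]
    by (intro mult_mono) (auto simp: ker_cinv_def norm_divide)
  also have "\<dots> = 2 * ?b" by (simp add: power2_eq_square)
  finally have b3: "norm (R1 * ker_cinv z) \<le> 2 * ?b" .
  have "norm (Z' * R2 + (Z' - ker_phase z) * (cnj w / (cnj z)\<^sup>2) + R1 * ker_cinv z) \<le> 5 * ?b"
    by (rule order_trans[OF norm_triangle_ineq order_trans[OF add_right_mono[OF norm_triangle_ineq]]])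
       (use b1 b2 b3 in linarith)
  thus "norm (ker_strain (z - w) - (ker_strain z - 1 / (cnj z)\<^sup>2 * w - - 2 * z / (cnj z)^3 * cnj w))
     \<le> 5 * (norm w)\<^sup>2 / (norm z ^ 2 * norm (z - w))"
    unfolding a by simp
qed simp

section \<open>Size and increments of the kernels\<close>

lemma kernel_measurable[measurable]:
  "ker_log \<in> borel_measurable borel" "ker_phase \<in> borel_measurable borel"
  "ker_inv \<in> borel_measurable borel" "ker_cinv \<in> borel_measurable borel"
  "ker_strain \<in> borel_measurable borel"
  unfolding ker_log_def[abs_def] ker_phase_def[abs_def] ker_inv_def[abs_def] ker_cinv_def[abs_def] ker_strain_def[abs_def]
  by measurable

lemma kernel_singular_inv: "kernel_singular ker_inv"
  unfolding kernel_singular_def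
proof (intro conjI exI[of _ 1] allI impI)
  fix z w :: complex assume z: "z \<noteq> 0" and zw: "z \<noteq> w"
  have "ker_inv (z - w) - ker_inv z = w / (z * (z - w))"
    using z zw unfolding ker_inv_def by (simp add: field_simps)
  thus "norm (ker_inv (z - w) - ker_inv z) \<le> 1 * norm w / (norm z * norm (z - w))"
    by (simp add: norm_mult norm_divide)
qed (auto simp: ker_inv_def norm_divide)

lemma kernel_singular_cinv: "kernel_singular ker_cinv"
  unfolding kernel_singular_def
proof (intro conjI exI[of _ 1] allI impI)
  fix z w :: complex assume z: "z \<noteq> 0" and zw: "z \<noteq> w"
  show "norm (ker_cinv (z - w) - ker_cinv z) \<le> 1 * norm w / (norm z * norm (z - w))"
    unfolding cinv_diff(1)[OF z zw] by (simp add: norm_mult norm_divide del: complex_cnj_diff)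
qed (auto simp: ker_cinv_def norm_divide)

lemma strain_diff:
  assumes z: "z \<noteq> 0" and zw: "z \<noteq> w"
  shows "norm (ker_strain (z - w) - ker_strain z) \<le> 3 * norm w / (norm z * norm (z - w))"
proof -
  let ?b = "norm w / (norm z * norm (z - w))"
  have a: "ker_strain (z - w) - ker_strain z = (ker_phase (z - w) - ker_phase z) * ker_cinv (z - w)
     + ker_phase z * (ker_cinv (z - w) - ker_cinv z)"
    unfolding strain_eq by (simp add: algebra_simps)
  have "norm ((ker_phase (z - w) - ker_phase z) * ker_cinv (z - w)) \<le> (2 * norm w / norm z) * (1 / norm (z - w))"
    unfolding norm_mult using phase_diff(2)[OF z zw]
    by (intro mult_mono) (auto simp: ker_cinv_def norm_divide simp del: complex_cnj_diff)
  hence b1: "norm ((ker_phase (z - w) - ker_phase z) * ker_cinv (z - w)) \<le> 2 * ?b" by simp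
  have b2: "norm (ker_phase z * (ker_cinv (z - w) - ker_cinv z)) \<le> ?b"
    unfolding norm_mult cinv_diff(1)[OF z zw]
    using mult_right_mono[OF norm_phase_le, of ?b z] by (simp add: norm_mult norm_divide del: complex_cnj_diff)
  show ?thesis
    unfolding a by (rule order_trans[OF norm_triangle_ineq]) (use b1 b2 in linarith)
qed

lemma kernel_singular_strain: "kernel_singular ker_strain"
proof -
  have "norm (ker_strain z) \<le> 1 / norm z" for z
    by (simp add: ker_strain_def norm_divide norm_power) (simp add: power2_eq_square)
  moreover have "(0::real) \<le> 1" "(0::real) \<le> 3" by simp_all
  ultimately show ?thesis
    unfolding kernel_singular_def using strain_diff kernel_measurable(5) by blast
qed

lemma kernel_growth_log: "kernel_growth ker_log"
  unfolding kernel_growth_def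
proof (intro conjI exI[of _ 1] allI)
  fix z :: complex
  show "norm (ker_log z) \<le> 1 * (norm z + 1 / norm z)"
  proof (cases "z = 0")
    case False
    hence s: "norm z > 0" by simp
    have "ln (norm z) \<le> norm z - 1" by (rule ln_le_minus_one[OF s])
    moreover have "ln (1 / norm z) \<le> 1 / norm z - 1" using s by (intro ln_le_minus_one) simp
    hence "- ln (norm z) \<le> 1 / norm z - 1" using s by (simp add: ln_div)
    moreover have "1 / norm z > 0" using s by simp
    ultimately have "\<bar>ln (norm z)\<bar> \<le> norm z + 1 / norm z"
      using s unfolding abs_le_iff by linarith
    thus ?thesis unfolding ker_log_def by simp
  qed (simp add: ker_log_def)
qed auto

lemma kernel_growth_phase: "kernel_growth ker_phase"
  unfolding kernel_growth_def
proof (intro conjI exI[of _ 1] allI)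
  fix z :: complex
  show "norm (ker_phase z) \<le> 1 * (norm z + 1 / norm z)"
  proof (cases "z = 0")
    case False
    hence s: "norm z > 0" by simp
    have "0 \<le> (norm z - 1)\<^sup>2" by simp
    hence "2 * norm z \<le> (norm z)\<^sup>2 + 1" by (simp add: power2_eq_square algebra_simps)
    hence "1 * norm z \<le> (norm z)\<^sup>2 + 1" using s by linarith
    also have "\<dots> = (norm z + 1 / norm z) * norm z" using s by (simp add: field_simps power2_eq_square)
    finally have "1 \<le> norm z + 1 / norm z" using s by (simp only: mult_le_cancel_right_pos)
    thus ?thesis using norm_phase_le[of z] by simp
  qed (simp add: ker_phase_def)
qed auto

section \<open>Radial integrals and power weights\<close>

text \<open>Unlike the reciprocal of \<open>weight\<close>, these powers multiply exactly by adding
  exponents. Negative exponents are allowed and describe growth, as for the coordinate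
  \<open>cx\<close>.\<close>

definition dec :: "real \<Rightarrow> real^2 \<Rightarrow> real" where
  "dec q x = (1 + norm x) powr (- q)"

text \<open>Polar coordinates for radial integrands. Both measures assign the area of a disc to each
  half-line \<open>{..a}\<close>, and the half-lines form an intersection-stable generator of the
  Borel sets.\<close>

lemma radial_distr:
  "distr lborel borel (norm :: real^2 \<Rightarrow> real)
     = density lborel (\<lambda>r. ennreal (2 * pi * r) * indicator {0..} r)"
proof (rule measure_eqI_generator_eq[where E = "range (\<lambda>a::real. {..a})" and \<Omega> = UNIV and A = "\<lambda>i. {..real i}"])
  show "Int_stable (range (\<lambda>a::real. {..a}))"
    by (auto simp: Int_stable_def)
  have D: "emeasure (distr lborel borel (norm :: real^2 \<Rightarrow> real)) {..a} = ennreal (if a \<ge> 0 then pi * a\<^sup>2 else 0)" for a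
  proof -
    have "emeasure (distr lborel borel (norm :: real^2 \<Rightarrow> real)) {..a} = emeasure lborel (cball (0::real^2) a)"
      by (subst emeasure_distr) (auto intro!: arg_cong2[of _ _ _ _ emeasure])
    also have "\<dots> = ennreal (if a \<ge> 0 then pi * a\<^sup>2 else 0)"
    proof (cases "a \<ge> 0")
      case True thus ?thesis by (simp add: emeasure_cball unit_ball_vol_2)
    qed auto
    finally show ?thesis .
  qed
  have E: "emeasure (density lborel (\<lambda>r. ennreal (2 * pi * r) * indicator {0..} r)) {..a}
      = ennreal (if a \<ge> 0 then pi * a\<^sup>2 else 0)" for a
  proof (cases "a \<ge> 0")
    case True
    have "emeasure (density lborel (\<lambda>r. ennreal (2 * pi * r) * indicator {0..} r)) {..a}
        = (\<integral>\<^sup>+r. ennreal (2 * pi * r) * indicator {0..a} r \<partial>lborel)"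
      by (subst emeasure_density) (auto intro!: nn_integral_cong simp: indicator_def)
    also have "\<dots> = ennreal (pi * a\<^sup>2 - pi * 0\<^sup>2)"
      by (rule nn_integral_FTC_Icc) (use True in \<open>auto intro!: derivative_eq_intros\<close>)
    finally show ?thesis using True by simp
  next
    case False
    have "emeasure (density lborel (\<lambda>r. ennreal (2 * pi * r) * indicator {0..} r)) {..a}
        = (\<integral>\<^sup>+r. ennreal (2 * pi * r) * indicator {0..} r * indicator {..a} r \<partial>lborel)"
      by (subst emeasure_density) auto
    also have "\<dots> = (\<integral>\<^sup>+r. 0 \<partial>(lborel :: real measure))"
      using False by (intro nn_integral_cong) (auto simp: indicator_def)
    finally have "emeasure (density lborel (\<lambda>r. ennreal (2 * pi * r) * indicator {0..} r)) {..a} = 0"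
      by simp
    thus ?thesis using False by simp
  qed
  show "emeasure (distr lborel borel (norm :: real^2 \<Rightarrow> real)) X
      = emeasure (density lborel (\<lambda>r. ennreal (2 * pi * r) * indicator {0..} r)) X"
    if "X \<in> range (\<lambda>a::real. {..a})" for X
    using that D E by auto
  show "emeasure (distr lborel borel (norm :: real^2 \<Rightarrow> real)) {..real i} \<noteq> \<infinity>" for i
    unfolding D by simp
  show "(\<Union>i. {..real i}) = UNIV" using real_arch_simple by auto
qed (auto simp: borel_eq_atMost)

lemma radial_nn_integral:
  fixes f :: "real \<Rightarrow> ennreal"
  assumes [measurable]: "f \<in> borel_measurable borel"
  shows "(\<integral>\<^sup>+x. f (norm x) \<partial>(lborel :: (real^2) measure))
    = (\<integral>\<^sup>+r. ennreal (2 * pi * r) * indicator {0..} r * f r \<partial>lborel)"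
proof -
  have "(\<integral>\<^sup>+x. f (norm x) \<partial>(lborel :: (real^2) measure)) = (\<integral>\<^sup>+r. f r \<partial>distr lborel borel (norm :: real^2 \<Rightarrow> real))"
    by (subst nn_integral_distr) auto
  also have "\<dots> = (\<integral>\<^sup>+r. ennreal (2 * pi * r) * indicator {0..} r * f r \<partial>lborel)"
    unfolding radial_distr by (subst nn_integral_density) auto
  finally show ?thesis .
qed

lemma has_bochner_radial_FTC:
  fixes f F :: "real \<Rightarrow> real"
  assumes [measurable]: "f \<in> borel_measurable borel"
    and F: "\<And>r. 0 \<le> r \<Longrightarrow> DERIV F r :> 2 * pi * r * f r"
    and nn: "\<And>r. 0 \<le> r \<Longrightarrow> 0 \<le> f r"
    and T: "(F \<longlongrightarrow> T) at_top" and v: "T - F 0 = v" "0 \<le> v"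
  shows "has_bochner_integral lborel (\<lambda>x::real^2. f (norm x)) v"
proof (rule has_bochner_integral_nn_integral)
  have "(\<integral>\<^sup>+x. ennreal (f (norm x)) \<partial>(lborel :: (real^2) measure))
     = (\<integral>\<^sup>+r. ennreal (2 * pi * r) * indicator {0..} r * ennreal (f r) \<partial>lborel)"
    by (subst radial_nn_integral[where f = "\<lambda>r. ennreal (f r)"]) auto
  also have "\<dots> = (\<integral>\<^sup>+r. ennreal (2 * pi * r * f r) * indicator {0..} r \<partial>lborel)"
    using nn by (intro nn_integral_cong) (auto simp: indicator_def ennreal_mult[symmetric])
  also have "\<dots> = ennreal (T - F 0)"
    by (rule nn_integral_FTC_atLeast) (use assms in auto)
  finally show "(\<integral>\<^sup>+x. ennreal (f (norm x)) \<partial>(lborel :: (real^2) measure)) = ennreal v" using v by simp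
qed (use v nn in auto)

text \<open>Eight times this value is the torque 4 \<pi> of \<open>vortex_source\<close>; it fixes
  the factor between M and the strength of the swirl.\<close>

lemma integral_vortex_moment:
  "has_bochner_integral lborel (\<lambda>x::real^2. (norm x)\<^sup>2 / (1 + (norm x)\<^sup>2)^3) (pi / 2)"
proof (rule has_bochner_radial_FTC[where F = "\<lambda>r. pi / 2 * (1 - 1 / (1 + r\<^sup>2))\<^sup>2" and T = "pi / 2 * (1 - 0)\<^sup>2"])
  fix r :: real
  have p: "1 + r\<^sup>2 > 0" by (simp add: add_pos_nonneg)
  have e: "1 - 1 / (1 + r\<^sup>2) = r\<^sup>2 / (1 + r\<^sup>2)" using p by (simp add: field_simps)
  have "((\<lambda>r. pi / 2 * (1 - 1 / (1 + r\<^sup>2))\<^sup>2) has_real_derivative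
      pi * (1 - 1 / (1 + r\<^sup>2)) * (2 * r / (1 + r\<^sup>2)\<^sup>2)) (at r)"
    using p by (auto intro!: derivative_eq_intros simp: power2_eq_square)
  moreover have "pi * (1 - 1 / (1 + r\<^sup>2)) * (2 * r / (1 + r\<^sup>2)\<^sup>2) = 2 * pi * r * (r\<^sup>2 / (1 + r\<^sup>2)^3)"
    unfolding e using p by (simp add: field_simps eval_nat_numeral)
  ultimately show "((\<lambda>r. pi / 2 * (1 - 1 / (1 + r\<^sup>2))\<^sup>2) has_real_derivative 2 * pi * r * (r\<^sup>2 / (1 + r\<^sup>2)^3)) (at r)"
    by simp
next
  have "filterlim (\<lambda>r::real. 1 + r\<^sup>2) at_top at_top"
    by (intro filterlim_tendsto_add_at_top[OF tendsto_const] filterlim_pow_at_top filterlim_ident) auto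
  hence "((\<lambda>r::real. 1 / (1 + r\<^sup>2)) \<longlongrightarrow> 0) at_top"
    by (intro tendsto_divide_0[OF tendsto_const] filterlim_at_top_imp_at_infinity)
  thus "((\<lambda>r::real. pi / 2 * (1 - 1 / (1 + r\<^sup>2))\<^sup>2) \<longlongrightarrow> pi / 2 * (1 - 0)\<^sup>2) at_top"
    by (intro tendsto_intros)
qed auto

text \<open>The integrand is the cnj z derivative of cnj z / (|z|^2 + d^2), a smooth substitute for
  1/z. That the mass does not depend on d makes it \<pi> times an approximate identity as d tends to
  0.\<close>

lemma integral_poisson_kernel:
  assumes d: "d > 0"
  shows "has_bochner_integral lborel (\<lambda>x::real^2. d\<^sup>2 / ((norm x)\<^sup>2 + d\<^sup>2)\<^sup>2) pi"
proof (rule has_bochner_radial_FTC[where F = "\<lambda>r. - (pi * d\<^sup>2 * (1 / (r\<^sup>2 + d\<^sup>2)))" and T = "- (pi * d\<^sup>2 * 0)"])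
  fix r :: real
  have p: "r\<^sup>2 + d\<^sup>2 > 0" using d by (simp add: add_nonneg_pos)
  thus "((\<lambda>r. - (pi * d\<^sup>2 * (1 / (r\<^sup>2 + d\<^sup>2)))) has_real_derivative 2 * pi * r * (d\<^sup>2 / (r\<^sup>2 + d\<^sup>2)\<^sup>2)) (at r)"
    by (auto intro!: derivative_eq_intros simp: power2_eq_square)
next
  have "filterlim (\<lambda>r::real. d\<^sup>2 + r\<^sup>2) at_top at_top"
    by (intro filterlim_tendsto_add_at_top[OF tendsto_const] filterlim_pow_at_top filterlim_ident) auto
  hence "((\<lambda>r::real. 1 / (r\<^sup>2 + d\<^sup>2)) \<longlongrightarrow> 0) at_top"
    by (intro tendsto_divide_0[OF tendsto_const] filterlim_at_top_imp_at_infinity) (simp add: add.commute)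
  thus "((\<lambda>r. - (pi * d\<^sup>2 * (1 / (r\<^sup>2 + d\<^sup>2)))) \<longlongrightarrow> - (pi * d\<^sup>2 * 0)) at_top"
    by (intro tendsto_intros)
qed (use d in auto)

text \<open>This value explains the factor 1/\<pi> in the forcing: the z-moment of the corrector is
  then exactly the complex parameter in front of it.\<close>

lemma integral_gaussian_moment:
  "has_bochner_integral lborel (\<lambda>x::real^2. (norm x)\<^sup>2 * exp (- (norm x)\<^sup>2)) pi"
proof (rule has_bochner_radial_FTC[where F = "\<lambda>r. - (pi * ((1 + r\<^sup>2) * exp (- r\<^sup>2)))" and T = "- (pi * (0 + 0))"])
  fix r :: real
  show "((\<lambda>r. - (pi * ((1 + r\<^sup>2) * exp (- r\<^sup>2)))) has_real_derivative 2 * pi * r * (r\<^sup>2 * exp (- r\<^sup>2))) (at r)"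
    by (auto intro!: derivative_eq_intros simp: algebra_simps power2_eq_square)
next
  have l: "filterlim (\<lambda>r::real. r\<^sup>2) at_top at_top"
    by (intro filterlim_pow_at_top filterlim_ident) auto
  have "((\<lambda>r::real. (r\<^sup>2)^k / exp (r\<^sup>2)) \<longlongrightarrow> 0) at_top" for k
    using filterlim_compose[OF tendsto_power_div_exp_0 l] .
  from this[of 0] this[of 1] have "((\<lambda>r::real. exp (- r\<^sup>2) + r\<^sup>2 * exp (- r\<^sup>2)) \<longlongrightarrow> 0 + 0) at_top"
    by (intro tendsto_add) (simp_all add: exp_minus field_simps)
  thus "((\<lambda>r. - (pi * ((1 + r\<^sup>2) * exp (- r\<^sup>2)))) \<longlongrightarrow> - (pi * (0 + 0))) at_top"
    by (intro tendsto_minus tendsto_mult tendsto_const) (simp add: distrib_right)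
qed auto

lemma integral_powr_near:
  assumes k: "k < 2" and R: "R \<ge> 0"
  shows "has_bochner_integral lborel (\<lambda>x::real^2. if norm x \<le> R then norm x powr (- k) else 0)
    (2 * pi * R powr (2 - k) / (2 - k))"
proof (rule has_bochner_integral_nn_integral)
  have "(\<integral>\<^sup>+x. ennreal (if norm x \<le> R then norm x powr (- k) else 0) \<partial>(lborel :: (real^2) measure))
     = (\<integral>\<^sup>+r. ennreal (2 * pi * r) * indicator {0..} r * ennreal (if r \<le> R then r powr (- k) else 0) \<partial>lborel)"
    by (subst radial_nn_integral[where f = "\<lambda>r. ennreal (if r \<le> R then r powr (- k) else 0)"]) auto
  also have "\<dots> = (\<integral>\<^sup>+r. indicator {0..R} r * (2 * pi * r powr (1 - k)) \<partial>lborel)"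
  proof (intro nn_integral_cong)
    fix r :: real
    have "r * r powr (- k) = r powr (1 - k)" if "r > 0"
      using that by (simp add: powr_diff powr_minus field_simps)
    thus "ennreal (2 * pi * r) * indicator {0..} r * ennreal (if r \<le> R then r powr (- k) else 0)
        = ennreal (indicator {0..R} r * (2 * pi * r powr (1 - k)))"
      by (cases "r > 0") (auto simp: indicator_def ennreal_mult[symmetric] mult.assoc)
  qed
  also have "\<dots> = ennreal (2 * pi * (R powr (1 - k + 1) / (1 - k + 1)))"
    by (intro nn_integral_has_integral_lebesgue has_integral_mult_right has_integral_powr_from_0) (use k R in auto)
  finally show "(\<integral>\<^sup>+x. ennreal (if norm x \<le> R then norm x powr (- k) else 0) \<partial>(lborel :: (real^2) measure))
     = ennreal (2 * pi * R powr (2 - k) / (2 - k))" by (simp add: algebra_simps)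
qed (use k in auto)

lemma integral_powr_far:
  assumes k: "k > 2" and R: "R > 0"
  shows "has_bochner_integral lborel (\<lambda>x::real^2. if R \<le> norm x then norm x powr (- k) else 0)
    (2 * pi * R powr (2 - k) / (k - 2))"
proof (rule has_bochner_integral_nn_integral)
  have "(\<integral>\<^sup>+x. ennreal (if R \<le> norm x then norm x powr (- k) else 0) \<partial>(lborel :: (real^2) measure))
     = (\<integral>\<^sup>+r. ennreal (2 * pi * r) * indicator {0..} r * ennreal (if R \<le> r then r powr (- k) else 0) \<partial>lborel)"
    by (subst radial_nn_integral[where f = "\<lambda>r. ennreal (if R \<le> r then r powr (- k) else 0)"]) auto
  also have "\<dots> = (\<integral>\<^sup>+r. indicator {R..} r * (2 * pi * r powr (1 - k)) \<partial>lborel)"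
  proof (intro nn_integral_cong)
    fix r :: real
    have "r * r powr (- k) = r powr (1 - k)" if "r > 0"
      using that by (simp add: powr_diff powr_minus field_simps)
    thus "ennreal (2 * pi * r) * indicator {0..} r * ennreal (if R \<le> r then r powr (- k) else 0)
        = ennreal (indicator {R..} r * (2 * pi * r powr (1 - k)))"
      using R by (cases "r > 0") (auto simp: indicator_def ennreal_mult[symmetric] mult.assoc)
  qed
  also have "\<dots> = ennreal (2 * pi * (-(R powr (1 - k + 1)) / (1 - k + 1)))"
    by (intro nn_integral_has_integral_lebesgue has_integral_mult_right has_integral_powr_to_inf) (use k R in auto)
  also have "2 * pi * (-(R powr (1 - k + 1)) / (1 - k + 1)) = 2 * pi * R powr (2 - k) / (k - 2)"
    using k by (simp add: field_simps)
  finally show "(\<integral>\<^sup>+x. ennreal (if R \<le> norm x then norm x powr (- k) else 0) \<partial>(lborel :: (real^2) measure))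
     = ennreal (2 * pi * R powr (2 - k) / (k - 2))" .
qed (use k in auto)

lemma has_bochner_translate:
  fixes f :: "'a::euclidean_space \<Rightarrow> 'b::{banach, second_countable_topology}"
  assumes "has_bochner_integral lborel f v"
  shows "has_bochner_integral lborel (\<lambda>y. f (c + y)) v"
proof -
  have "f \<in> borel_measurable borel" using assms by (auto dest: borel_measurable_has_bochner_integral)
  hence "has_bochner_integral (distr lborel borel ((+) c)) f v \<longleftrightarrow> has_bochner_integral lborel (\<lambda>y. f (c + y)) v"
    unfolding has_bochner_integral_iff by (subst integrable_distr_eq integral_distr; simp)+
  thus ?thesis using assms by (simp add: lborel_distr_plus)
qed

lemma has_bochner_radial_translate:
  fixes f :: "real \<Rightarrow> real" and x :: "real^2"
  assumes "has_bochner_integral lborel (\<lambda>y::real^2. f (norm y)) v"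
  shows "has_bochner_integral lborel (\<lambda>y. f (norm (x - y))) v"
  using has_bochner_translate[OF assms, of "- x"] by (simp add: norm_minus_commute)

section \<open>Algebra and integrability of the power weights\<close>

lemma dec_pos[simp]: "dec q x > 0" "dec q x \<ge> 0" "dec q x \<noteq> 0"
proof -
  have "1 + norm x > 0" by (simp add: add_pos_nonneg)
  thus "dec q x > 0" "dec q x \<ge> 0" "dec q x \<noteq> 0" by (auto simp: dec_def)
qed

lemma dec_le_1: "q \<ge> 0 \<Longrightarrow> dec q x \<le> 1"
  unfolding dec_def using powr_mono[of "-q" 0 "1 + norm x"] by (cases "1 + norm x = 0") auto

lemma dec_mult: "dec p x * dec q x = dec (p + q) x"
proof -
  have "1 + norm x > 0" by (simp add: add_pos_nonneg)
  thus ?thesis by (simp add: dec_def flip: powr_add)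
qed

lemma dec_mono: "p \<le> q \<Longrightarrow> dec q x \<le> dec p x"
  unfolding dec_def by (intro powr_mono) auto

lemma dec_0[simp]: "dec 0 x = 1"
proof -
  have "1 + norm x > 0" by (simp add: add_pos_nonneg)
  thus ?thesis by (simp add: dec_def)
qed

lemma dec_1: "dec 1 x = 1 / (1 + norm x)"
proof -
  have "1 + norm x > 0" by (simp add: add_pos_nonneg)
  thus ?thesis by (simp add: dec_def powr_minus field_simps)
qed

lemma norm_mult_dec_le: "norm x * dec q x \<le> dec (q - 1) x"
proof -
  have p: "1 + norm x > 0" by (simp add: add_pos_nonneg)
  have "norm x * dec q x = norm x * dec 1 x * dec (q - 1) x"
    by (simp add: dec_mult mult.assoc)
  also have "\<dots> \<le> 1 * dec (q - 1) x"
    using p by (intro mult_right_mono) (auto simp: dec_1)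
  finally show ?thesis by simp
qed

lemma dec_le_powr: "x \<noteq> 0 \<Longrightarrow> q \<ge> 0 \<Longrightarrow> dec q x \<le> norm x powr (- q)"
  unfolding dec_def by (intro powr_mono2') auto

lemma continuous_dec: "continuous_on S (dec q)"
proof -
  have "1 + norm x > 0" for x :: "real^2" by (simp add: add_pos_nonneg)
  thus ?thesis unfolding dec_def by (intro continuous_intros) (metis less_irrefl)
qed

lemma measurable_dec[measurable]: "dec q \<in> borel_measurable borel"
  by (intro borel_measurable_continuous_onI continuous_dec)

lemma integrable_dec:
  assumes q: "q > 2"
  shows "integrable lborel (dec q)"
proof (rule Bochner_Integration.integrable_bound)
  show "integrable lborel (\<lambda>x::real^2. indicator (cball 0 1) x + (if 1 \<le> norm x then norm x powr (- q) else 0))"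
    using integral_powr_far[OF q, of 1]
    by (intro Bochner_Integration.integrable_add integrable_real_indicator)
       (use emeasure_lborel_cball_finite[of "0 :: real^2" 1] in \<open>auto simp: has_bochner_integral_iff\<close>)
  show "AE x in lborel. norm (dec q x) \<le> norm (indicator (cball 0 1) x + (if 1 \<le> norm x then norm x powr (- q) else 0))"
  proof (intro AE_I2)
    fix x :: "real^2"
    show "norm (dec q x) \<le> norm (indicator (cball 0 1) x + (if 1 \<le> norm x then norm x powr (- q) else 0))"
    proof (cases "norm x \<le> 1")
      case True
      have "dec q x \<le> 1" using q by (intro dec_le_1) simp
      thus ?thesis using True by (auto simp: indicator_def)
    next
      case False
      hence "dec q x \<le> norm x powr (- q)" using q by (intro dec_le_powr) auto
      thus ?thesis using False by (auto simp: indicator_def)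
    qed
  qed
qed auto

lemma integrable_of_dec:
  fixes f :: "real^2 \<Rightarrow> 'b::{banach, second_countable_topology}"
  assumes "f \<in> borel_measurable borel" "q > 2" "\<And>x. norm (f x) \<le> c * dec q x"
  shows "integrable lborel f"
proof (rule Bochner_Integration.integrable_bound[OF integrable_mult_right[OF integrable_dec[OF assms(2)], of c]])
  show "AE x in lborel. norm (f x) \<le> norm (c * dec q x)"
    using assms(3) by (intro AE_I2) (metis abs_ge_self order_trans real_norm_def)
qed (use assms in simp)

lemma norm_integral_le_dec:
  fixes f :: "real^2 \<Rightarrow> 'b::{banach, second_countable_topology}"
  assumes "f \<in> borel_measurable borel" "q > 2" "\<And>x. norm (f x) \<le> c * dec q x"
  shows "norm (integral\<^sup>L lborel f) \<le> c * integral\<^sup>L lborel (dec q)"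
proof -
  have "norm (integral\<^sup>L lborel f) \<le> (\<integral>x. norm (f x) \<partial>lborel)" by (rule integral_norm_bound)
  also have "\<dots> \<le> (\<integral>x. c * dec q x \<partial>lborel)"
    using integrable_of_dec[OF assms] integrable_dec[OF assms(2)] assms(3)
    by (intro integral_mono) auto
  finally show ?thesis by simp
qed

text \<open>The bound is uniform in x: inside the unit disc around x the weight is replaced by 1,
  outside it the kernel is.\<close>

lemma singular_dec_integral:
  assumes k: "0 \<le> k" "k < 2" and q: "q > 2"
  shows "integrable lborel (\<lambda>y. norm (x - y) powr (- k) * dec q y)"
    and "(\<integral>y. norm (x - y) powr (- k) * dec q y \<partial>lborel) \<le> 2 * pi / (2 - k) + integral\<^sup>L lborel (dec q)"
proof -
  define b where "b = (\<lambda>y. (if norm (x - y) \<le> 1 then norm (x - y) powr (- k) else 0) + dec q y)"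
  have hb: "has_bochner_integral lborel b (2 * pi / (2 - k) + integral\<^sup>L lborel (dec q))"
    unfolding b_def
  proof (intro has_bochner_integral_add)
    show "has_bochner_integral lborel (\<lambda>y. if norm (x - y) \<le> 1 then norm (x - y) powr (- k) else 0) (2 * pi / (2 - k))"
      using has_bochner_radial_translate[OF integral_powr_near[OF k(2), of 1], of x] by simp
  qed (use integrable_dec[OF q] in \<open>auto simp: has_bochner_integral_iff\<close>)
  have le: "norm (x - y) powr (- k) * dec q y \<le> b y" for y
  proof (cases "norm (x - y) \<le> 1")
    case True
    have "norm (x - y) powr (- k) * dec q y \<le> norm (x - y) powr (- k) * 1"
      using q by (intro mult_left_mono dec_le_1) auto
    also have "\<dots> \<le> b y" unfolding b_def using True by simp
    finally show ?thesis .
  next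
    case False
    hence "norm (x - y) powr (- k) \<le> 1" using k powr_mono[of "-k" 0 "norm (x - y)"] by (cases "x = y") auto
    hence "norm (x - y) powr (- k) * dec q y \<le> 1 * dec q y" by (intro mult_right_mono) auto
    thus ?thesis using False by (simp add: b_def)
  qed
  show i: "integrable lborel (\<lambda>y. norm (x - y) powr (- k) * dec q y)"
    by (rule Bochner_Integration.integrable_bound[of _ b])
       (use hb le in \<open>auto simp: has_bochner_integral_iff intro!: AE_I2 order_trans[OF le]\<close>)
  have "(\<integral>y. norm (x - y) powr (- k) * dec q y \<partial>lborel) \<le> (\<integral>y. b y \<partial>lborel)"
    using i hb le by (intro integral_mono) (auto simp: has_bochner_integral_iff)
  thus "(\<integral>y. norm (x - y) powr (- k) * dec q y \<partial>lborel) \<le> 2 * pi / (2 - k) + integral\<^sup>L lborel (dec q)"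
    using hb by (simp add: has_bochner_integral_iff)
qed

text \<open>The plane is cut into the disc of radius |x|/2 around 0, the one around x, and the rest.
  The condition e < 1 makes |y|^(-1-e) integrable at the origin, e > 0 makes |y|^(-2-e) integrable
  at infinity, and by homogeneity every piece scales like |x|^(-e).\<close>

lemma riesz_convolution:
  assumes e: "0 < e" "e < 1" and x: "x \<noteq> (0::real^2)"
  shows "integrable lborel (\<lambda>y. norm y powr (- 1 - e) / norm (x - y))"
    and "(\<integral>y. norm y powr (- 1 - e) / norm (x - y) \<partial>lborel)
      \<le> 2 powr e * (2 * pi / (1 - e) + 2 * pi + 4 * pi / e) * norm x powr (- e)"
proof -
  define R where "R = norm x / 2"
  have R: "R > 0" using x by (simp add: R_def)
  define b where "b = (\<lambda>y. 1 / R * (if norm y \<le> R then norm y powr (- (1 + e)) else 0)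
     + R powr (- 1 - e) * (if norm (x - y) \<le> R then norm (x - y) powr (- 1) else 0)
     + (if R \<le> norm y then norm y powr (- (2 + e)) else 0)
     + (if R \<le> norm (x - y) then norm (x - y) powr (- (2 + e)) else 0))"
  define v where "v = 1 / R * (2 * pi * R powr (2 - (1 + e)) / (2 - (1 + e)))
     + R powr (- 1 - e) * (2 * pi * R powr (2 - 1) / (2 - 1))
     + 2 * pi * R powr (2 - (2 + e)) / (2 + e - 2) + 2 * pi * R powr (2 - (2 + e)) / (2 + e - 2)"
  have hb: "has_bochner_integral lborel b v"
    unfolding b_def v_def
  proof (intro has_bochner_integral_add has_bochner_integral_mult_right)
    show "has_bochner_integral lborel (\<lambda>y. if norm (x - y) \<le> R then norm (x - y) powr (- 1) else 0)
       (2 * pi * R powr (2 - 1) / (2 - 1))"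
      by (rule has_bochner_radial_translate[OF integral_powr_near]) (use R in auto)
    show "has_bochner_integral lborel (\<lambda>y. if R \<le> norm (x - y) then norm (x - y) powr (- (2 + e)) else 0)
       (2 * pi * R powr (2 - (2 + e)) / (2 + e - 2))"
      by (rule has_bochner_radial_translate[OF integral_powr_far]) (use R e in auto)
  qed (intro integral_powr_near integral_powr_far; use R e in auto)+
  have v: "v = 2 powr e * (2 * pi / (1 - e) + 2 * pi + 4 * pi / e) * norm x powr (- e)"
  proof -
    have "R powr (2 - (1 + e)) = R * R powr (- e)" "R powr (- 1 - e) = R powr (- e) / R"
      "R powr (2 - 1) = R" "R powr (2 - (2 + e)) = R powr (- e)"
      using R by (simp_all add: powr_diff powr_minus field_simps)
    hence "v = (2 * pi / (1 - e) + 2 * pi + 4 * pi / e) * R powr (- e)"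
      unfolding v_def using R e by (simp add: algebra_simps)
    also have "R powr (- e) = 2 powr e * norm x powr (- e)"
      unfolding R_def using x by (simp add: powr_divide powr_minus field_simps)
    finally show ?thesis by (simp add: mult_ac)
  qed
  have le: "norm y powr (- 1 - e) / norm (x - y) \<le> b y" for y
  proof -
    have nn: "0 \<le> 1 / R * (if norm y \<le> R then norm y powr (- (1 + e)) else 0)"
      "0 \<le> R powr (- 1 - e) * (if norm (x - y) \<le> R then norm (x - y) powr (- 1) else 0)"
      "0 \<le> (if R \<le> norm y then norm y powr (- (2 + e)) else 0)"
      "0 \<le> (if R \<le> norm (x - y) then norm (x - y) powr (- (2 + e)) else 0)"
      using R by auto
    have tri: "2 * R \<le> norm y + norm (x - y)"
      unfolding R_def using norm_triangle_ineq[of y "x - y"] by simp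
    consider "norm y \<le> R" | "norm (x - y) \<le> R" "R < norm y" | "R < norm y" "R < norm (x - y)" by linarith
    thus ?thesis
    proof cases
      case 1
      hence "R \<le> norm (x - y)" using tri by linarith
      hence "norm y powr (- 1 - e) / norm (x - y) \<le> norm y powr (- 1 - e) / R"
        using R by (intro divide_left_mono mult_pos_pos) auto
      also have "\<dots> = 1 / R * (if norm y \<le> R then norm y powr (- (1 + e)) else 0)"
        using 1 by simp
      finally show ?thesis using nn unfolding b_def by linarith
    next
      case 2
      have "norm y powr (- 1 - e) / norm (x - y) \<le> R powr (- 1 - e) / norm (x - y)"
        using 2 R e by (intro divide_right_mono powr_mono2') auto
      also have "\<dots> = R powr (- 1 - e) * (if norm (x - y) \<le> R then norm (x - y) powr (- 1) else 0)"
        using 2 by (simp add: powr_minus powr_one' divide_inverse)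
      finally show ?thesis using nn unfolding b_def by linarith
    next
      case 3
      have p: "norm y > 0" "norm (x - y) > 0" using 3 R by linarith+
      \<comment> \<open>Away from both discs the product is at most the power -(2 + e) of the
        smaller distance, hence at most the sum of two functions radial about 0 and about x.\<close>
      define m where "m = min (norm y) (norm (x - y))"
      have m: "m > 0" using p by (simp add: m_def)
      have "norm y powr (- 1 - e) / norm (x - y) = norm y powr (- 1 - e) * norm (x - y) powr (- 1)"
        using p by (simp add: powr_minus divide_inverse)
      also have "\<dots> \<le> m powr (- 1 - e) * m powr (- 1)"
        using m e by (intro mult_mono powr_mono2') (auto simp: m_def)
      also have "\<dots> = m powr (- (2 + e))" by (simp only: powr_add[symmetric]) simp
      also have "\<dots> \<le> norm y powr (- (2 + e)) + norm (x - y) powr (- (2 + e))"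
        unfolding m_def by (auto simp: min_def)
      finally show ?thesis using nn 3 unfolding b_def by simp
    qed
  qed
  show i: "integrable lborel (\<lambda>y. norm y powr (- 1 - e) / norm (x - y))"
    by (rule Bochner_Integration.integrable_bound[of _ b])
       (use hb le in \<open>auto simp: has_bochner_integral_iff intro!: AE_I2 order_trans[OF le]\<close>)
  have "(\<integral>y. norm y powr (- 1 - e) / norm (x - y) \<partial>lborel) \<le> (\<integral>y. b y \<partial>lborel)"
    using i hb le by (intro integral_mono) (auto simp: has_bochner_integral_iff)
  thus "(\<integral>y. norm y powr (- 1 - e) / norm (x - y) \<partial>lborel)
      \<le> 2 powr e * (2 * pi / (1 - e) + 2 * pi + 4 * pi / e) * norm x powr (- e)"
    using hb v by (simp add: has_bochner_integral_iff)
qed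

section \<open>Convolution with the kernels\<close>

definition cx :: "real^2 \<Rightarrow> complex" where "cx x = Complex (x $ 1) (x $ 2)"

lemma cx_simps[simp]:
  "cx (r *\<^sub>R x) = r *\<^sub>R cx x" "cx 0 = 0" "Re (cx x) = x $ 1" "Im (cx x) = x $ 2"
  by (simp_all add: cx_def complex_eq_iff)

lemma cx_add: "cx (x + y) = cx x + cx y"
  and cx_diff: "cx (x - y) = cx x - cx y"
  by (simp_all add: cx_def complex_eq_iff)

lemma norm_cx[simp]: "norm (cx x) = norm x"
  by (simp add: cx_def cmod_def norm_vec_def L2_set_def sum_2)

lemma cx_eq_0_iff[simp]: "cx x = 0 \<longleftrightarrow> x = 0"
  by (metis norm_cx norm_eq_zero)

lemma cx_eq_iff[simp]: "cx x = cx y \<longleftrightarrow> x = y"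
  using cx_eq_0_iff[of "x - y"] by (simp add: cx_diff)

lemma bounded_linear_cx: "bounded_linear cx"
  by (rule bounded_linear_intro[of _ 1]) (auto simp: cx_add)

lemmas continuous_on_cx[continuous_intros] = bounded_linear.continuous_on[OF bounded_linear_cx]
lemmas has_derivative_cx[derivative_intros] = bounded_linear.has_derivative[OF bounded_linear_cx]

lemma measurable_cx[measurable]: "cx \<in> borel_measurable borel"
  by (intro borel_measurable_continuous_onI continuous_intros)

definition decays :: "real \<Rightarrow> real \<Rightarrow> (real^2 \<Rightarrow> complex) \<Rightarrow> bool" where
  "decays q c f \<longleftrightarrow> (\<forall>x. norm (f x) \<le> c * dec q x)"

lemma decaysD: "decays q c f \<Longrightarrow> norm (f x) \<le> c * dec q x"
  by (simp add: decays_def)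

lemma decays_nonneg: "decays q c f \<Longrightarrow> 0 \<le> c"
proof -
  assume "decays q c f"
  hence "0 \<le> c * dec q 0" by (rule order_trans[OF norm_ge_zero decaysD])
  thus ?thesis using zero_le_mult_iff[of c "dec q 0"] dec_pos(1)[of q 0] by linarith
qed

definition conv :: "(complex \<Rightarrow> complex) \<Rightarrow> (real^2 \<Rightarrow> complex) \<Rightarrow> real^2 \<Rightarrow> complex" where
  "conv K G x = (\<integral>y. K (cx (x - y)) * G y \<partial>lborel)"

text \<open>At z = 0 both sides are 0, so no case distinction is needed under the integrals.\<close>

lemma inverse_eq_powr: "1 / norm (z :: 'a::real_normed_vector) = norm z powr (- 1)"
  by (simp add: powr_minus divide_inverse)

text \<open>The linear growth of the kernel costs one power of the decay of \<open>G\<close>; hence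
  q > 3 where q > 2 would suffice for a decaying kernel.\<close>

lemma conv_integrable:
  assumes K: "kernel_growth K" and [measurable]: "G \<in> borel_measurable borel"
    and G: "decays q c G" and q: "q > 3"
  shows "integrable lborel (\<lambda>y. K (cx (x - y)) * G y)"
proof -
  from K obtain a where [measurable]: "K \<in> borel_measurable borel" and a: "a \<ge> 0"
    and Kb: "\<And>z. norm (K z) \<le> a * (norm z + 1 / norm z)"
    unfolding kernel_growth_def by blast
  have c: "c \<ge> 0" by (rule decays_nonneg[OF G])
  define b where "b = (\<lambda>y. a * c * (norm x * dec q y + dec (q - 1) y + norm (x - y) powr (- 1) * dec q y))"
  have b: "integrable lborel b"
    unfolding b_def using q
    by (intro integrable_mult_right Bochner_Integration.integrable_add integrable_dec singular_dec_integral) auto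
  show ?thesis
  proof (rule Bochner_Integration.integrable_bound[OF b])
    show "AE y in lborel. norm (K (cx (x - y)) * G y) \<le> norm (b y)"
    proof (intro AE_I2)
      fix y
      have "norm (K (cx (x - y)) * G y) \<le> (a * (norm (x - y) + 1 / norm (x - y))) * (c * dec q y)"
        unfolding norm_mult using Kb[of "cx (x - y)"] unfolding norm_cx
        by (rule mult_mono) (use decaysD[OF G, of y] a in auto)
      also have "\<dots> = a * c * (norm (x - y) * dec q y + norm (x - y) powr (- 1) * dec q y)"
        unfolding inverse_eq_powr by (simp add: algebra_simps)
      also have "\<dots> \<le> b y"
      proof -
        have "norm (x - y) * dec q y \<le> (norm x + norm y) * dec q y"
          by (intro mult_right_mono norm_triangle_ineq4) auto
        also have "\<dots> \<le> norm x * dec q y + dec (q - 1) y"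
          using norm_mult_dec_le[of y q] by (simp add: distrib_right)
        finally show ?thesis unfolding b_def using a c by (intro mult_left_mono) auto
      qed
      finally show "norm (K (cx (x - y)) * G y) \<le> norm (b y)" by simp
    qed
  qed measurable
qed

lemma conv_bounded:
  assumes K: "kernel_singular K" and q: "q > 2"
  obtains C where "C \<ge> 0"
    "\<And>G c x. G \<in> borel_measurable borel \<Longrightarrow> decays q c G \<Longrightarrow> norm (conv K G x) \<le> C * c"
proof -
  from K obtain a where Km[measurable]: "K \<in> borel_measurable borel" and a: "a \<ge> 0"
    and Kb: "\<And>z. norm (K z) \<le> a / norm z"
    unfolding kernel_singular_def by blast
  define I where "I = 2 * pi / (2 - 1) + integral\<^sup>L lborel (dec q)"
  show ?thesis
  proof
    have "integral\<^sup>L lborel (dec q) \<ge> 0" by (rule Bochner_Integration.integral_nonneg) simp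
    thus "a * I \<ge> 0" using a by (auto simp: I_def)
    fix G c x assume [measurable]: "G \<in> borel_measurable borel" and G: "decays q c G"
    have c: "c \<ge> 0" by (rule decays_nonneg[OF G])
    have S: "integrable lborel (\<lambda>y. norm (x - y) powr (- 1) * dec q y)"
      "(\<integral>y. norm (x - y) powr (- 1) * dec q y \<partial>lborel) \<le> I"
      unfolding I_def by (rule singular_dec_integral; use q in simp)+
    have le: "norm (K (cx (x - y)) * G y) \<le> a * c * (norm (x - y) powr (- 1) * dec q y)" for y
    proof -
      have "norm (K (cx (x - y)) * G y) \<le> (a / norm (x - y)) * (c * dec q y)"
        unfolding norm_mult using Kb[of "cx (x - y)"] unfolding norm_cx
        by (rule mult_mono) (use decaysD[OF G, of y] a in auto)
      also have "\<dots> = a * c * ((1 / norm (x - y)) * dec q y)" by simp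
      finally show ?thesis unfolding inverse_eq_powr .
    qed
    have i: "integrable lborel (\<lambda>y. K (cx (x - y)) * G y)"
      by (rule Bochner_Integration.integrable_bound[OF integrable_mult_right[OF S(1), of "a * c"]])
         (measurable, rule AE_I2, unfold real_norm_def, rule order_trans[OF le abs_ge_self])
    have "norm (conv K G x) \<le> (\<integral>y. norm (K (cx (x - y)) * G y) \<partial>lborel)"
      unfolding conv_def by (rule integral_norm_bound)
    also have "\<dots> \<le> (\<integral>y. a * c * (norm (x - y) powr (- 1) * dec q y) \<partial>lborel)"
      by (intro integral_mono integrable_norm i integrable_mult_right S(1) le)
    also have "\<dots> = a * c * (\<integral>y. norm (x - y) powr (- 1) * dec q y \<partial>lborel)"
      by (rule integral_mult_right_zero)
    also have "\<dots> \<le> a * c * I" using a c S(2) by (intro mult_left_mono) auto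
    finally show "norm (conv K G x) \<le> a * I * c" by (simp add: mult_ac)
  qed
qed

text \<open>Used with p = |x - y| and q = |x + h - y|, where the hypothesis on h is the triangle
  inequality. Half a power of h is given up to turn a product of two poles into a sum of single ones
  of order 3/2, which is below 2 and thus integrable in the plane.\<close>

lemma sqrt_split:
  fixes p q h :: real
  assumes "p > 0" "q > 0" "0 \<le> h" "h \<le> p + q"
  shows "h / (p * q) \<le> 2 * sqrt h * (p powr (- (3/2)) + q powr (- (3/2)))"
proof -
  \<comment> \<open>Here m is the smaller and M the larger distance, so h is at most 2 M and one
    factor sqrt h is absorbed by sqrt M.\<close>
  have 1: "h / (m * M) \<le> 2 * sqrt h * m powr (- (3/2))" if m: "0 < m" "m \<le> M" "h \<le> 2 * M" for m M
  proof -
    have M: "M > 0" using m by linarith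
    have "h = sqrt h * sqrt h" using assms by simp
    also have "\<dots> \<le> sqrt h * (2 * sqrt M)"
    proof (intro mult_left_mono)
      have "sqrt h \<le> sqrt (4 * M)" using m M by simp
      thus "sqrt h \<le> 2 * sqrt M" by (simp add: real_sqrt_mult)
    qed (use assms in simp)
    finally have "h / (m * M) \<le> sqrt h * (2 * sqrt M) / (m * M)"
      using m M by (intro divide_right_mono) auto
    also have "\<dots> = 2 * sqrt h / (m * sqrt M)"
      using m M by (simp add: field_simps)
    also have "\<dots> \<le> 2 * sqrt h / (m * sqrt m)"
      using m M assms by (intro divide_left_mono mult_left_mono mult_pos_pos) auto
    also have "\<dots> = 2 * sqrt h * m powr (- (3/2))"
    proof -
      have "m powr (3/2) = m powr (1 + 1/2)" by simp
      also have "\<dots> = m * sqrt m" using m by (subst powr_add) (simp add: powr_half_sqrt)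
      finally show ?thesis unfolding powr_minus_divide by simp
    qed
    finally show ?thesis .
  qed
  have nn: "0 \<le> 2 * sqrt h * p powr (- (3/2))" "0 \<le> 2 * sqrt h * q powr (- (3/2))" using assms by auto
  show ?thesis
  proof (cases "p \<le> q")
    case True
    from 1[of p q] True assms have "h / (p * q) \<le> 2 * sqrt h * p powr (- (3/2))" by auto
    thus ?thesis using nn unfolding distrib_left by linarith
  next
    case False
    from 1[of q p] False assms have "h / (p * q) \<le> 2 * sqrt h * q powr (- (3/2))" by (auto simp: mult.commute)
    thus ?thesis using nn unfolding distrib_left by linarith
  qed
qed

text \<open>The factor \<open>sqrt |h|\<close> gained here gives both continuity and differentiability of convolutions.\<close>

lemma increment_integral_bound:
  fixes D :: "real^2 \<Rightarrow> complex"
  assumes D: "integrable lborel (\<lambda>y. D y * G y)" and G: "decays q c G" and q: "q > 2" and a: "a \<ge> 0" and s: "s \<ge> 0"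
    and le: "\<And>y. y \<noteq> x \<Longrightarrow> y \<noteq> x + h \<Longrightarrow> norm (D y) \<le> a * s * (norm h / (norm (x - y) * norm (x + h - y)))"
  shows "norm (\<integral>y. D y * G y \<partial>lborel) \<le> 4 * a * c * (4 * pi + integral\<^sup>L lborel (dec q)) * (s * sqrt (norm h))"
proof -
  have c: "c \<ge> 0" by (rule decays_nonneg[OF G])
  define f where "f = (\<lambda>x y. norm (x - y) powr (- (3/2)) * dec q y)"
  have S: "integrable lborel (f z)" "integral\<^sup>L lborel (f z) \<le> 4 * pi + integral\<^sup>L lborel (dec q)" for z
    using singular_dec_integral[of "3/2" q z, OF _ _ q] unfolding f_def by auto
  have "norm (\<integral>y. D y * G y \<partial>lborel) \<le> (\<integral>y. norm (D y * G y) \<partial>lborel)"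
    by (rule integral_norm_bound)
  also have "\<dots> \<le> (\<integral>y. 2 * a * c * s * sqrt (norm h) * (f x y + f (x + h) y) \<partial>lborel)"
  proof (rule integral_mono_AE)
    show "AE y in lborel. norm (D y * G y) \<le> 2 * a * c * s * sqrt (norm h) * (f x y + f (x + h) y)"
      using AE_lborel_singleton[of x] AE_lborel_singleton[of "x + h"]
    proof eventually_elim
      case (elim y)
      have "norm h \<le> norm (x - y) + norm (x + h - y)"
        using norm_triangle_ineq4[of "x + h - y" "x - y"] by simp
      hence "norm h / (norm (x - y) * norm (x + h - y))
         \<le> 2 * sqrt (norm h) * (norm (x - y) powr (- (3/2)) + norm (x + h - y) powr (- (3/2)))"
        using elim by (intro sqrt_split) auto
      hence "a * s * (norm h / (norm (x - y) * norm (x + h - y)))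
         \<le> a * s * (2 * sqrt (norm h) * (norm (x - y) powr (- (3/2)) + norm (x + h - y) powr (- (3/2))))"
        using a s by (intro mult_left_mono) auto
      with le[of y] elim have "norm (D y)
         \<le> a * s * (2 * sqrt (norm h) * (norm (x - y) powr (- (3/2)) + norm (x + h - y) powr (- (3/2))))"
        by linarith
      hence "norm (D y * G y)
         \<le> a * s * (2 * sqrt (norm h) * (norm (x - y) powr (- (3/2)) + norm (x + h - y) powr (- (3/2)))) * (c * dec q y)"
        unfolding norm_mult by (rule mult_mono) (use decaysD[OF G, of y] a s in auto)
      thus ?case by (simp add: f_def algebra_simps)
    qed
  qed (use D S in auto)
  also have "\<dots> = 2 * a * c * s * sqrt (norm h) * (integral\<^sup>L lborel (f x) + integral\<^sup>L lborel (f (x + h)))"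
    using S by simp
  also have "\<dots> \<le> 2 * a * c * s * sqrt (norm h) * (2 * (4 * pi + integral\<^sup>L lborel (dec q)))"
    using S(2)[of x] S(2)[of "x + h"] a c s by (intro mult_left_mono) auto
  finally show ?thesis by (simp add: mult_ac)
qed

lemma conv_continuous:
  assumes K: "kernel_singular K" and [measurable]: "G \<in> borel_measurable borel"
    and G: "decays q c G" and q: "q > 3"
  shows "continuous_on UNIV (conv K G)"
proof -
  from K obtain a where a: "a \<ge> 0" and Kl: "\<And>z w. z \<noteq> 0 \<Longrightarrow> z \<noteq> w \<Longrightarrow>
        norm (K (z - w) - K z) \<le> a * norm w / (norm z * norm (z - w))"
    unfolding kernel_singular_def by blast
  note i = conv_integrable[OF kernel_singular_imp_growth[OF K] assms(2) G q]
  define B where "B = 4 * a * c * (4 * pi + integral\<^sup>L lborel (dec q))"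
  have "isCont (conv K G) x" for x
    unfolding isCont_iff
  proof (rule LIM_zero_cancel, rule Lim_null_comparison[of _ "\<lambda>h. B * sqrt (norm h)"])
    show "\<forall>\<^sub>F h in at 0. norm (conv K G (x + h) - conv K G x) \<le> B * sqrt (norm h)"
    proof (intro always_eventually allI)
      fix h
      have e: "conv K G (x + h) - conv K G x = (\<integral>y. (K (cx (x + h - y)) - K (cx (x - y))) * G y \<partial>lborel)"
        unfolding conv_def by (subst Bochner_Integration.integral_diff[symmetric]) (use i in \<open>auto simp: left_diff_distrib\<close>)
      have "norm (\<integral>y. (K (cx (x + h - y)) - K (cx (x - y))) * G y \<partial>lborel)
          \<le> 4 * a * c * (4 * pi + integral\<^sup>L lborel (dec q)) * (1 * sqrt (norm h))"
      proof (rule increment_integral_bound[OF _ G])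
        show "integrable lborel (\<lambda>y. (K (cx (x + h - y)) - K (cx (x - y))) * G y)"
          using Bochner_Integration.integrable_diff[OF i[of "x + h"] i[of x]] by (simp add: left_diff_distrib)
        fix y assume y: "y \<noteq> x" "y \<noteq> x + h"
        have z: "cx (x - y) \<noteq> 0" "cx (x - y) \<noteq> - cx h"
          using y by (auto simp: eq_neg_iff_add_eq_0 simp flip: cx_add) (auto simp: algebra_simps)
        \<comment> \<open>The kernel estimates subtract their increment, so the shift by h
          corresponds to w = - cx h.\<close>
        have ee: "cx (x - y) - - cx h = cx (x + h - y)" by (simp add: cx_add cx_diff)
        show "norm (K (cx (x + h - y)) - K (cx (x - y))) \<le> a * 1 * (norm h / (norm (x - y) * norm (x + h - y)))"
          using Kl[OF z] unfolding ee norm_cx norm_minus_cancel by simp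
      qed (use q a in auto)
      thus "norm (conv K G (x + h) - conv K G x) \<le> B * sqrt (norm h)" unfolding e B_def by simp
    qed
    have "((\<lambda>h::real^2. B * sqrt (norm h)) \<longlongrightarrow> B * sqrt (norm (0::real^2))) (at 0)"
      by (intro tendsto_intros)
    thus "((\<lambda>h::real^2. B * sqrt (norm h)) \<longlongrightarrow> 0) (at 0)" by simp
  qed
  thus ?thesis by (simp add: continuous_on_eq_continuous_at)
qed

lemma conv_has_derivative:
  assumes K: "kernel_growth K" and T: "kernel_taylor 1 K \<alpha> \<beta>"
    and al: "kernel_singular \<alpha>" and be: "kernel_singular \<beta>"
    and [measurable]: "G \<in> borel_measurable borel" and G: "decays q c G" and q: "q > 3"
  shows "(conv K G has_derivative (\<lambda>h. conv \<alpha> G x * cx h + conv \<beta> G x * cnj (cx h))) (at x)"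
proof -
  from T obtain a where a: "a \<ge> 0" and Kt: "\<And>z w. z \<noteq> 0 \<Longrightarrow> z \<noteq> w \<Longrightarrow>
     norm (K (z - w) - (K z - \<alpha> z * w - \<beta> z * cnj w)) \<le> a * (norm w)\<^sup>2 / (norm z ^ 1 * norm (z - w))"
    unfolding kernel_taylor_def by blast
  note iK = conv_integrable[OF K assms(5) G q]
  note ia = conv_integrable[OF kernel_singular_imp_growth[OF al] assms(5) G q]
  note ib = conv_integrable[OF kernel_singular_imp_growth[OF be] assms(5) G q]
  define B where "B = 4 * a * c * (4 * pi + integral\<^sup>L lborel (dec q))"
  show ?thesis unfolding has_derivative_at
  proof
    show "bounded_linear (\<lambda>h. conv \<alpha> G x * cx h + conv \<beta> G x * cnj (cx h))"
      by (intro bounded_linear_add bounded_linear_mult_right[THEN bounded_linear_compose]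
          bounded_linear_cx bounded_linear_compose[OF bounded_linear_cnj bounded_linear_cx])
    let ?r = "\<lambda>h. conv K G (x + h) - conv K G x - (conv \<alpha> G x * cx h + conv \<beta> G x * cnj (cx h))"
    have r: "norm (?r h) \<le> B * (norm h * sqrt (norm h))" for h
    proof -
      let ?D = "\<lambda>y. K (cx (x + h - y)) - K (cx (x - y)) - (\<alpha> (cx (x - y)) * cx h + \<beta> (cx (x - y)) * cnj (cx h))"
      have i1: "integrable lborel (\<lambda>y. K (cx (x + h - y)) * G y - K (cx (x - y)) * G y)"
        by (intro Bochner_Integration.integrable_diff iK)
      have i2: "integrable lborel (\<lambda>y. \<alpha> (cx (x - y)) * G y * cx h + \<beta> (cx (x - y)) * G y * cnj (cx h))"
        by (intro Bochner_Integration.integrable_add integrable_mult_left ia ib)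
      have eD: "?D y * G y = (K (cx (x + h - y)) * G y - K (cx (x - y)) * G y)
          - (\<alpha> (cx (x - y)) * G y * cx h + \<beta> (cx (x - y)) * G y * cnj (cx h))" for y
      proof -
        have "(A - B - (P * H + Q * H')) * g = (A * g - B * g) - (P * g * H + Q * g * H')"
          for A B P Q H H' g :: complex by (simp add: algebra_simps)
        thus ?thesis .
      qed
      have iD: "integrable lborel (\<lambda>y. ?D y * G y)"
        unfolding eD by (intro Bochner_Integration.integrable_diff i1 i2)
      have "(\<integral>y. ?D y * G y \<partial>lborel) = ?r h"
        unfolding eD conv_def
        by (subst Bochner_Integration.integral_diff[OF i1 i2])
           (subst Bochner_Integration.integral_diff[OF iK iK],
             subst Bochner_Integration.integral_add[OF integrable_mult_left[OF ia] integrable_mult_left[OF ib]], simp)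
      moreover have "norm (\<integral>y. ?D y * G y \<partial>lborel)
          \<le> 4 * a * c * (4 * pi + integral\<^sup>L lborel (dec q)) * (norm h * sqrt (norm h))"
      proof (rule increment_integral_bound[OF iD G])
        fix y assume y: "y \<noteq> x" "y \<noteq> x + h"
        have z: "cx (x - y) \<noteq> 0" "cx (x - y) \<noteq> - cx h"
          using y by (auto simp: eq_neg_iff_add_eq_0 simp flip: cx_add) (auto simp: algebra_simps)
        have ee: "cx (x - y) - - cx h = cx (x + h - y)" by (simp add: cx_add cx_diff)
        have e3: "?D y = K (cx (x + h - y)) - (K (cx (x - y)) - \<alpha> (cx (x - y)) * - cx h - \<beta> (cx (x - y)) * cnj (- cx h))"
          by simp
        show "norm (?D y) \<le> a * norm h * (norm h / (norm (x - y) * norm (x + h - y)))"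
          using Kt[OF z] unfolding e3 ee norm_cx norm_minus_cancel by (simp add: power2_eq_square)
      qed (use q a in auto)
      ultimately show ?thesis unfolding B_def by simp
    qed
    show "(\<lambda>h. norm (?r h) / norm h) \<midarrow>0\<rightarrow> 0"
    proof (rule Lim_null_comparison[of _ "\<lambda>h. B * sqrt (norm h)"])
      show "\<forall>\<^sub>F h in at 0. norm (norm (?r h) / norm h) \<le> B * sqrt (norm h)"
        unfolding eventually_at_filter
        using r by (intro always_eventually) (auto simp: divide_le_eq mult_ac)
      have "((\<lambda>h::real^2. B * sqrt (norm h)) \<longlongrightarrow> B * sqrt (norm (0::real^2))) (at 0)"
        by (intro tendsto_intros)
      thus "((\<lambda>h::real^2. B * sqrt (norm h)) \<longlongrightarrow> 0) (at 0)" by simp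
    qed
  qed
qed

text \<open>K(x - y) is expanded in y around y = 0. The constant term disappears because
  \<open>G\<close> has integral 0, and the linear terms are the displayed moments. The remainder
  carries |y|^2, which lowers the decay of \<open>G\<close> to |y|^(-1-e), the function treated by
  \<open>riesz_convolution\<close>.\<close>

lemma conv_expansion:
  assumes K: "kernel_growth K" and T: "kernel_taylor n K \<alpha> \<beta>" and e: "0 < e" "e < 1"
  obtains C where "C \<ge> 0"
    "\<And>G c x. G \<in> borel_measurable borel \<Longrightarrow> decays (3 + e) c G \<Longrightarrow> integral\<^sup>L lborel G = 0 \<Longrightarrow> x \<noteq> 0 \<Longrightarrow>
      norm (conv K G x + \<alpha> (cx x) * (\<integral>y. cx y * G y \<partial>lborel) + \<beta> (cx x) * (\<integral>y. cnj (cx y) * G y \<partial>lborel))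
        \<le> C * c * norm x powr (- (real n + e))"
proof -
  from T obtain a where a: "a \<ge> 0" and Kt: "\<And>z w. z \<noteq> 0 \<Longrightarrow> z \<noteq> w \<Longrightarrow>
     norm (K (z - w) - (K z - \<alpha> z * w - \<beta> z * cnj w)) \<le> a * (norm w)\<^sup>2 / (norm z ^ n * norm (z - w))"
    unfolding kernel_taylor_def by blast
  define I where "I = 2 powr e * (2 * pi / (1 - e) + 2 * pi + 4 * pi / e)"
  show ?thesis
  proof
    show "a * I \<ge> 0" using a e by (auto simp: I_def)
    fix G c x assume Gm[measurable]: "G \<in> borel_measurable borel" and G: "decays (3 + e) c G"
      and G0: "integral\<^sup>L lborel G = 0" and x: "x \<noteq> (0::real^2)"
    have c: "c \<ge> 0" by (rule decays_nonneg[OF G])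
    note iK = conv_integrable[OF K Gm G]
    note R = riesz_convolution[OF e x, folded I_def]
    have iG: "integrable lborel G"
      by (rule integrable_of_dec[of _ "3 + e"]) (use e decaysD[OF G] in auto)
    have w: "norm y * norm (G y) \<le> c * dec (2 + e) y" for y
    proof -
      have "norm y * norm (G y) \<le> norm y * (c * dec (3 + e) y)"
        by (intro mult_left_mono decaysD[OF G]) auto
      also have "\<dots> \<le> c * dec (3 + e - 1) y"
        using mult_left_mono[OF norm_mult_dec_le[of y "3 + e"] c] by (simp add: mult_ac)
      finally show ?thesis by simp
    qed
    have i1: "integrable lborel (\<lambda>y. cx y * G y)" and i2: "integrable lborel (\<lambda>y. cnj (cx y) * G y)"
      by (rule integrable_of_dec[of _ "2 + e" c]; use e w in \<open>auto simp: norm_mult\<close>)+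
    let ?D = "\<lambda>y. K (cx (x - y)) * G y - (K (cx x) * G y - \<alpha> (cx x) * (cx y * G y) - \<beta> (cx x) * (cnj (cx y) * G y))"
    have iK': "integrable lborel (\<lambda>y. K (cx (x - y)) * G y)" using iK e by simp
    have iD: "integrable lborel ?D"
      by (intro Bochner_Integration.integrable_diff iK' integrable_mult_right iG i1 i2)
    have r1: "integral\<^sup>L lborel ?D = conv K G x + \<alpha> (cx x) * (\<integral>y. cx y * G y \<partial>lborel) + \<beta> (cx x) * (\<integral>y. cnj (cx y) * G y \<partial>lborel)"
      using iK' iG i1 i2 G0 unfolding conv_def by simp
    have r2: "norm (integral\<^sup>L lborel ?D) \<le> (\<integral>y. norm (?D y) \<partial>lborel)" by (rule integral_norm_bound)
    have r3: "(\<integral>y. norm (?D y) \<partial>lborel)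
        \<le> (\<integral>y. a * c / norm x ^ n * (norm y powr (- 1 - e) / norm (x - y)) \<partial>lborel)"
    proof (rule integral_mono_AE)
      show "AE y in lborel. norm (?D y) \<le> a * c / norm x ^ n * (norm y powr (- 1 - e) / norm (x - y))"
        using AE_lborel_singleton[of x]
      proof eventually_elim
        case (elim y)
        have z: "cx x \<noteq> 0" "cx x \<noteq> cx y"
          using x elim by auto
        have "?D y = (K (cx x - cx y) - (K (cx x) - \<alpha> (cx x) * cx y - \<beta> (cx x) * cnj (cx y))) * G y"
          by (simp add: algebra_simps cx_diff)
        hence "norm (?D y) = norm (K (cx x - cx y) - (K (cx x) - \<alpha> (cx x) * cx y - \<beta> (cx x) * cnj (cx y))) * norm (G y)"
          by (simp add: norm_mult)
        also have "\<dots> \<le> (a * (norm y)\<^sup>2 / (norm x ^ n * norm (x - y))) * norm (G y)"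
          using Kt[OF z] unfolding cx_diff[symmetric] norm_cx by (intro mult_right_mono) auto
        also have "\<dots> = (a / (norm x ^ n * norm (x - y))) * ((norm y)\<^sup>2 * norm (G y))" by simp
        also have "\<dots> \<le> (a / (norm x ^ n * norm (x - y))) * (c * norm y powr (- 1 - e))"
        proof (intro mult_left_mono)
          \<comment> \<open>The weight is traded for a pure power that is singular at 0; only
            homogeneous functions give a clean power of |x|.\<close>
          show "(norm y)\<^sup>2 * norm (G y) \<le> c * norm y powr (- 1 - e)"
          proof (cases "y = 0")
            case False
            have "(norm y)\<^sup>2 * norm (G y) \<le> (norm y)\<^sup>2 * (c * norm y powr (- (3 + e)))"
              using decaysD[OF G, of y] mult_left_mono[OF dec_le_powr[OF False, of "3 + e"] c] e
              by (intro mult_left_mono) auto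
            also have "(norm y)\<^sup>2 = norm y powr 2" using False by simp
            also have "norm y powr 2 * (c * norm y powr (- (3 + e))) = c * (norm y powr 2 * norm y powr (- (3 + e)))"
              by (simp only: mult_ac)
            also have "norm y powr 2 * norm y powr (- (3 + e)) = norm y powr (2 + - (3 + e))"
              by (rule powr_add[symmetric])
            finally show ?thesis by simp
          qed simp
        qed (use a in auto)
        finally show ?case by (simp add: mult_ac)
      qed
    qed (intro integrable_norm iD integrable_mult_right R(1))+
    have r4: "(\<integral>y. a * c / norm x ^ n * (norm y powr (- 1 - e) / norm (x - y)) \<partial>lborel)
        \<le> a * c / norm x ^ n * (I * norm x powr (- e))"
      unfolding integral_mult_right_zero using R(2) a c by (intro mult_left_mono) auto
    have r5: "a * c / norm x ^ n * (I * norm x powr (- e)) = a * I * c * norm x powr (- (real n + e))"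
    proof -
      have "norm x powr (- (real n + e)) = norm x powr (- real n + - e)" by simp
      also have "\<dots> = norm x powr (- real n) * norm x powr (- e)" by (rule powr_add)
      also have "norm x powr (- real n) = 1 / norm x ^ n"
        using x by (simp add: powr_minus powr_realpow divide_inverse)
      finally show ?thesis by simp
    qed
    show "norm (conv K G x + \<alpha> (cx x) * (\<integral>y. cx y * G y \<partial>lborel) + \<beta> (cx x) * (\<integral>y. cnj (cx y) * G y \<partial>lborel))
        \<le> a * I * c * norm x powr (- (real n + e))" unfolding r1[symmetric] r5[symmetric] by (rule order_trans[OF order_trans[OF r2 r3] r4])
  qed
qed

section \<open>Integration by parts on the plane\<close>

lemma one_plus_norm_neq_0[simp]: "1 + norm x \<noteq> 0"
  using norm_ge_zero[of x] by linarith

lemma dec_shift: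
  assumes h: "norm h \<le> 1" and q: "q \<ge> 0"
  shows "dec q (x + h) \<le> 2 powr q * dec q x"
proof -
  have p: "1 + norm x > 0" by (simp add: add_pos_nonneg)
  have "norm x \<le> norm (x + h) + norm h" using norm_triangle_ineq4[of "x + h" h] by simp
  hence "1 + norm x \<le> 2 + norm (x + h)" using h by linarith
  also have "\<dots> \<le> 2 * (1 + norm (x + h))" by simp
  finally have "(1 + norm x) / 2 \<le> 1 + norm (x + h)" by simp
  hence "dec q (x + h) \<le> ((1 + norm x) / 2) powr (- q)"
    unfolding dec_def using p q by (intro powr_mono2') auto
  also have "\<dots> = 2 powr q * dec q x"
    unfolding dec_def using p by (simp add: powr_divide powr_minus field_simps)
  finally show ?thesis .
qed

text \<open>By translation invariance every difference quotient of \<open>F\<close> has integral 0.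
  The mean value inequality bounds the quotients by the derivative at a point at distance at most 1,
  and \<open>dec_shift\<close> turns this into an integrable majorant.\<close>

lemma integral_directional_derivative_zero_fast:
  fixes F :: "real^2 \<Rightarrow> complex"
  assumes F: "\<And>x. (F has_derivative F' x) (at x)"
    and [measurable]: "(\<lambda>x. F' x v) \<in> borel_measurable borel"
    and v: "norm v = 1" and q: "q > 2"
    and b0: "\<And>x. norm (F x) \<le> B * dec q x" and b1: "\<And>x. norm (F' x v) \<le> C * dec q x"
  shows "(\<integral>x. F' x v \<partial>lborel) = 0"
proof -
  have "continuous_on UNIV F" using F by (auto intro!: continuous_at_imp_continuous_on has_derivative_continuous)
  hence Fm[measurable]: "F \<in> borel_measurable borel" by (rule borel_measurable_continuous_onI)
  have iF: "integrable lborel F" by (rule integrable_of_dec[OF Fm q b0])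
  have C: "C \<ge> 0" using order_trans[OF norm_ge_zero b1[of 0]] zero_le_mult_iff[of C "dec q 0"] dec_pos(1)[of q 0] by linarith
  define t where "t = (\<lambda>n::nat. 1 / (real n + 1))"
  have t: "0 < t n" "t n \<le> 1" for n by (auto simp: t_def)
  have t0: "t \<longlonglongrightarrow> 0" unfolding t_def using LIMSEQ_inverse_real_of_nat by (simp add: inverse_eq_divide add.commute)
  define s where "s = (\<lambda>n x. (F (x + t n *\<^sub>R v) - F x) /\<^sub>R t n)"
  have d: "((\<lambda>\<tau>. F (x + \<tau> *\<^sub>R v)) has_derivative (\<lambda>h. F' (x + \<tau> *\<^sub>R v) (h *\<^sub>R v))) (at \<tau>)" for x \<tau>
  proof -
    have "((\<lambda>\<tau>. x + \<tau> *\<^sub>R v) has_derivative (\<lambda>h. h *\<^sub>R v)) (at \<tau>)"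
      by (auto intro!: derivative_eq_intros)
    from has_derivative_compose[OF this F] show ?thesis .
  qed
  have lim: "(\<lambda>n. s n x) \<longlonglongrightarrow> F' x v" for x
  proof -
    have lin: "bounded_linear (F' x)" using F by (rule has_derivative_bounded_linear)
    have fl: "filterlim (\<lambda>n. t n *\<^sub>R v) (at 0) sequentially"
    proof (rule filterlim_atI)
      have "(\<lambda>n. t n *\<^sub>R v) \<longlonglongrightarrow> 0 *\<^sub>R v" by (intro tendsto_intros t0)
      thus "(\<lambda>n. t n *\<^sub>R v) \<longlonglongrightarrow> 0" by simp
      show "\<forall>\<^sub>F n in sequentially. t n *\<^sub>R v \<noteq> 0"
        using t(1) v by (intro always_eventually allI) (auto simp: less_imp_neq[symmetric])
    qed
    have "(\<lambda>h. norm (F (x + h) - F x - F' x h) / norm h) \<midarrow>0\<rightarrow> 0"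
      using F[of x] unfolding has_derivative_at by blast
    from filterlim_compose[OF this fl]
    have "(\<lambda>n. norm (F (x + t n *\<^sub>R v) - F x - F' x (t n *\<^sub>R v)) / norm (t n *\<^sub>R v)) \<longlonglongrightarrow> 0" .
    moreover have "norm (F (x + t n *\<^sub>R v) - F x - F' x (t n *\<^sub>R v)) / norm (t n *\<^sub>R v) = norm (s n x - F' x v)" for n
    proof -
      have "s n x - F' x v = (F (x + t n *\<^sub>R v) - F x - F' x (t n *\<^sub>R v)) /\<^sub>R t n"
        using t(1)[of n] by (simp add: s_def linear_simps(5)[OF lin] scaleR_diff_right)
      thus ?thesis using t(1)[of n] v by (simp add: divide_inverse mult.commute)
    qed
    ultimately have "(\<lambda>n. norm (s n x - F' x v)) \<longlonglongrightarrow> 0" by simp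
    thus ?thesis by (simp add: tendsto_norm_zero_iff LIM_zero_iff)
  qed
  have bd: "norm (s n x) \<le> 2 powr q * C * dec q x" for n x
  proof -
    obtain \<tau> where \<tau>: "\<tau> \<in> {0<..<t n}"
      and m: "norm (F (x + t n *\<^sub>R v) - F (x + 0 *\<^sub>R v)) \<le> norm (F' (x + \<tau> *\<^sub>R v) ((t n - 0) *\<^sub>R v))"
      using mvt_general[of 0 "t n" "\<lambda>\<tau>. F (x + \<tau> *\<^sub>R v)" "\<lambda>\<tau> h. F' (x + \<tau> *\<^sub>R v) (h *\<^sub>R v)"] t d
      by (metis has_derivative_continuous continuous_at_imp_continuous_on)
    have lin: "bounded_linear (F' (x + \<tau> *\<^sub>R v))" using F by (rule has_derivative_bounded_linear)
    have "norm (s n x) \<le> norm (F' (x + \<tau> *\<^sub>R v) v)"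
    proof -
      have "norm (s n x) = norm (F (x + t n *\<^sub>R v) - F x) / t n"
        using t[of n] unfolding s_def norm_scaleR by (simp add: divide_inverse)
      also have "\<dots> \<le> norm (F' (x + \<tau> *\<^sub>R v) v)"
        using m t[of n] by (simp add: linear_simps(5)[OF lin] divide_le_eq mult.commute)
      finally show ?thesis .
    qed
    also have "\<dots> \<le> C * dec q (x + \<tau> *\<^sub>R v)" by (rule b1)
    also have "\<dots> \<le> C * (2 powr q * dec q x)"
      using \<tau> t[of n] v q by (intro mult_left_mono dec_shift C) auto
    finally show ?thesis by (simp add: mult_ac)
  qed
  have int0: "integral\<^sup>L lborel (s n) = 0" for n
  proof -
    have hb: "has_bochner_integral lborel F (integral\<^sup>L lborel F)" using iF by (rule has_bochner_integral_integrable)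
    from has_bochner_translate[OF this, of "t n *\<^sub>R v"]
    have "has_bochner_integral lborel (\<lambda>x. F (x + t n *\<^sub>R v)) (integral\<^sup>L lborel F)" by (simp add: add.commute)
    from has_bochner_integral_diff[OF this hb] have "(\<integral>x. F (x + t n *\<^sub>R v) - F x \<partial>lborel) = 0"
      by (simp add: has_bochner_integral_iff)
    thus ?thesis unfolding s_def by simp
  qed
  have "(\<lambda>n. integral\<^sup>L lborel (s n)) \<longlonglongrightarrow> (\<integral>x. F' x v \<partial>lborel)"
    by (rule integral_dominated_convergence[where w = "\<lambda>x. 2 powr q * C * dec q x"])
       (use lim bd integrable_dec[OF q] in \<open>auto simp: s_def\<close>)
  thus ?thesis unfolding int0 by (simp add: LIMSEQ_const_iff)
qed

lemma dec_2_ge: "1 / (1 + (norm x)\<^sup>2) \<le> 2 * dec 2 x"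
proof -
  have p: "1 + norm x > 0" by (simp add: add_pos_nonneg)
  have "dec 2 x = 1 / (1 + norm x)\<^sup>2" using p by (simp add: dec_def powr_minus divide_inverse)
  moreover have "(1 + norm x)\<^sup>2 \<le> 2 * (1 + (norm x)\<^sup>2)"
    using zero_le_power2[of "1 - norm x"] by (simp add: power2_eq_square algebra_simps)
  hence "1 / (2 * (1 + (norm x)\<^sup>2)) \<le> 1 / (1 + norm x)\<^sup>2"
    using p by (intro divide_left_mono mult_pos_pos) (auto simp: add_pos_nonneg)
  moreover have "1 / a = 2 * (1 / (2 * a))" for a :: real by simp
  hence "1 / (1 + (norm x)\<^sup>2) = 2 * (1 / (2 * (1 + (norm x)\<^sup>2)))" .
  ultimately show ?thesis by (simp only: mult_le_cancel_left_pos zero_less_numeral)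
qed

text \<open>A function of order r^(-1-e) need not be integrable, so translation invariance does not
  apply directly. After multiplication by a cut-off it does, and dominated convergence removes the
  cut-off. Tensors such as products of two velocities have only this slow decay.\<close>

lemma integral_directional_derivative_zero:
  fixes F :: "real^2 \<Rightarrow> complex"
  assumes F: "\<And>x. (F has_derivative F' x) (at x)"
    and m[measurable]: "(\<lambda>x. F' x v) \<in> borel_measurable borel"
    and v: "norm v = 1" and e: "e > 0"
    and b0: "\<And>x. norm (F x) \<le> B * dec (1 + e) x" and b1: "\<And>x. norm (F' x v) \<le> B * dec (2 + e) x"
  shows "(\<integral>x. F' x v \<partial>lborel) = 0"
proof -
  have "continuous_on UNIV F" using F by (auto intro!: continuous_at_imp_continuous_on has_derivative_continuous)
  hence Fm[measurable]: "F \<in> borel_measurable borel" by (rule borel_measurable_continuous_onI)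
  have B: "B \<ge> 0" using order_trans[OF norm_ge_zero b1[of 0]] zero_le_mult_iff[of B "dec (2 + e) 0"] dec_pos(1)[of "2 + e" 0] by linarith
  define R where "R = (\<lambda>n::nat. (real n + 1)\<^sup>2)"
  have R: "R n \<ge> 1" for n by (simp add: R_def)
  \<comment> \<open>A rational cut-off has two bounds with different roles: \<open>cut n\<close> is
    at most 2 \<open>R n\<close> times \<open>dec 2\<close>, giving integrability for fixed n, while
    its derivative is at most 4 \<open>dec 1\<close> uniformly in n, which lifts the decay of
    \<open>F\<close> to that of its derivative.\<close>
  define cut where "cut = (\<lambda>n (x::real^2). R n / (R n + x \<bullet> x))"
  define cut' where "cut' = (\<lambda>n (x::real^2). - (R n * (2 * (x \<bullet> v)) / (R n + x \<bullet> x)\<^sup>2))"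
  have p: "R n + x \<bullet> x > 0" "R n + x \<bullet> x \<ge> 1 + (norm x)\<^sup>2" for n and x :: "real^2"
    using R[of n] inner_ge_zero[of x] by (auto simp: power2_norm_eq_inner intro: add_pos_nonneg)
  have c01: "0 \<le> cut n x" "cut n x \<le> 1" for n x
    using p[where n = n and x = x] R[of n] inner_ge_zero[of x] by (auto simp: cut_def divide_le_eq_1 intro!: divide_nonneg_pos)
  have cR: "cut n x \<le> 2 * R n * dec 2 x" for n x
  proof -
    have "cut n x = R n * (1 / (R n + x \<bullet> x))" by (simp add: cut_def)
    also have "\<dots> \<le> R n * (1 / (1 + (norm x)\<^sup>2))"
      using R[of n] p[where n = n and x = x] by (intro mult_left_mono divide_left_mono mult_pos_pos) (auto simp: add_pos_nonneg)
    also have "\<dots> \<le> R n * (2 * dec 2 x)" using R[of n] by (intro mult_left_mono dec_2_ge) auto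
    finally show ?thesis by simp
  qed
  have c': "\<bar>cut' n x\<bar> \<le> 4 * dec 1 x" for n x
  proof -
    have xv: "\<bar>x \<bullet> v\<bar> \<le> norm x" using Cauchy_Schwarz_ineq2[of x v] v by simp
    have "\<bar>cut' n x\<bar> = cut n x * (2 * \<bar>x \<bullet> v\<bar> / (R n + x \<bullet> x))"
      using p[where n = n and x = x] R[of n] by (simp add: cut'_def cut_def abs_mult power2_eq_square)
    also have "\<dots> \<le> 1 * (2 * norm x / (1 + (norm x)\<^sup>2))"
      using c01[of n x] p[where n = n and x = x] xv by (intro mult_mono frac_le) (auto simp: add_pos_nonneg)
    also have "\<dots> = 2 * norm x * (1 / (1 + (norm x)\<^sup>2))" by simp
    also have "\<dots> \<le> 2 * norm x * (2 * dec 2 x)" by (intro mult_left_mono dec_2_ge) auto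
    also have "\<dots> \<le> 4 * dec 1 x" using norm_mult_dec_le[of x 2] by simp
    finally show ?thesis .
  qed
  have dchi: "(cut n has_derivative (\<lambda>h. - (R n * (2 * (x \<bullet> h)) / (R n + x \<bullet> x)\<^sup>2))) (at x)" for n x
    unfolding cut_def using p[where n = n and x = x]
    by (auto intro!: derivative_eq_intros ext simp: inner_commute power2_eq_square field_simps)
  define G where "G = (\<lambda>n x. cut n x *\<^sub>R F x)"
  define G' where "G' = (\<lambda>n x h. cut n x *\<^sub>R F' x h + (- (R n * (2 * (x \<bullet> h)) / (R n + x \<bullet> x)\<^sup>2)) *\<^sub>R F x)"
  have G'v: "G' n x v = cut n x *\<^sub>R F' x v + cut' n x *\<^sub>R F x" for n x by (simp add: G'_def cut'_def)
  have cm: "cut n \<in> borel_measurable borel" "cut' n \<in> borel_measurable borel" for n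
  proof -
    have "R n + x \<bullet> x \<noteq> 0" for x :: "real^2" using p[where n = n and x = x] by simp
    thus "cut n \<in> borel_measurable borel" "cut' n \<in> borel_measurable borel"
      unfolding cut_def cut'_def by (auto intro!: borel_measurable_continuous_onI continuous_intros)
  qed
  have G'm: "(\<lambda>x. G' n x v) \<in> borel_measurable borel" for n
    unfolding G'v using cm by measurable
  have bd: "norm (G' n x v) \<le> 5 * B * dec (2 + e) x" for n x
  proof -
    have "norm (G' n x v) \<le> cut n x * norm (F' x v) + \<bar>cut' n x\<bar> * norm (F x)"
      unfolding G'v using c01[of n x] by (intro order_trans[OF norm_triangle_ineq]) simp
    also have "\<dots> \<le> 1 * (B * dec (2 + e) x) + (4 * dec 1 x) * (B * dec (1 + e) x)"
      using c01[of n x] c'[of n x] by (intro add_mono mult_mono b0 b1) auto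
    also have "(4 * dec 1 x) * (B * dec (1 + e) x) = 4 * B * (dec 1 x * dec (1 + e) x)" by simp
    also have "dec 1 x * dec (1 + e) x = dec (2 + e) x" by (simp add: dec_mult)
    finally show ?thesis by simp
  qed
  have int0: "(\<integral>x. G' n x v \<partial>lborel) = 0" for n
  proof (rule integral_directional_derivative_zero_fast[of "G n" "G' n", OF _ G'm v _ _ bd])
    show "(G n has_derivative G' n x) (at x)" for x
      unfolding G_def G'_def by (rule has_derivative_scaleR[OF dchi F, THEN has_derivative_eq_rhs]) simp
    show "norm (G n x) \<le> 2 * R n * B * dec (2 + e) x" for x
    proof -
      have "norm (G n x) = cut n x * norm (F x)" unfolding G_def using c01[of n x] by simp
      also have "\<dots> \<le> (2 * R n * dec 2 x) * (B * dec (1 + e) x)"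
        using R[of n] by (intro mult_mono cR b0) auto
      also have "\<dots> = 2 * R n * B * (dec 2 x * dec (1 + e) x)" by simp
      also have "\<dots> \<le> 2 * R n * B * dec (2 + e) x"
        unfolding dec_mult using R[of n] B by (intro mult_left_mono dec_mono) auto
      finally show ?thesis .
    qed
  qed (use e in auto)
  have Rinf: "filterlim R at_top sequentially"
  proof -
    have "filterlim (\<lambda>n. real n + 1) at_top sequentially"
      using filterlim_tendsto_add_at_top[OF tendsto_const filterlim_real_sequentially, of 1] by (simp add: add.commute)
    thus ?thesis unfolding R_def by (intro filterlim_pow_at_top) auto
  qed
  have lim: "(\<lambda>n. G' n x v) \<longlonglongrightarrow> F' x v" for x
  proof -
    have inv: "(\<lambda>n. 1 / R n) \<longlonglongrightarrow> 0"
      by (intro tendsto_divide_0[OF tendsto_const] filterlim_at_top_imp_at_infinity Rinf)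
    have nz: "R n \<noteq> 0" "1 + (x \<bullet> x) * (1 / R n) \<noteq> 0" for n
      using R[of n] inner_ge_zero[of x] by (auto simp: add_nonneg_eq_0_iff)
    have e1: "cut n x = 1 / (1 + (x \<bullet> x) * (1 / R n))" for n
      using nz[of n] p[where n = n and x = x] by (simp add: cut_def field_simps)
    have e2: "cut' n x = - (2 * (x \<bullet> v) * (1 / R n) * (cut n x)\<^sup>2)" for n
      using nz[of n] p[where n = n and x = x] by (simp add: cut_def cut'_def field_simps power2_eq_square)
    have "(\<lambda>n. 1 / (1 + (x \<bullet> x) * (1 / R n))) \<longlonglongrightarrow> 1 / (1 + (x \<bullet> x) * 0)"
      by (intro tendsto_intros inv) auto
    hence l1: "(\<lambda>n. cut n x) \<longlonglongrightarrow> 1" unfolding e1 by simp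
    have "(\<lambda>n. - (2 * (x \<bullet> v) * (1 / R n) * (cut n x)\<^sup>2)) \<longlonglongrightarrow> - (2 * (x \<bullet> v) * 0 * 1\<^sup>2)"
      by (intro tendsto_intros inv l1)
    hence l2: "(\<lambda>n. cut' n x) \<longlonglongrightarrow> 0" unfolding e2 by simp
    have "(\<lambda>n. G' n x v) \<longlonglongrightarrow> 1 *\<^sub>R F' x v + 0 *\<^sub>R F x"
      unfolding G'v by (intro tendsto_intros l1 l2)
    thus ?thesis by simp
  qed
  have "(\<lambda>n. \<integral>x. G' n x v \<partial>lborel) \<longlonglongrightarrow> (\<integral>x. F' x v \<partial>lborel)"
    by (rule integral_dominated_convergence[where w = "\<lambda>x. 5 * B * dec (2 + e) x"])
       (use lim bd integrable_dec[of "2 + e"] G'm e in auto)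
  thus ?thesis unfolding int0 by (simp add: LIMSEQ_const_iff)
qed

section \<open>Test functions\<close>

lemma compact_support_decays:
  fixes f :: "real^2 \<Rightarrow> complex"
  assumes f: "continuous_on UNIV f" and S: "compact S" and z: "\<And>x. x \<notin> S \<Longrightarrow> f x = 0"
  obtains C where "C \<ge> 0" "decays q C f"
proof -
  have "continuous_on S (\<lambda>x. f x / complex_of_real (dec q x))"
    using f by (intro continuous_intros continuous_on_subset[OF f] continuous_dec) (auto simp: less_imp_neq[OF dec_pos(1), symmetric])
  hence "bounded ((\<lambda>x. f x / complex_of_real (dec q x)) ` S)"
    using S by (intro compact_imp_bounded compact_continuous_image)
  then obtain C where C: "C > 0" "\<And>x. x \<in> S \<Longrightarrow> norm (f x / complex_of_real (dec q x)) \<le> C"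
    unfolding bounded_pos by auto
  have "norm (f x) \<le> C * dec q x" for x
  proof (cases "x \<in> S")
    case True
    thus ?thesis using C(2)[OF True] dec_pos(1)[of q x] by (simp add: norm_divide divide_le_eq)
  next
    case False thus ?thesis using C z by simp
  qed
  thus ?thesis using that[of C] C by (simp add: decays_def)
qed

lemma has_derivative_partial:
  fixes g :: "real^2 \<Rightarrow> real"
  assumes "g differentiable (at x)"
  shows "(g has_derivative (\<lambda>h. partial 1 g x * h $ 1 + partial 2 g x * h $ 2)) (at x)"
proof -
  have d: "(g has_derivative frechet_derivative g (at x)) (at x)"
    using assms by (simp add: frechet_derivative_works)
  then interpret bounded_linear "frechet_derivative g (at x)" by (rule has_derivative_bounded_linear)
  have "frechet_derivative g (at x) h = partial 1 g x * h $ 1 + partial 2 g x * h $ 2" for h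
  proof -
    have "h = h $ 1 *\<^sub>R axis 1 1 + h $ 2 *\<^sub>R axis 2 1"
      by (simp add: vec_eq_iff forall_2 axis_def)
    hence "frechet_derivative g (at x) h = frechet_derivative g (at x) (h $ 1 *\<^sub>R axis 1 1 + h $ 2 *\<^sub>R axis 2 1)"
      by simp
    thus ?thesis unfolding add scaleR partial_def by simp
  qed
  hence "frechet_derivative g (at x) = (\<lambda>h. partial 1 g x * h $ 1 + partial 2 g x * h $ 2)" by (rule ext)
  thus ?thesis using d by simp
qed

lemma partial_eqI: "(g has_derivative g') (at x) \<Longrightarrow> partial i g x = g' (axis i 1)"
  unfolding partial_def by (metis frechet_derivative_at)

lemma test_function_facts:
  assumes "\<phi> \<in> test_functions"
  shows test_function_differentiable: "\<phi> differentiable (at x)"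
    and test_function_continuous: "continuous_on UNIV \<phi>"
    and test_function_partial: "partial i \<phi> \<in> test_functions"
proof -
  have Ck: "\<And>n. Ck n \<phi>" and cpt: "compact (closure {x. \<phi> x \<noteq> 0})"
    using assms by (auto simp: test_functions_def)
  show dphi: "\<phi> differentiable (at x)" for x using Ck[of "Suc 0"] by simp
  show "continuous_on UNIV \<phi>" using Ck[of 0] by simp
  have "Ck n (partial i \<phi>)" for n using Ck[of "Suc n"] by simp
  moreover have "{x. partial i \<phi> x \<noteq> 0} \<subseteq> closure {x. \<phi> x \<noteq> 0}"
  proof (rule ccontr)
    assume "\<not> ?thesis"
    then obtain x where x: "partial i \<phi> x \<noteq> 0" "x \<in> - closure {x. \<phi> x \<noteq> 0}" by auto
    have "(\<phi> has_derivative (\<lambda>h. 0)) (at x)"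
    proof (rule has_derivative_transform_within_open[of "\<lambda>x. 0"])
      show "open (- closure {x. \<phi> x \<noteq> 0})" by auto
      fix y assume "y \<in> - closure {x. \<phi> x \<noteq> 0}"
      thus "0 = \<phi> y" using closure_subset[of "{x. \<phi> x \<noteq> 0}"] by auto
    qed (use x in auto)
    from partial_eqI[OF this] x(1) show False by simp
  qed
  hence "closure {x. partial i \<phi> x \<noteq> 0} \<subseteq> closure {x. \<phi> x \<noteq> 0}" by (rule closure_minimal) simp
  hence "compact (closure {x. partial i \<phi> x \<noteq> 0})"
    using cpt by (metis closed_closure compact_Int_closed inf.absorb_iff2)
  ultimately show "partial i \<phi> \<in> test_functions" by (simp add: test_functions_def)
qed

lemma test_function_decays:
  assumes "\<phi> \<in> test_functions"
  obtains C where "C \<ge> 0" "\<And>x. \<bar>\<phi> x\<bar> \<le> C * dec q x"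
proof -
  have c: "continuous_on UNIV (\<lambda>x. complex_of_real (\<phi> x))"
    using test_function_continuous[OF assms] by (intro continuous_intros)
  obtain C where "C \<ge> 0" "decays q C (\<lambda>x. complex_of_real (\<phi> x))"
  proof (rule compact_support_decays[OF c])
    show "compact (closure {x. \<phi> x \<noteq> 0})" using assms by (simp add: test_functions_def)
    show "complex_of_real (\<phi> x) = 0" if "x \<notin> closure {x. \<phi> x \<noteq> 0}" for x
      using that closure_subset[of "{x. \<phi> x \<noteq> 0}"] by auto
  qed
  thus ?thesis using that[of C] by (auto simp: decays_def)
qed

lemma test_function_mult_decays:
  fixes U :: "real^2 \<Rightarrow> complex"
  assumes \<phi>: "\<phi> \<in> test_functions" and U: "continuous_on UNIV U"
  obtains C where "C \<ge> 0" "decays q C (\<lambda>x. U x * of_real (\<phi> x))"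
proof (rule compact_support_decays)
  show "continuous_on UNIV (\<lambda>x. U x * complex_of_real (\<phi> x))"
    using test_function_continuous[OF \<phi>] U by (intro continuous_intros)
  show "compact (closure {x. \<phi> x \<noteq> 0})" using \<phi> by (simp add: test_functions_def)
  show "U x * complex_of_real (\<phi> x) = 0" if "x \<notin> closure {x. \<phi> x \<noteq> 0}" for x
    using that closure_subset[of "{x. \<phi> x \<noteq> 0}"] by auto
qed (use that in blast)

lemma test_function_integrable:
  fixes U :: "real^2 \<Rightarrow> complex"
  assumes \<phi>: "\<phi> \<in> test_functions" and U: "continuous_on UNIV U"
  shows "integrable lborel (\<lambda>x. U x * of_real (\<phi> x))"
proof -
  obtain C where "decays 3 C (\<lambda>x. U x * of_real (\<phi> x))" using test_function_mult_decays[OF \<phi> U] by blast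
  moreover have "continuous_on UNIV (\<lambda>x. U x * complex_of_real (\<phi> x))"
    using test_function_continuous[OF \<phi>] U by (intro continuous_intros)
  ultimately show ?thesis
    by (intro integrable_of_dec[of _ 3 C] borel_measurable_continuous_onI) (auto simp: decays_def)
qed

text \<open>The compact support of the test function supplies the decay, so the growth of
  \<open>U\<close> is irrelevant.\<close>

lemma integration_by_parts:
  fixes U :: "real^2 \<Rightarrow> complex"
  assumes \<phi>: "\<phi> \<in> test_functions" and U: "\<And>x. (U has_derivative U' x) (at x)"
    and c: "continuous_on UNIV (\<lambda>x. U' x (axis i 1))"
  shows "(\<integral>x. U' x (axis i 1) * of_real (\<phi> x) \<partial>lborel) = - (\<integral>x. U x * of_real (partial i \<phi> x) \<partial>lborel)"
proof -
  have Uc: "continuous_on UNIV U" using U by (auto intro!: continuous_at_imp_continuous_on has_derivative_continuous)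
  note \<phi>' = test_function_partial[OF \<phi>, of i]
  define D where "D = (\<lambda>x h. U x * of_real (partial 1 \<phi> x * h $ 1 + partial 2 \<phi> x * h $ 2) + U' x h * of_real (\<phi> x))"
  have d: "((\<lambda>x. U x * of_real (\<phi> x)) has_derivative D x) (at x)" for x
    unfolding D_def
    by (intro has_derivative_mult U has_derivative_of_real has_derivative_partial test_function_differentiable[OF \<phi>])
  have Dv: "D x (axis i 1) = U x * of_real (partial i \<phi> x) + U' x (axis i 1) * of_real (\<phi> x)" for x
    using exhaust_2[of i] by (auto simp: D_def axis_def)
  obtain C0 where C0: "C0 \<ge> 0" "decays 3 C0 (\<lambda>x. U x * of_real (\<phi> x))"
    using test_function_mult_decays[OF \<phi> Uc] by blast
  obtain C1 where C1: "C1 \<ge> 0" "decays 3 C1 (\<lambda>x. U x * of_real (partial i \<phi> x))"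
    using test_function_mult_decays[OF \<phi>' Uc] by blast
  obtain C2 where C2: "C2 \<ge> 0" "decays 3 C2 (\<lambda>x. U' x (axis i 1) * of_real (\<phi> x))"
    using test_function_mult_decays[OF \<phi> c] by blast
  have "(\<integral>x. D x (axis i 1) \<partial>lborel) = 0"
  proof (rule integral_directional_derivative_zero_fast[OF d])
    show "(\<lambda>x. D x (axis i 1)) \<in> borel_measurable borel"
      unfolding Dv using Uc c test_function_continuous[OF \<phi>] test_function_continuous[OF \<phi>']
      by (intro borel_measurable_continuous_onI continuous_intros)
    show "norm (U x * of_real (\<phi> x)) \<le> C0 * dec 3 x" for x by (rule decaysD[OF C0(2)])
    show "norm (D x (axis i 1)) \<le> (C1 + C2) * dec 3 x" for x
      unfolding Dv using decaysD[OF C1(2), of x] decaysD[OF C2(2), of x]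
      by (intro order_trans[OF norm_triangle_ineq]) (simp add: distrib_right)
  qed (auto simp: norm_axis_1)
  thus ?thesis unfolding Dv
    using test_function_integrable[OF \<phi>' Uc] test_function_integrable[OF \<phi> c] by (simp add: eq_neg_iff_add_eq_0 add.commute)
qed

text \<open>The mean value theorem is used twice: in direction i on the increment of f in direction
  j, then in direction j on the partial derivative.\<close>

lemma second_difference:
  fixes f :: "real^2 \<Rightarrow> real"
  assumes f: "\<And>x. f differentiable (at x)" "\<And>x. partial i f differentiable (at x)" and s: "s > 0"
  shows "\<exists>a b. 0 < a \<and> a < s \<and> 0 < b \<and> b < s \<and>
    f (x + s *\<^sub>R axis i 1 + s *\<^sub>R axis j 1) - f (x + s *\<^sub>R axis i 1) - f (x + s *\<^sub>R axis j 1) + f x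
     = s * (s * partial j (partial i f) (x + a *\<^sub>R axis i 1 + b *\<^sub>R axis j 1))"
proof -
  have D: "DERIV (\<lambda>t. g (y + t *\<^sub>R axis k 1)) t :> partial k g (y + t *\<^sub>R axis k 1)"
    if g: "\<And>x. g differentiable (at x)" for g :: "real^2 \<Rightarrow> real" and y k t
  proof -
    have "((\<lambda>t. y + t *\<^sub>R axis k 1) has_derivative (\<lambda>h. h *\<^sub>R axis k 1)) (at t)"
      by (auto intro!: derivative_eq_intros)
    from has_derivative_compose[OF this has_derivative_partial[OF g]]
    have "((\<lambda>t. g (y + t *\<^sub>R axis k 1)) has_derivative (\<lambda>h. h * partial k g (y + t *\<^sub>R axis k 1))) (at t)"
      using exhaust_2[of k] by (auto simp: axis_def mult.commute elim!: has_derivative_eq_rhs)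
    thus ?thesis by (simp add: has_field_derivative_def mult_commute_abs)
  qed
  let ?g = "\<lambda>t. f ((x + s *\<^sub>R axis j 1) + t *\<^sub>R axis i 1) - f (x + t *\<^sub>R axis i 1)"
  obtain a where a: "0 < a" "a < s"
    "?g s - ?g 0 = (s - 0) * (partial i f ((x + s *\<^sub>R axis j 1) + a *\<^sub>R axis i 1) - partial i f (x + a *\<^sub>R axis i 1))"
    using MVT2[of 0 s ?g "\<lambda>t. partial i f ((x + s *\<^sub>R axis j 1) + t *\<^sub>R axis i 1) - partial i f (x + t *\<^sub>R axis i 1)"]
      s DERIV_diff[OF D[OF f(1)] D[OF f(1)]] by auto
  let ?h = "\<lambda>t. partial i f ((x + a *\<^sub>R axis i 1) + t *\<^sub>R axis j 1)"
  obtain b where b: "0 < b" "b < s"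
    "?h s - ?h 0 = (s - 0) * partial j (partial i f) ((x + a *\<^sub>R axis i 1) + b *\<^sub>R axis j 1)"
    using MVT2[of 0 s ?h "\<lambda>t. partial j (partial i f) ((x + a *\<^sub>R axis i 1) + t *\<^sub>R axis j 1)"]
      s D[OF f(2)] by auto
  show ?thesis
    using a b by (intro exI[of _ a] exI[of _ b]) (simp add: add_ac)
qed

text \<open>The second difference is symmetric in i and j. Divided by the square of the step, it
  equals either mixed derivative at a nearby point, and continuity identifies the limits.\<close>

lemma test_function_partial_commute:
  assumes \<phi>: "\<phi> \<in> test_functions"
  shows "partial j (partial i \<phi>) x = partial i (partial j \<phi>) x"
proof -
  define t where "t = (\<lambda>n::nat. 1 / (real n + 1))"
  have t: "0 < t n" for n by (auto simp: t_def)
  have t0: "t \<longlonglongrightarrow> 0" unfolding t_def using LIMSEQ_inverse_real_of_nat by (simp add: inverse_eq_divide add.commute)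
  have key: "\<exists>y. (\<forall>n. norm (y n) \<le> 2 * t n) \<and> (\<forall>n. t n * (t n * partial j (partial i \<phi>) (x + y n))
     = \<phi> (x + t n *\<^sub>R axis i 1 + t n *\<^sub>R axis j 1) - \<phi> (x + t n *\<^sub>R axis i 1) - \<phi> (x + t n *\<^sub>R axis j 1) + \<phi> x)" for i j
  proof -
    have "\<exists>y. norm y \<le> 2 * t n \<and> t n * (t n * partial j (partial i \<phi>) (x + y))
     = \<phi> (x + t n *\<^sub>R axis i 1 + t n *\<^sub>R axis j 1) - \<phi> (x + t n *\<^sub>R axis i 1) - \<phi> (x + t n *\<^sub>R axis j 1) + \<phi> x" for n
    proof -
      from second_difference[of \<phi> i "t n" x j] test_function_differentiable[OF \<phi>]
        test_function_differentiable[OF test_function_partial[OF \<phi>]] t[of n]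
      obtain a b where ab: "0 < a" "a < t n" "0 < b" "b < t n"
        and e: "\<phi> (x + t n *\<^sub>R axis i 1 + t n *\<^sub>R axis j 1) - \<phi> (x + t n *\<^sub>R axis i 1) - \<phi> (x + t n *\<^sub>R axis j 1) + \<phi> x
     = t n * (t n * partial j (partial i \<phi>) (x + a *\<^sub>R axis i 1 + b *\<^sub>R axis j 1))" by blast
      have "norm (a *\<^sub>R axis i 1 + b *\<^sub>R axis j 1 :: real^2) \<le> 2 * t n"
        by (rule order_trans[OF norm_triangle_ineq]) (use ab in \<open>auto simp: norm_axis_1\<close>)
      thus ?thesis using e by (intro exI[of _ "a *\<^sub>R axis i 1 + b *\<^sub>R axis j 1"]) (simp add: add.assoc)
    qed
    thus ?thesis by metis
  qed
  have lim: "(\<lambda>n. partial j (partial i \<phi>) (x + y n)) \<longlonglongrightarrow> partial j (partial i \<phi>) x"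
    if "\<forall>n. norm (y n) \<le> 2 * t n" for y i j
  proof -
    have "(\<lambda>n. 2 * t n) \<longlonglongrightarrow> 2 * 0" by (intro tendsto_intros t0)
    hence "y \<longlonglongrightarrow> 0" using that by (intro Lim_null_comparison[of y "\<lambda>n. 2 * t n"]) auto
    hence "(\<lambda>n. x + y n) \<longlonglongrightarrow> x + 0" by (intro tendsto_intros)
    moreover have "isCont (partial j (partial i \<phi>)) x"
      using test_function_continuous[OF test_function_partial[OF test_function_partial[OF \<phi>]]]
      by (simp add: continuous_on_eq_continuous_at)
    ultimately show ?thesis
      using isCont_tendsto_compose[of x "partial j (partial i \<phi>)" "\<lambda>n. x + y n" sequentially] by simp
  qed
  obtain y where y: "\<forall>n. norm (y n) \<le> 2 * t n" "\<forall>n. t n * (t n * partial j (partial i \<phi>) (x + y n))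
     = \<phi> (x + t n *\<^sub>R axis i 1 + t n *\<^sub>R axis j 1) - \<phi> (x + t n *\<^sub>R axis i 1) - \<phi> (x + t n *\<^sub>R axis j 1) + \<phi> x"
    using key[of j i] by blast
  obtain z where z: "\<forall>n. norm (z n) \<le> 2 * t n" "\<forall>n. t n * (t n * partial i (partial j \<phi>) (x + z n))
     = \<phi> (x + t n *\<^sub>R axis j 1 + t n *\<^sub>R axis i 1) - \<phi> (x + t n *\<^sub>R axis j 1) - \<phi> (x + t n *\<^sub>R axis i 1) + \<phi> x"
    using key[of i j] by blast
  have "t n * (t n * partial j (partial i \<phi>) (x + y n)) = t n * (t n * partial i (partial j \<phi>) (x + z n))" for n
    using y(2) z(2) by (simp add: add_ac)
  hence "partial j (partial i \<phi>) (x + y n) = partial i (partial j \<phi>) (x + z n)" for n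
    using t[of n] by (metis less_irrefl mult_left_cancel)
  thus ?thesis using lim[OF y(1), of j i] lim[OF z(1), of i j] LIMSEQ_unique by auto
qed

section \<open>Wirtinger calculus and the Cauchy--Pompeiu formula\<close>

definition dbar :: "(real^2 \<Rightarrow> real) \<Rightarrow> real^2 \<Rightarrow> complex" where
  "dbar \<phi> x = (of_real (partial 1 \<phi> x) + \<i> * of_real (partial 2 \<phi> x)) / 2"

definition lap :: "(real^2 \<Rightarrow> real) \<Rightarrow> real^2 \<Rightarrow> real" where
  "lap \<phi> x = partial 1 (partial 1 \<phi>) x + partial 2 (partial 2 \<phi>) x"

lemma cx_axis[simp]: "cx (axis 1 1) = 1" "cx (axis 2 1) = \<i>"
  by (simp_all add: cx_def axis_def complex_eq_iff)

text \<open>With a and b the z- and cnj z-derivatives, the real partial derivatives are a + b and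
  \<i> (a - b).\<close>

lemma wirtinger_by_parts:
  assumes \<phi>: "\<phi> \<in> test_functions"
    and U: "\<And>x. (U has_derivative (\<lambda>h. a x * cx h + b x * cnj (cx h))) (at x)"
    and a: "continuous_on UNIV a" and b: "continuous_on UNIV b"
  shows "(\<integral>x. U x * of_real (partial 1 \<phi> x) \<partial>lborel) = - (\<integral>x. (a x + b x) * of_real (\<phi> x) \<partial>lborel)"
    and "(\<integral>x. U x * of_real (partial 2 \<phi> x) \<partial>lborel) = - (\<integral>x. \<i> * (a x - b x) * of_real (\<phi> x) \<partial>lborel)"
proof -
  have "(\<integral>x. (a x * cx (axis 1 1) + b x * cnj (cx (axis 1 1))) * of_real (\<phi> x) \<partial>lborel)
      = - (\<integral>x. U x * of_real (partial 1 \<phi> x) \<partial>lborel)"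
    by (rule integration_by_parts[OF \<phi> U]) (intro continuous_intros a b)
  thus "(\<integral>x. U x * of_real (partial 1 \<phi> x) \<partial>lborel) = - (\<integral>x. (a x + b x) * of_real (\<phi> x) \<partial>lborel)" by simp
  have "(\<integral>x. (a x * cx (axis 2 1) + b x * cnj (cx (axis 2 1))) * of_real (\<phi> x) \<partial>lborel)
      = - (\<integral>x. U x * of_real (partial 2 \<phi> x) \<partial>lborel)"
    by (rule integration_by_parts[OF \<phi> U]) (intro continuous_intros a b)
  moreover have "(a x * cx (axis 2 1) + b x * cnj (cx (axis 2 1))) = \<i> * (a x - b x)" for x
    by (simp add: algebra_simps)
  ultimately show "(\<integral>x. U x * of_real (partial 2 \<phi> x) \<partial>lborel) = - (\<integral>x. \<i> * (a x - b x) * of_real (\<phi> x) \<partial>lborel)"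
    by simp
qed

lemma wirtinger_continuous:
  assumes "\<And>x. (U has_derivative (\<lambda>h. a x * cx h + b x * cnj (cx h))) (at x)"
  shows "continuous_on UNIV U"
  using assms by (auto intro!: continuous_at_imp_continuous_on has_derivative_continuous)

lemma dbar_by_parts:
  assumes \<phi>: "\<phi> \<in> test_functions"
    and U: "\<And>x. (U has_derivative (\<lambda>h. a x * cx h + b x * cnj (cx h))) (at x)"
    and a: "continuous_on UNIV a" and b: "continuous_on UNIV b"
  shows "(\<integral>x. U x * dbar \<phi> x \<partial>lborel) = - (\<integral>x. b x * of_real (\<phi> x) \<partial>lborel)"
proof -
  note Uc = wirtinger_continuous[OF U]
  note i = test_function_integrable[OF test_function_partial[OF \<phi>] Uc]
  note ia = test_function_integrable[OF \<phi> a] and ib = test_function_integrable[OF \<phi> b]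
  have "(\<integral>x. U x * dbar \<phi> x \<partial>lborel)
      = (\<integral>x. (U x * of_real (partial 1 \<phi> x) + \<i> * (U x * of_real (partial 2 \<phi> x))) / 2 \<partial>lborel)"
    by (intro Bochner_Integration.integral_cong) (auto simp: dbar_def algebra_simps)
  also have "\<dots> = ((\<integral>x. U x * of_real (partial 1 \<phi> x) \<partial>lborel) + \<i> * (\<integral>x. U x * of_real (partial 2 \<phi> x) \<partial>lborel)) / 2"
    using i by simp
  also have "(\<integral>x. U x * of_real (partial 1 \<phi> x) \<partial>lborel) = - (\<integral>x. a x * of_real (\<phi> x) + b x * of_real (\<phi> x) \<partial>lborel)"
    unfolding wirtinger_by_parts(1)[OF \<phi> U a b] by (simp add: distrib_right)
  also have "\<dots> = - ((\<integral>x. a x * of_real (\<phi> x) \<partial>lborel) + (\<integral>x. b x * of_real (\<phi> x) \<partial>lborel))"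
    using ia ib by simp
  also have "(\<integral>x. U x * of_real (partial 2 \<phi> x) \<partial>lborel) = - (\<integral>x. \<i> * (a x * of_real (\<phi> x) - b x * of_real (\<phi> x)) \<partial>lborel)"
    unfolding wirtinger_by_parts(2)[OF \<phi> U a b] by (simp add: algebra_simps)
  also have "\<dots> = - (\<i> * ((\<integral>x. a x * of_real (\<phi> x) \<partial>lborel) - (\<integral>x. b x * of_real (\<phi> x) \<partial>lborel)))"
    using ia ib by simp
  finally show ?thesis by (simp add: algebra_simps)
qed

text \<open>The weak form of factoring the Laplacian as 4 times a z- and a cnj z-derivative. As
  \<open>U\<close> is only C^1, one derivative is moved to \<open>U\<close> and the other stays on
  the test function.\<close>

lemma laplacian_by_parts:
  assumes \<phi>: "\<phi> \<in> test_functions"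
    and U: "\<And>x. (U has_derivative (\<lambda>h. a x * cx h + b x * cnj (cx h))) (at x)"
    and a: "continuous_on UNIV a" and b: "continuous_on UNIV b"
  shows "(\<integral>x. U x * of_real (lap \<phi> x) \<partial>lborel) = - 4 * (\<integral>x. a x * dbar \<phi> x \<partial>lborel)"
proof -
  note Uc = wirtinger_continuous[OF U]
  note \<phi>' = test_function_partial[OF \<phi>]
  note i = test_function_integrable[OF test_function_partial[OF \<phi>'] Uc]
  define A where "A = (\<lambda>j. \<integral>x. a x * of_real (partial j \<phi> x) \<partial>lborel)"
  define B where "B = (\<lambda>j. \<integral>x. b x * of_real (partial j \<phi> x) \<partial>lborel)"
  have ia: "integrable lborel (\<lambda>x. a x * of_real (partial j \<phi> x))"
    and ib: "integrable lborel (\<lambda>x. b x * of_real (partial j \<phi> x))" for j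
    by (rule test_function_integrable[OF \<phi>' a], rule test_function_integrable[OF \<phi>' b])
  have p1: "(\<integral>x. U x * of_real (partial 1 (partial j \<phi>) x) \<partial>lborel) = - (A j + B j)" for j
    unfolding wirtinger_by_parts(1)[OF \<phi>' U a b] A_def B_def using ia ib by (simp add: distrib_right)
  have p2: "(\<integral>x. U x * of_real (partial 2 (partial j \<phi>) x) \<partial>lborel) = - (\<i> * (A j - B j))" for j
  proof -
    have "(\<integral>x. U x * of_real (partial 2 (partial j \<phi>) x) \<partial>lborel)
      = - (\<integral>x. \<i> * (a x * of_real (partial j \<phi> x) - b x * of_real (partial j \<phi> x)) \<partial>lborel)"
      unfolding wirtinger_by_parts(2)[OF \<phi>' U a b] by (simp add: algebra_simps)
    thus ?thesis unfolding A_def B_def using ia ib by simp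
  qed
  text \<open>The symmetry of the mixed derivatives of \<open>\<phi>\<close> trades the unwanted coefficient \<open>b\<close> for \<open>a\<close>.\<close>
  have "partial 1 (partial 2 \<phi>) = partial 2 (partial 1 \<phi>)"
    using test_function_partial_commute[OF \<phi>] by (intro ext)
  hence "- (A 2 + B 2) = - (\<i> * (A 1 - B 1))" by (metis p1 p2)
  hence mixed: "A 2 + B 2 = \<i> * (A 1 - B 1)" by (simp only: neg_equal_iff_equal)
  have "(\<integral>x. U x * of_real (lap \<phi> x) \<partial>lborel)
      = (\<integral>x. U x * of_real (partial 1 (partial 1 \<phi>) x) + U x * of_real (partial 2 (partial 2 \<phi>) x) \<partial>lborel)"
    by (simp add: lap_def distrib_left)
  also have "\<dots> = - (A 1 + B 1) - \<i> * (A 2 - B 2)"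
    using i by (simp add: p1 p2)
  also have "\<dots> = - 2 * (A 1 + \<i> * A 2)"
  proof -
    have e: "A 2 - B 2 = 2 * A 2 - \<i> * (A 1 - B 1)" unfolding mixed[symmetric] by simp
    show ?thesis unfolding e by (simp add: algebra_simps)
  qed
  also have "A 1 + \<i> * A 2 = 2 * (\<integral>x. a x * dbar \<phi> x \<partial>lborel)"
  proof -
    have "(\<integral>x. a x * dbar \<phi> x \<partial>lborel)
      = (\<integral>x. (a x * of_real (partial 1 \<phi> x) + \<i> * (a x * of_real (partial 2 \<phi> x))) / 2 \<partial>lborel)"
      by (intro Bochner_Integration.integral_cong) (auto simp: dbar_def algebra_simps)
    thus ?thesis unfolding A_def using ia by (simp add: mult.commute)
  qed
  finally show ?thesis by simp
qed

lemma test_function_lipschitz: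
  assumes \<phi>: "\<phi> \<in> test_functions"
  obtains L where "L \<ge> 0" "\<And>x y. \<bar>\<phi> x - \<phi> y\<bar> \<le> L * norm (x - y)" "\<And>x. \<bar>\<phi> x\<bar> \<le> L"
proof -
  obtain C1 where C1: "C1 \<ge> 0" "\<And>x. \<bar>partial 1 \<phi> x\<bar> \<le> C1 * dec 0 x"
    using test_function_decays[OF test_function_partial[OF \<phi>]] by blast
  obtain C2 where C2: "C2 \<ge> 0" "\<And>x. \<bar>partial 2 \<phi> x\<bar> \<le> C2 * dec 0 x"
    using test_function_decays[OF test_function_partial[OF \<phi>]] by blast
  obtain C0 where C0: "C0 \<ge> 0" "\<And>x. \<bar>\<phi> x\<bar> \<le> C0 * dec 0 x"
    using test_function_decays[OF \<phi>] by blast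
  have l: "\<bar>\<phi> x - \<phi> y\<bar> \<le> (C1 + C2) * norm (x - y)" for x y
  proof -
    have "norm (\<phi> x - \<phi> y) \<le> (C1 + C2) * norm (x - y)"
    proof (rule differentiable_bound[OF convex_UNIV, where f' = "\<lambda>x h. partial 1 \<phi> x * h $ 1 + partial 2 \<phi> x * h $ 2"])
      show "(\<phi> has_derivative (\<lambda>h. partial 1 \<phi> x * h $ 1 + partial 2 \<phi> x * h $ 2)) (at x within UNIV)" for x
        by (rule has_derivative_partial[OF test_function_differentiable[OF \<phi>]])
      show "onorm (\<lambda>h::real^2. partial 1 \<phi> x * h $ 1 + partial 2 \<phi> x * h $ 2) \<le> C1 + C2" for x
      proof (rule onorm_bound)
        fix h :: "real^2"
        have "norm (partial 1 \<phi> x * h $ 1 + partial 2 \<phi> x * h $ 2) \<le> \<bar>partial 1 \<phi> x\<bar> * \<bar>h $ 1\<bar> + \<bar>partial 2 \<phi> x\<bar> * \<bar>h $ 2\<bar>"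
          unfolding real_norm_def abs_mult[symmetric] by (rule abs_triangle_ineq)
        also have "\<dots> \<le> C1 * norm h + C2 * norm h"
          using C1 C2 by (intro add_mono mult_mono component_le_norm_cart) auto
        finally show "norm (partial 1 \<phi> x * h $ 1 + partial 2 \<phi> x * h $ 2) \<le> (C1 + C2) * norm h"
          by (simp add: distrib_right)
      qed (use C1 C2 in auto)
    qed auto
    thus ?thesis by simp
  qed
  show ?thesis
  proof (rule that[of "C0 + C1 + C2"])
    show "\<bar>\<phi> x - \<phi> y\<bar> \<le> (C0 + C1 + C2) * norm (x - y)" for x y
      by (rule order_trans[OF l]) (use C0 in \<open>auto intro!: mult_right_mono\<close>)
    show "\<bar>\<phi> x\<bar> \<le> C0 + C1 + C2" for x using C0(2)[of x] C1 C2 by simp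
  qed (use C0 C1 C2 in auto)
qed

text \<open>The kernels themselves have no integrable common majorant, since their supremum over all
  d > 0 is of order r^-2 at the centre. Subtracting \<phi> y first gains one power of r from the
  Lipschitz bound.\<close>

lemma approximate_identity:
  assumes \<phi>: "\<phi> \<in> test_functions"
  shows "(\<lambda>n. \<integral>x. (1 / (real n + 1))\<^sup>2 / ((norm (x - y))\<^sup>2 + (1 / (real n + 1))\<^sup>2)\<^sup>2 * \<phi> x \<partial>lborel)
     \<longlonglongrightarrow> pi * \<phi> y"
proof -
  define d where "d = (\<lambda>n::nat. 1 / (real n + 1))"
  have d: "0 < d n" "d n \<le> 1" for n by (auto simp: d_def)
  have d0: "d \<longlonglongrightarrow> 0" unfolding d_def using LIMSEQ_inverse_real_of_nat by (simp add: inverse_eq_divide add.commute)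
  define p where "p = (\<lambda>n x. (d n)\<^sup>2 / ((norm (x - y))\<^sup>2 + (d n)\<^sup>2)\<^sup>2)"
  have hp: "has_bochner_integral lborel (p n) pi" for n
    using has_bochner_radial_translate[OF integral_poisson_kernel[OF d(1)[of n]], of y]
    unfolding p_def by (simp add: norm_minus_commute)
  obtain L where L: "L \<ge> 0" "\<And>x y. \<bar>\<phi> x - \<phi> y\<bar> \<le> L * norm (x - y)" "\<And>x. \<bar>\<phi> x\<bar> \<le> L"
    using test_function_lipschitz[OF \<phi>] by blast
  have m[measurable]: "\<phi> \<in> borel_measurable borel"
    by (rule borel_measurable_continuous_onI[OF test_function_continuous[OF \<phi>]])
  \<comment> \<open>The first part is the Lipschitz bound times r^-2, the second the bound 2 L times
    r^-4, for which the step width being at most 1 is used.\<close>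
  define w where "w = (\<lambda>x. L * (if norm (y - x) \<le> 1 then norm (y - x) powr (- 1) else 0)
     + 2 * L * (if 1 \<le> norm (y - x) then norm (y - x) powr (- 4) else 0))"
  have iw: "integrable lborel w"
    unfolding w_def
    using has_bochner_radial_translate[OF integral_powr_near[of 1 1], of y]
      has_bochner_radial_translate[OF integral_powr_far[of 4 1], of y]
    by (intro Bochner_Integration.integrable_add integrable_mult_right) (auto simp: has_bochner_integral_iff)
  have bd: "norm (p n x * (\<phi> x - \<phi> y)) \<le> w x" if x: "x \<noteq> y" for n x
  proof -
    define r where "r = norm (x - y)"
    have r: "r > 0" using x by (simp add: r_def)
    have rr: "norm (y - x) = r" by (simp add: r_def norm_minus_commute)
    have pos: "0 < r\<^sup>2 + (d n)\<^sup>2" using r by (simp add: add_pos_nonneg)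
    have p0: "p n x \<ge> 0" by (simp add: p_def)
    have p1: "p n x \<le> 1 / r\<^sup>2"
    proof -
      have "p n x = ((d n)\<^sup>2 / (r\<^sup>2 + (d n)\<^sup>2)) * (1 / (r\<^sup>2 + (d n)\<^sup>2))"
        by (simp add: p_def r_def power2_eq_square)
      also have "\<dots> \<le> 1 * (1 / r\<^sup>2)"
        using pos r by (intro mult_mono divide_left_mono) auto
      finally show ?thesis by simp
    qed
    have p2: "p n x \<le> 1 / r^4"
    proof -
      have "(d n)\<^sup>2 \<le> 1" using d[of n] by (simp add: power_le_one)
      moreover have "(r\<^sup>2)\<^sup>2 \<le> (r\<^sup>2 + (d n)\<^sup>2)\<^sup>2" by (intro power_mono) auto
      ultimately have "p n x \<le> 1 / (r\<^sup>2)\<^sup>2"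
        unfolding p_def r_def[symmetric] using r by (intro frac_le) auto
      thus ?thesis by simp
    qed
    show ?thesis
    proof (cases "r \<le> 1")
      case True
      have "norm (p n x * (\<phi> x - \<phi> y)) \<le> (1 / r\<^sup>2) * (L * r)"
        unfolding norm_mult using p0 p1 L(2)[of x y] L(1) r by (intro mult_mono) (auto simp: r_def)
      also have "\<dots> = L * r powr (- 1)"
        using r by (simp add: powr_minus power2_eq_square field_simps)
      also have "\<dots> \<le> w x" unfolding w_def rr using True L(1) by simp
      finally show ?thesis .
    next
      case False
      have "\<bar>\<phi> x - \<phi> y\<bar> \<le> 2 * L" using L(3)[of x] L(3)[of y] by linarith
      hence "norm (p n x * (\<phi> x - \<phi> y)) \<le> (1 / r^4) * (2 * L)"
        unfolding norm_mult using p0 p2 L(1) r by (intro mult_mono) auto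
      also have "\<dots> = 2 * L * r powr (- 4)"
        using r by (simp add: powr_minus divide_inverse)
      also have "\<dots> \<le> w x" unfolding w_def rr using False L(1) by simp
      finally show ?thesis .
    qed
  qed
  have lim: "(\<lambda>n. p n x * (\<phi> x - \<phi> y)) \<longlonglongrightarrow> 0" if x: "x \<noteq> y" for x
  proof -
    have "(\<lambda>n. (d n)\<^sup>2 / ((norm (x - y))\<^sup>2 + (d n)\<^sup>2)\<^sup>2 * (\<phi> x - \<phi> y))
       \<longlonglongrightarrow> 0\<^sup>2 / ((norm (x - y))\<^sup>2 + 0\<^sup>2)\<^sup>2 * (\<phi> x - \<phi> y)"
      using x by (intro tendsto_intros d0) auto
    thus ?thesis by (simp add: p_def)
  qed
  have pm[measurable]: "p n \<in> borel_measurable borel" for n unfolding p_def by measurable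
  have "(\<lambda>n. \<integral>x. p n x * (\<phi> x - \<phi> y) \<partial>lborel) \<longlonglongrightarrow> (\<integral>x. 0 \<partial>(lborel :: (real^2) measure))"
  proof (rule integral_dominated_convergence[OF _ _ iw])
    show "AE x in lborel. (\<lambda>n. p n x * (\<phi> x - \<phi> y)) \<longlonglongrightarrow> 0"
      using AE_lborel_singleton[of y] by eventually_elim (rule lim)
    show "AE x in lborel. norm (p n x * (\<phi> x - \<phi> y)) \<le> w x" for n
      using AE_lborel_singleton[of y] by eventually_elim (rule bd)
  qed auto
  moreover have "(\<integral>x. p n x * (\<phi> x - \<phi> y) \<partial>lborel) = (\<integral>x. p n x * \<phi> x \<partial>lborel) - pi * \<phi> y" for n
  proof -
    have ip: "integrable lborel (p n)" using hp by (simp add: has_bochner_integral_iff)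
    have i1: "integrable lborel (\<lambda>x. p n x * \<phi> x)"
    proof (rule Bochner_Integration.integrable_bound[OF integrable_mult_left[of L, OF ip]])
      show "AE x in lborel. norm (p n x * \<phi> x) \<le> norm (p n x * L)"
        using L by (auto intro!: AE_I2 mult_left_mono simp: norm_mult abs_mult)
    qed measurable
    have "(\<integral>x. p n x * (\<phi> x - \<phi> y) \<partial>lborel) = (\<integral>x. p n x * \<phi> x - p n x * \<phi> y \<partial>lborel)"
      by (simp add: right_diff_distrib)
    also have "\<dots> = (\<integral>x. p n x * \<phi> x \<partial>lborel) - (\<integral>x. p n x * \<phi> y \<partial>lborel)"
      by (intro Bochner_Integration.integral_diff i1 integrable_mult_left ip)
    also have "(\<integral>x. p n x * \<phi> y \<partial>lborel) = pi * \<phi> y" using hp[of n] by (simp add: has_bochner_integral_iff)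
    finally show ?thesis .
  qed
  ultimately have "(\<lambda>n. (\<integral>x. p n x * \<phi> x \<partial>lborel) - pi * \<phi> y) \<longlonglongrightarrow> 0" by simp
  hence "(\<lambda>n. \<integral>x. p n x * \<phi> x \<partial>lborel) \<longlonglongrightarrow> pi * \<phi> y" by (simp add: LIM_zero_iff)
  thus ?thesis unfolding p_def d_def .
qed

lemma dbar_decays:
  assumes \<phi>: "\<phi> \<in> test_functions"
  obtains C where "C \<ge> 0" "decays q C (dbar \<phi>)"
proof -
  obtain C1 where C1: "C1 \<ge> 0" "\<And>x. \<bar>partial 1 \<phi> x\<bar> \<le> C1 * dec q x"
    using test_function_decays[OF test_function_partial[OF \<phi>]] by blast
  obtain C2 where C2: "C2 \<ge> 0" "\<And>x. \<bar>partial 2 \<phi> x\<bar> \<le> C2 * dec q x"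
    using test_function_decays[OF test_function_partial[OF \<phi>]] by blast
  have "norm (dbar \<phi> x) \<le> (C1 + C2) * dec q x" for x
  proof -
    have "norm (dbar \<phi> x) \<le> (\<bar>partial 1 \<phi> x\<bar> + \<bar>partial 2 \<phi> x\<bar>) / 2"
      unfolding dbar_def norm_divide
      by (simp, intro order_trans[OF norm_triangle_ineq]) (simp add: norm_mult)
    also have "\<dots> \<le> (C1 * dec q x + C2 * dec q x) / 2"
      using C1(2)[of x] C2(2)[of x] by simp
    also have "\<dots> \<le> C1 * dec q x + C2 * dec q x" using C1(1) C2(1) by simp
    finally show ?thesis by (simp add: distrib_right)
  qed
  thus ?thesis using C1 C2 by (intro that[of "C1 + C2"]) (auto simp: decays_def)
qed

lemma dbar_continuous: "\<phi> \<in> test_functions \<Longrightarrow> continuous_on UNIV (dbar \<phi>)"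
  unfolding dbar_def[abs_def]
  by (intro continuous_intros test_function_continuous test_function_partial) auto

text \<open>The singular kernel is approximated by cnj z / (|z|^2 + d^2). Integration by parts is
  then legitimate on the whole plane and produces the approximate identity, so no disc has to be
  excised.\<close>

lemma cauchy_pompeiu:
  assumes \<phi>: "\<phi> \<in> test_functions"
  shows "(\<integral>x. ker_inv (cx (x - y)) * dbar \<phi> x \<partial>lborel) = - of_real (pi * \<phi> y)"
proof -
  define d where "d = (\<lambda>n::nat. 1 / (real n + 1))"
  have d: "0 < d n" for n by (auto simp: d_def)
  have d0: "d \<longlonglongrightarrow> 0" unfolding d_def using LIMSEQ_inverse_real_of_nat by (simp add: inverse_eq_divide add.commute)
  define \<rho> where "\<rho> = (\<lambda>n x. cx (x - y) * cnj (cx (x - y)) + of_real ((d n)\<^sup>2))"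
  have \<rho>r: "\<rho> n x = of_real ((norm (x - y))\<^sup>2 + (d n)\<^sup>2)" for n x
    by (simp add: \<rho>_def flip: complex_norm_square)
  have pos: "0 < (norm (x - y))\<^sup>2 + (d n)\<^sup>2" for n x
    using d[of n] by (simp add: add_nonneg_pos)
  have \<rho>0: "\<rho> n x \<noteq> 0" for n x unfolding \<rho>r of_real_eq_0_iff using pos[where n = n and x = x] by (metis less_irrefl)
  define F where "F = (\<lambda>n x. cnj (cx (x - y)) / \<rho> n x)"
  define a where "a = (\<lambda>n x. - (cnj (cx (x - y)))\<^sup>2 / (\<rho> n x)\<^sup>2)"
  define b where "b = (\<lambda>n x. of_real ((d n)\<^sup>2) / (\<rho> n x)\<^sup>2)"
  have dz: "((\<lambda>x. cx (x - y)) has_derivative cx) (at x)" for x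
    unfolding cx_diff by (auto intro!: derivative_eq_intros)
  have dzc: "((\<lambda>x. cnj (cx (x - y))) has_derivative (\<lambda>h. cnj (cx h))) (at x)" for x
    by (rule bounded_linear.has_derivative[OF bounded_linear_cnj dz])
  have d\<rho>: "(\<rho> n has_derivative (\<lambda>h. cx (x - y) * cnj (cx h) + cx h * cnj (cx (x - y)))) (at x)" for n x
    unfolding \<rho>_def using has_derivative_add_const[OF has_derivative_mult[OF dz dzc]] .
  have dF: "(F n has_derivative (\<lambda>h. a n x * cx h + b n x * cnj (cx h))) (at x)" for n x
    unfolding F_def
  proof (rule has_derivative_eq_rhs[OF has_derivative_divide'[OF dzc d\<rho> \<rho>0]], rule ext)
    fix h
    have "(cnj (cx h) * \<rho> n x - cnj (cx (x - y)) * (cx (x - y) * cnj (cx h) + cx h * cnj (cx (x - y))))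
      = - (cnj (cx (x - y)))\<^sup>2 * cx h + of_real ((d n)\<^sup>2) * cnj (cx h)"
      unfolding \<rho>_def by (simp add: algebra_simps power2_eq_square)
    thus "(cnj (cx h) * \<rho> n x - cnj (cx (x - y)) * (cx (x - y) * cnj (cx h) + cx h * cnj (cx (x - y)))) / (\<rho> n x * \<rho> n x)
       = a n x * cx h + b n x * cnj (cx h)"
      unfolding a_def b_def by (simp add: add_divide_distrib diff_divide_distrib power2_eq_square)
  qed
  have \<rho>c: "continuous_on UNIV (\<rho> n)" for n using d\<rho> by (auto intro!: continuous_at_imp_continuous_on has_derivative_continuous)
  have ac: "continuous_on UNIV (a n)" and bc: "continuous_on UNIV (b n)" for n
    unfolding a_def b_def using \<rho>0 by (auto intro!: continuous_intros \<rho>c)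
  have eq: "(\<integral>x. F n x * dbar \<phi> x \<partial>lborel) = - of_real (\<integral>x. (d n)\<^sup>2 / ((norm (x - y))\<^sup>2 + (d n)\<^sup>2)\<^sup>2 * \<phi> x \<partial>lborel)" for n
  proof -
    have "b n x * of_real (\<phi> x) = of_real ((d n)\<^sup>2 / ((norm (x - y))\<^sup>2 + (d n)\<^sup>2)\<^sup>2 * \<phi> x)" for x
      unfolding b_def \<rho>r by simp
    thus ?thesis unfolding dbar_by_parts[OF \<phi> dF ac bc] by (simp del: of_real_mult of_real_divide)
  qed
  have r: "(\<lambda>n. \<integral>x. F n x * dbar \<phi> x \<partial>lborel) \<longlonglongrightarrow> - of_real (pi * \<phi> y)"
    unfolding eq unfolding d_def by (intro tendsto_minus tendsto_of_real approximate_identity[OF \<phi>])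
  obtain C where C: "C \<ge> 0" "decays 3 C (dbar \<phi>)" using dbar_decays[OF \<phi>] by blast
  have mF: "F n \<in> borel_measurable borel" for n
    using dF by (intro borel_measurable_continuous_onI) (auto intro!: continuous_at_imp_continuous_on has_derivative_continuous)
  have mb[measurable]: "dbar \<phi> \<in> borel_measurable borel"
    by (rule borel_measurable_continuous_onI[OF dbar_continuous[OF \<phi>]])
  have l: "(\<lambda>n. \<integral>x. F n x * dbar \<phi> x \<partial>lborel) \<longlonglongrightarrow> (\<integral>x. ker_inv (cx (x - y)) * dbar \<phi> x \<partial>lborel)"
  proof (rule integral_dominated_convergence[where w = "\<lambda>x. C * (norm (y - x) powr (- 1) * dec 3 x)"])
    show "integrable lborel (\<lambda>x. C * (norm (y - x) powr (- 1) * dec 3 x))"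
      by (intro integrable_mult_right singular_dec_integral) auto
    show "(\<lambda>x. F n x * dbar \<phi> x) \<in> borel_measurable lborel" for n using mF by measurable
    show "(\<lambda>x. ker_inv (cx (x - y)) * dbar \<phi> x) \<in> borel_measurable lborel" by measurable
    show "AE x in lborel. (\<lambda>n. F n x * dbar \<phi> x) \<longlonglongrightarrow> ker_inv (cx (x - y)) * dbar \<phi> x"
      using AE_lborel_singleton[of y]
    proof eventually_elim
      case (elim x)
      hence nz: "cx (x - y) \<noteq> 0" by simp
      have "(\<lambda>n. cnj (cx (x - y)) / (cx (x - y) * cnj (cx (x - y)) + of_real ((d n)\<^sup>2)) * dbar \<phi> x)
        \<longlonglongrightarrow> cnj (cx (x - y)) / (cx (x - y) * cnj (cx (x - y)) + of_real (0\<^sup>2)) * dbar \<phi> x"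
        using nz by (intro tendsto_intros d0) auto
      moreover have "cnj (cx (x - y)) / (cx (x - y) * cnj (cx (x - y)) + of_real (0\<^sup>2)) = ker_inv (cx (x - y))"
        using nz by (simp add: ker_inv_def)
      ultimately show ?case unfolding F_def \<rho>_def by simp
    qed
    \<comment> \<open>Regularising only makes the kernel smaller, so 1/|x - y| serves as majorant
      for all n.\<close>
    show "AE x in lborel. norm (F n x * dbar \<phi> x) \<le> C * (norm (y - x) powr (- 1) * dec 3 x)" for n
      using AE_lborel_singleton[of y]
    proof eventually_elim
      case (elim x)
      hence p: "norm (x - y) > 0" by simp
      have "norm (F n x) = norm (x - y) / ((norm (x - y))\<^sup>2 + (d n)\<^sup>2)"
        using pos[where n = n and x = x] unfolding F_def \<rho>r norm_divide by (simp del: of_real_add)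
      also have "\<dots> \<le> norm (x - y) / (norm (x - y))\<^sup>2"
        using p pos[where n = n and x = x] by (intro divide_left_mono) auto
      also have "\<dots> = 1 / norm (y - x)" by (simp add: power2_eq_square norm_minus_commute)
      finally have "norm (F n x * dbar \<phi> x) \<le> (1 / norm (y - x)) * (C * dec 3 x)"
        unfolding norm_mult by (intro mult_mono decaysD[OF C(2)]) auto
      thus ?case unfolding inverse_eq_powr by (simp only: mult_ac)
    qed
  qed
  show ?thesis by (rule LIMSEQ_unique[OF l r])
qed

text \<open>This says that 1/(\<pi> z) is a fundamental solution of the cnj z derivative. After
  Fubini the inner integral over x is the Cauchy--Pompeiu formula at y.\<close>

lemma conv_inv_weak_dbar:
  assumes \<phi>: "\<phi> \<in> test_functions" and [measurable]: "G \<in> borel_measurable borel"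
    and G: "decays q c G" and q: "q > 3"
  shows "(\<integral>x. conv ker_inv G x * dbar \<phi> x \<partial>lborel) = - of_real pi * (\<integral>y. G y * of_real (\<phi> y) \<partial>lborel)"
proof -
  obtain C where C: "C \<ge> 0" "decays 3 C (dbar \<phi>)" using dbar_decays[OF \<phi>] by blast
  have mb[measurable]: "dbar \<phi> \<in> borel_measurable borel"
    by (rule borel_measurable_continuous_onI[OF dbar_continuous[OF \<phi>]])
  note i = conv_integrable[OF kernel_singular_imp_growth[OF kernel_singular_inv] assms(2) G q]
  define f where "f = (\<lambda>x y. ker_inv (cx (x - y)) * G y * dbar \<phi> x)"
  have I: "integrable (lborel \<Otimes>\<^sub>M lborel) (case_prod f)"
  proof (rule lborel_pair.Fubini_integrable)
    show "case_prod f \<in> borel_measurable (lborel \<Otimes>\<^sub>M lborel)" unfolding f_def by measurable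
    show "AE x in lborel. integrable lborel (\<lambda>y. case_prod f (x, y))"
      unfolding f_def using i by (auto intro!: AE_I2 integrable_mult_left)
    have c: "c \<ge> 0" by (rule decays_nonneg[OF G])
    define B where "B = c * (2 * pi / (2 - 1) + integral\<^sup>L lborel (dec q))"
    have S: "integrable lborel (\<lambda>y. norm (x - y) powr (- 1) * dec q y)"
      "(\<integral>y. norm (x - y) powr (- 1) * dec q y \<partial>lborel) \<le> 2 * pi / (2 - 1) + integral\<^sup>L lborel (dec q)" for x
      by (rule singular_dec_integral; use q in simp)+
    \<comment> \<open>The inner integral is bounded uniformly in x, so the decay of
      \<open>dbar \<phi>\<close> alone makes the double integral finite.\<close>
    have N: "(\<integral>y. norm (ker_inv (cx (x - y)) * G y) \<partial>lborel) \<le> B" for x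
    proof -
      have "(\<integral>y. norm (ker_inv (cx (x - y)) * G y) \<partial>lborel) \<le> (\<integral>y. c * (norm (x - y) powr (- 1) * dec q y) \<partial>lborel)"
      proof (intro integral_mono integrable_norm i integrable_mult_right S(1))
        fix y
        have "norm (ker_inv (cx (x - y)) * G y) \<le> (1 / norm (x - y)) * (c * dec q y)"
          unfolding norm_mult by (intro mult_mono decaysD[OF G]) (auto simp: ker_inv_def norm_divide)
        thus "norm (ker_inv (cx (x - y)) * G y) \<le> c * (norm (x - y) powr (- 1) * dec q y)"
          unfolding inverse_eq_powr by (simp only: mult_ac)
      qed
      also have "\<dots> \<le> B" unfolding integral_mult_right_zero B_def by (intro mult_left_mono S(2) c)
      finally show ?thesis .
    qed
    have e: "(\<integral>y. norm (case_prod f (x, y)) \<partial>lborel) = (\<integral>y. norm (ker_inv (cx (x - y)) * G y) \<partial>lborel) * norm (dbar \<phi> x)" for x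
      unfolding f_def by (simp add: norm_mult)
    show "integrable lborel (\<lambda>x. \<integral>y. norm (case_prod f (x, y)) \<partial>lborel)"
    proof (rule integrable_of_dec[of _ 3 "B * C"])
      show "(\<lambda>x. \<integral>y. norm (case_prod f (x, y)) \<partial>lborel) \<in> borel_measurable borel"
        unfolding f_def by measurable
      have "0 \<le> (\<integral>y. norm (ker_inv (cx (x - y)) * G y) \<partial>lborel)" for x
        by (rule Bochner_Integration.integral_nonneg) simp
      thus "norm (\<integral>y. norm (case_prod f (x, y)) \<partial>lborel) \<le> B * C * dec 3 x" for x
        unfolding e using mult_mono[OF N[of x] decaysD[OF C(2), of x]] order_trans[OF _ N[of x]]
        by (simp add: abs_mult mult.assoc)
    qed simp
  qed
  have "(\<integral>x. conv ker_inv G x * dbar \<phi> x \<partial>lborel) = (\<integral>x. (\<integral>y. f x y \<partial>lborel) \<partial>lborel)"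
    unfolding conv_def f_def by simp
  also have "\<dots> = (\<integral>y. (\<integral>x. f x y \<partial>lborel) \<partial>lborel)"
    by (rule lborel_pair.Fubini_integral[OF I, symmetric])
  also have "\<dots> = (\<integral>y. - of_real pi * (G y * of_real (\<phi> y)) \<partial>lborel)"
  proof (intro Bochner_Integration.integral_cong refl)
    fix y
    have "(\<integral>x. f x y \<partial>lborel) = (\<integral>x. G y * (ker_inv (cx (x - y)) * dbar \<phi> x) \<partial>lborel)"
      unfolding f_def by (simp add: mult_ac)
    also have "\<dots> = G y * - of_real (pi * \<phi> y)" using cauchy_pompeiu[OF \<phi>, of y] by simp
    finally show "(\<integral>x. f x y \<partial>lborel) = - of_real pi * (G y * of_real (\<phi> y))" by simp
  qed
  also have "\<dots> = - of_real pi * (\<integral>y. G y * of_real (\<phi> y) \<partial>lborel)" by (rule integral_mult_right_zero)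
  finally show ?thesis .
qed

section \<open>The Stokes operator\<close>

lemma kernel_singular_cmult:
  assumes "kernel_singular K"
  shows "kernel_singular (\<lambda>z. a * K z)"
proof -
  from assms obtain c d where [measurable]: "K \<in> borel_measurable borel" and c: "c \<ge> 0" "\<And>z. norm (K z) \<le> c / norm z"
    and d: "d \<ge> 0" "\<And>z w. z \<noteq> 0 \<Longrightarrow> z \<noteq> w \<Longrightarrow> norm (K (z - w) - K z) \<le> d * norm w / (norm z * norm (z - w))"
    unfolding kernel_singular_def by blast
  have "norm (a * K z) \<le> norm a * c / norm z" for z
    using mult_left_mono[OF c(2)[of z], of "norm a"] by (simp add: norm_mult)
  moreover have "norm (a * K (z - w) - a * K z) \<le> norm a * d * norm w / (norm z * norm (z - w))"
    if "z \<noteq> 0" "z \<noteq> w" for z w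
  proof -
    have "a * K (z - w) - a * K z = a * (K (z - w) - K z)" by (simp add: algebra_simps)
    thus ?thesis using mult_left_mono[OF d(2)[OF that], of "norm a"] by (simp add: norm_mult mult.assoc)
  qed
  moreover have "norm a * c \<ge> 0" "norm a * d \<ge> 0" using c d by auto
  moreover have "(\<lambda>z. a * K z) \<in> borel_measurable borel" by measurable
  ultimately show ?thesis unfolding kernel_singular_def by blast
qed

lemma conv_cmult: "conv (\<lambda>z. a * K z) G x = a * conv K G x"
  unfolding conv_def by (simp add: mult.assoc)

text \<open>Convolution with the Stokeslet (log r \<delta>_ij - x_i x_j / r^2) / (4 \<pi>): as a
  complex number, x (x . g) / r^2 is g/2 + (z / cnj z) cnj g / 2. The term g/2 contributes only a
  multiple of \<integral> G, which vanishes for the sources of interest, and is left out.\<close>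

definition velo :: "(real^2 \<Rightarrow> complex) \<Rightarrow> real^2 \<Rightarrow> complex" where
  "velo G x = 1 / (4 * of_real pi) * (conv ker_log G x - 1 / 2 * conv ker_phase (\<lambda>y. cnj (G y)) x)"

definition velo_z :: "(real^2 \<Rightarrow> complex) \<Rightarrow> real^2 \<Rightarrow> complex" where
  "velo_z G x = 1 / (8 * of_real pi) * (conv ker_inv G x - conv ker_cinv (\<lambda>y. cnj (G y)) x)"

definition velo_b :: "(real^2 \<Rightarrow> complex) \<Rightarrow> real^2 \<Rightarrow> complex" where
  "velo_b G x = 1 / (8 * of_real pi) * (conv ker_cinv G x + conv ker_strain (\<lambda>y. cnj (G y)) x)"

text \<open>The usual Stokes pressure: the real part of g/z is x . g / r^2, the gradient of log r
  paired with g.\<close>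

definition press :: "(real^2 \<Rightarrow> complex) \<Rightarrow> real^2 \<Rightarrow> real" where
  "press G x = - Re (conv ker_inv G x) / (2 * pi)"

lemma decays_cnj: "decays q c G \<Longrightarrow> decays q c (\<lambda>y. cnj (G y))"
  by (simp add: decays_def)

lemma conv_cinv_cnj: "conv ker_cinv (\<lambda>y. cnj (G y)) x = cnj (conv ker_inv G x)"
  unfolding conv_def by (rule trans[OF _ Bochner_Integration.integral_cnj]) (simp add: ker_cinv_def ker_inv_def)

text \<open>The divergence of a plane field is twice the real part of its z-derivative, and here
  that derivative is a real multiple of a number minus its conjugate.\<close>

lemma Re_velo_z: "Re (velo_z G x) = 0"
  unfolding velo_z_def conv_cinv_cnj by (simp add: Re_divide complex_eq_iff)

lemma velo_has_derivative:
  assumes m[measurable]: "G \<in> borel_measurable borel" and G: "decays q c G" and q: "q > 3"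
  shows "(velo G has_derivative (\<lambda>h. velo_z G x * cx h + velo_b G x * cnj (cx h))) (at x)"
proof -
  have m': "(\<lambda>y. cnj (G y)) \<in> borel_measurable borel" by measurable
  note L = conv_has_derivative[OF kernel_growth_log kernel_taylor_log kernel_singular_cmult[OF kernel_singular_inv]
      kernel_singular_cmult[OF kernel_singular_cinv] m G q, of x]
  have st: "kernel_singular (\<lambda>z. - ker_strain z)"
    using kernel_singular_cmult[OF kernel_singular_strain, of "-1"] by simp
  note P = conv_has_derivative[OF kernel_growth_phase kernel_taylor_phase kernel_singular_cinv st m' decays_cnj[OF G] q, of x]
  have st': "conv (\<lambda>z. - ker_strain z) (\<lambda>y. cnj (G y)) x = - conv ker_strain (\<lambda>y. cnj (G y)) x"
    using conv_cmult[of "-1" ker_strain] by simp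
  have "(velo G has_derivative (\<lambda>h. 1 / (4 * of_real pi) *
      ((conv (\<lambda>z. 1 / 2 * ker_inv z) G x * cx h + conv (\<lambda>z. 1 / 2 * ker_cinv z) G x * cnj (cx h))
       - 1 / 2 * (conv ker_cinv (\<lambda>y. cnj (G y)) x * cx h + conv (\<lambda>z. - ker_strain z) (\<lambda>y. cnj (G y)) x * cnj (cx h))))) (at x)"
    unfolding velo_def[abs_def]
    by (intro has_derivative_mult_right has_derivative_diff L P)
  thus ?thesis
  proof (rule has_derivative_eq_rhs, intro ext)
    fix h
    show "1 / (4 * of_real pi) *
      ((conv (\<lambda>z. 1 / 2 * ker_inv z) G x * cx h + conv (\<lambda>z. 1 / 2 * ker_cinv z) G x * cnj (cx h))
       - 1 / 2 * (conv ker_cinv (\<lambda>y. cnj (G y)) x * cx h + conv (\<lambda>z. - ker_strain z) (\<lambda>y. cnj (G y)) x * cnj (cx h)))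
      = velo_z G x * cx h + velo_b G x * cnj (cx h)"
      unfolding velo_z_def velo_b_def conv_cmult st' by (simp add: field_simps)
  qed
qed

lemma velo_deriv_continuous:
  assumes m[measurable]: "G \<in> borel_measurable borel" and G: "decays q c G" and q: "q > 3"
  shows "continuous_on UNIV (velo_z G)" "continuous_on UNIV (velo_b G)" "continuous_on UNIV (press G)"
proof -
  have m': "(\<lambda>y. cnj (G y)) \<in> borel_measurable borel" by measurable
  note c = conv_continuous[OF kernel_singular_inv m G q] conv_continuous[OF kernel_singular_cinv m' decays_cnj[OF G] q]
    conv_continuous[OF kernel_singular_cinv m G q] conv_continuous[OF kernel_singular_strain m' decays_cnj[OF G] q]
  show "continuous_on UNIV (velo_z G)" "continuous_on UNIV (velo_b G)" "continuous_on UNIV (press G)"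
    unfolding velo_z_def[abs_def] velo_b_def[abs_def] press_def[abs_def] by (intro continuous_intros c; simp)+
qed

lemma conv_diff:
  assumes K: "kernel_growth K" and [measurable]: "G \<in> borel_measurable borel" "H \<in> borel_measurable borel"
    and G: "decays q c G" and H: "decays q d H" and q: "q > 3"
  shows "conv K (\<lambda>y. G y - H y) x = conv K G x - conv K H x"
  unfolding conv_def right_diff_distrib
  by (intro Bochner_Integration.integral_diff conv_integrable[OF K _ G q] conv_integrable[OF K _ H q]) auto

lemma velo_diff:
  assumes m[measurable]: "G \<in> borel_measurable borel" "H \<in> borel_measurable borel"
    and G: "decays q c G" and H: "decays q d H" and q: "q > 3"
  shows "velo (\<lambda>y. G y - H y) x = velo G x - velo H x"
    "velo_z (\<lambda>y. G y - H y) x = velo_z G x - velo_z H x"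
    "velo_b (\<lambda>y. G y - H y) x = velo_b G x - velo_b H x"
proof -
  have m': "(\<lambda>y. cnj (G y)) \<in> borel_measurable borel" "(\<lambda>y. cnj (H y)) \<in> borel_measurable borel" by measurable
  note d = conv_diff[OF _ m G H q] conv_diff[OF _ m' decays_cnj[OF G] decays_cnj[OF H] q]
  note k = kernel_growth_log kernel_growth_phase kernel_singular_inv[THEN kernel_singular_imp_growth]
    kernel_singular_cinv[THEN kernel_singular_imp_growth] kernel_singular_strain[THEN kernel_singular_imp_growth]
  show "velo (\<lambda>y. G y - H y) x = velo G x - velo H x"
    "velo_z (\<lambda>y. G y - H y) x = velo_z G x - velo_z H x"
    "velo_b (\<lambda>y. G y - H y) x = velo_b G x - velo_b H x"
    unfolding velo_def velo_z_def velo_b_def complex_cnj_diff d[OF k(1)] d[OF k(2)] d[OF k(3)] d[OF k(4)] d[OF k(5)]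
    by (simp_all add: algebra_simps)
qed

lemma dbar_mult_integrable:
  assumes \<phi>: "\<phi> \<in> test_functions" and U: "continuous_on UNIV U"
  shows "integrable lborel (\<lambda>x. U x * dbar \<phi> x)"
proof -
  have "integrable lborel (\<lambda>x. (U x * of_real (partial 1 \<phi> x) + \<i> * (U x * of_real (partial 2 \<phi> x))) / 2)"
    using test_function_integrable[OF test_function_partial[OF \<phi>] U]
    by (intro integrable_divide_zero Bochner_Integration.integrable_add integrable_mult_right) auto
  thus ?thesis by (simp add: dbar_def algebra_simps)
qed

lemma stokes_weak:
  assumes \<phi>: "\<phi> \<in> test_functions" and m[measurable]: "G \<in> borel_measurable borel"
    and G: "decays q c G" and q: "q > 3"
  shows "(\<integral>x. velo G x * of_real (lap \<phi> x) \<partial>lborel) + 2 * (\<integral>x. of_real (press G x) * dbar \<phi> x \<partial>lborel)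
    = (\<integral>x. G x * of_real (\<phi> x) \<partial>lborel)"
proof -
  note c = velo_deriv_continuous[OF m G q]
  have c3: "continuous_on UNIV (\<lambda>x. complex_of_real (press G x))" by (intro continuous_intros c)
  \<comment> \<open>The imaginary part of the convolution is the velocity derivative and its real
    part the pressure: it equals \<pi> (4 \<open>velo_z\<close> - 2 \<open>press\<close>). Thus
    Laplacian and pressure gradient combine into a single cnj z derivative.\<close>
  have X: "conv ker_inv G x = - of_real pi * (- 4 * velo_z G x + 2 * of_real (press G x))" for x
  proof -
    have "conv ker_inv G x - cnj (conv ker_inv G x) = 2 * \<i> * of_real (Im (conv ker_inv G x))"
      by (simp add: complex_eq_iff)
    hence "velo_z G x = 1 / (8 * of_real pi) * (2 * \<i> * of_real (Im (conv ker_inv G x)))"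
      unfolding velo_z_def conv_cinv_cnj by simp
    thus ?thesis unfolding press_def by (simp add: complex_eq_iff field_simps)
  qed
  have "(\<integral>x. velo G x * of_real (lap \<phi> x) \<partial>lborel) = - 4 * (\<integral>x. velo_z G x * dbar \<phi> x \<partial>lborel)"
    by (rule laplacian_by_parts[OF \<phi> velo_has_derivative[OF m G q] c(1,2)])
  moreover have "(\<integral>x. conv ker_inv G x * dbar \<phi> x \<partial>lborel)
     = - of_real pi * (- 4 * (\<integral>x. velo_z G x * dbar \<phi> x \<partial>lborel) + 2 * (\<integral>x. of_real (press G x) * dbar \<phi> x \<partial>lborel))"
  proof -
    have "(\<integral>x. conv ker_inv G x * dbar \<phi> x \<partial>lborel)
      = (\<integral>x. - of_real pi * (- 4 * (velo_z G x * dbar \<phi> x) + 2 * (of_real (press G x) * dbar \<phi> x)) \<partial>lborel)"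
      unfolding X by (intro Bochner_Integration.integral_cong refl) (simp add: algebra_simps)
    also have "\<dots> = - of_real pi * (\<integral>x. - 4 * (velo_z G x * dbar \<phi> x) + 2 * (of_real (press G x) * dbar \<phi> x) \<partial>lborel)"
      by (rule integral_mult_right_zero)
    also have "(\<integral>x. - 4 * (velo_z G x * dbar \<phi> x) + 2 * (of_real (press G x) * dbar \<phi> x) \<partial>lborel)
      = (\<integral>x. - 4 * (velo_z G x * dbar \<phi> x) \<partial>lborel) + (\<integral>x. 2 * (of_real (press G x) * dbar \<phi> x) \<partial>lborel)"
      by (intro Bochner_Integration.integral_add integrable_mult_right dbar_mult_integrable[OF \<phi>] c c3)
    finally show ?thesis unfolding integral_mult_right_zero .
  qed
  ultimately have "- of_real pi * ((\<integral>x. velo G x * of_real (lap \<phi> x) \<partial>lborel) + 2 * (\<integral>x. of_real (press G x) * dbar \<phi> x \<partial>lborel))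
    = - of_real pi * (\<integral>x. G x * of_real (\<phi> x) \<partial>lborel)"
    unfolding conv_inv_weak_dbar[OF \<phi> m G q] by simp
  thus ?thesis by simp
qed

text \<open>The real part of the moment with cnj z is left free on purpose: its contributions to the
  far field through the logarithm and through the phase cancel.\<close>

definition admissible :: "real \<Rightarrow> real \<Rightarrow> (real^2 \<Rightarrow> complex) \<Rightarrow> bool" where
  "admissible e c G \<longleftrightarrow> G \<in> borel_measurable borel \<and> decays (3 + e) c G \<and> integral\<^sup>L lborel G = 0 \<and>
     (\<integral>y. cx y * G y \<partial>lborel) = 0 \<and> Im (\<integral>y. cnj (cx y) * G y \<partial>lborel) = 0"

text \<open>The factor 2^p comes from 1 + |x| being at most 2 inside the unit disc and at most 2 |x|
  outside.\<close>

lemma decay_combine: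
  fixes f :: "real^2 \<Rightarrow> complex"
  assumes near: "\<And>x. norm x \<le> 1 \<Longrightarrow> norm (f x) \<le> A" and far: "\<And>x. x \<noteq> 0 \<Longrightarrow> norm (f x) \<le> A * norm x powr (- p)"
    and p: "p \<ge> 0"
  shows "decays p (2 powr p * A) f"
  unfolding decays_def
proof
  fix x
  have A: "A \<ge> 0" using near[of 0] norm_ge_zero[of "f 0"] by (simp del: norm_ge_zero)
  show "norm (f x) \<le> 2 powr p * A * dec p x"
  proof (cases "norm x \<le> 1")
    case True
    have pos: "1 + norm x > 0" using norm_ge_zero[of x] by linarith
    have "2 powr (- p) \<le> dec p x"
      unfolding dec_def using p pos True by (intro powr_mono2') auto
    hence "2 powr p * 2 powr (- p) \<le> 2 powr p * dec p x" by (intro mult_left_mono) auto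
    hence "1 \<le> 2 powr p * dec p x" by (simp flip: powr_add)
    hence "A * 1 \<le> A * (2 powr p * dec p x)" using A by (intro mult_left_mono)
    thus ?thesis using near[OF True] by (simp add: mult_ac)
  next
    case False
    have pos: "1 + norm x > 0" using norm_ge_zero[of x] by linarith
    have "norm x powr (- p) \<le> ((1 + norm x) / 2) powr (- p)"
      using False p by (intro powr_mono2') auto
    also have "\<dots> = 2 powr p * dec p x"
      unfolding dec_def using pos by (simp add: powr_divide powr_minus field_simps)
    finally have "A * norm x powr (- p) \<le> A * (2 powr p * dec p x)" using A by (intro mult_left_mono)
    moreover have "x \<noteq> 0" using False by auto
    ultimately show ?thesis using far[of x] by (simp add: mult_ac)
  qed
qed

lemma decays_mono: "decays q c f \<Longrightarrow> c \<le> d \<Longrightarrow> decays q d f"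
  unfolding decays_def by (meson dec_pos(2) mult_right_mono order_trans)

text \<open>The far field follows from \<open>conv_expansion\<close> for the five kernels once the
  moment conditions have removed all leading terms. Near the origin the gradient is bounded by
  \<open>conv_bounded\<close>, and the velocity by integrating the gradient.\<close>

lemma velo_decay:
  assumes e: "0 < e" "e < 1"
  obtains C where "C > 0"
    "\<And>G c. admissible e c G \<Longrightarrow>
      decays (1 + e) (C * c) (velo G) \<and> decays (2 + e) (C * c) (velo_z G) \<and> decays (2 + e) (C * c) (velo_b G)"
proof -
  define S where "S = (\<lambda>C K \<alpha> \<beta> n. C \<ge> 0 \<and> (\<forall>G c x. G \<in> borel_measurable borel \<longrightarrow> decays (3 + e) c G \<longrightarrow> integral\<^sup>L lborel G = 0 \<longrightarrow> x \<noteq> 0 \<longrightarrow>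
      norm (conv K G x + \<alpha> (cx x) * (\<integral>y. cx y * G y \<partial>lborel) + \<beta> (cx x) * (\<integral>y. cnj (cx y) * G y \<partial>lborel))
        \<le> C * c * norm x powr (- (real n + e))))"
  have ex: "\<exists>C. S C K \<alpha> \<beta> n" if "kernel_growth K" "kernel_taylor n K \<alpha> \<beta>" for K \<alpha> \<beta> n
  proof (rule conv_expansion[OF that e])
    fix C assume "0 \<le> C" "\<And>G c x. G \<in> borel_measurable borel \<Longrightarrow> decays (3 + e) c G \<Longrightarrow> integral\<^sup>L lborel G = 0 \<Longrightarrow> x \<noteq> 0 \<Longrightarrow>
      norm (conv K G x + \<alpha> (cx x) * (\<integral>y. cx y * G y \<partial>lborel) + \<beta> (cx x) * (\<integral>y. cnj (cx y) * G y \<partial>lborel))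
        \<le> C * c * norm x powr (- (real n + e))"
    thus ?thesis unfolding S_def by blast
  qed
  obtain C1 where C1: "S C1 ker_log (\<lambda>z. 1 / 2 * ker_inv z) (\<lambda>z. 1 / 2 * ker_cinv z) 1"
    using ex[OF kernel_growth_log kernel_taylor_log] by blast
  obtain C2 where C2: "S C2 ker_phase ker_cinv (\<lambda>z. - ker_strain z) 1"
    using ex[OF kernel_growth_phase kernel_taylor_phase] by blast
  obtain C3 where C3: "S C3 ker_inv (\<lambda>z. - 1 / z\<^sup>2) (\<lambda>z. 0) 2"
    using ex[OF kernel_singular_imp_growth[OF kernel_singular_inv] kernel_taylor_inv] by blast
  obtain C4 where C4: "S C4 ker_cinv (\<lambda>z. 0) (\<lambda>z. - 1 / (cnj z)\<^sup>2) 2"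
    using ex[OF kernel_singular_imp_growth[OF kernel_singular_cinv] kernel_taylor_cinv] by blast
  obtain C5 where C5: "S C5 ker_strain (\<lambda>z. 1 / (cnj z)\<^sup>2) (\<lambda>z. - 2 * z / (cnj z)^3) 2"
    using ex[OF kernel_singular_imp_growth[OF kernel_singular_strain] kernel_taylor_strain] by blast
  have q: "3 + e > 2" "3 + e > 3" using e by auto
  obtain B1 where B1: "B1 \<ge> 0"
    "\<And>G c x. G \<in> borel_measurable borel \<Longrightarrow> decays (3 + e) c G \<Longrightarrow> norm (conv ker_inv G x) \<le> B1 * c"
    by (rule conv_bounded[OF kernel_singular_inv q(1)]) blast
  obtain B2 where B2: "B2 \<ge> 0"
    "\<And>G c x. G \<in> borel_measurable borel \<Longrightarrow> decays (3 + e) c G \<Longrightarrow> norm (conv ker_cinv G x) \<le> B2 * c"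
    by (rule conv_bounded[OF kernel_singular_cinv q(1)]) blast
  obtain B3 where B3: "B3 \<ge> 0"
    "\<And>G c x. G \<in> borel_measurable borel \<Longrightarrow> decays (3 + e) c G \<Longrightarrow> norm (conv ker_strain G x) \<le> B3 * c"
    by (rule conv_bounded[OF kernel_singular_strain q(1)]) blast
  define A where "A = C1 + C2 + 2 * C3 + C4 + C5 + 2 * B1 + B2 + B3"
  have nn: "C1 \<ge> 0" "C2 \<ge> 0" "C3 \<ge> 0" "C4 \<ge> 0" "C5 \<ge> 0" using C1 C2 C3 C4 C5 by (auto simp: S_def)
  have A0: "A \<ge> 0" using nn B1 B2 B3 by (simp add: A_def)
  have le_pi: "1 / (4 * pi) \<le> 1" "1 / (8 * pi) \<le> 1" using pi_gt3 by (simp_all add: divide_le_eq)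
  have main: "decays (1 + e) (2 powr (1 + e) * (5 * A * c)) (velo G)
      \<and> decays (2 + e) (2 powr (2 + e) * (A * c)) (velo_z G) \<and> decays (2 + e) (2 powr (2 + e) * (A * c)) (velo_b G)"
    if adm: "admissible e c G" for G c
  proof -
    from adm have m[measurable]: "G \<in> borel_measurable borel" and G: "decays (3 + e) c G" and G0: "integral\<^sup>L lborel G = 0"
      and m1: "(\<integral>y. cx y * G y \<partial>lborel) = 0" and m2: "Im (\<integral>y. cnj (cx y) * G y \<partial>lborel) = 0"
      by (auto simp: admissible_def)
    have c: "c \<ge> 0" by (rule decays_nonneg[OF G])
    have m': "(\<lambda>y. cnj (G y)) \<in> borel_measurable borel" by measurable
    note G' = decays_cnj[OF G]
    have G0': "(\<integral>y. cnj (G y) \<partial>lborel) = 0" using G0 Bochner_Integration.integral_cnj[of lborel G] by simp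
    define \<mu> where "\<mu> = (\<integral>y. cnj (cx y) * G y \<partial>lborel)"
    have "(\<integral>y. cx y * cnj (G y) \<partial>lborel) = cnj \<mu>" unfolding \<mu>_def by (rule trans[OF _ Bochner_Integration.integral_cnj]) simp
    \<comment> \<open>Vanishing torque makes \<mu> real. This equality lets the expansions with
      \<open>G\<close> and with its conjugate cancel each other.\<close>
    also have "cnj \<mu> = \<mu>" using m2 by (simp add: complex_eq_iff \<mu>_def)
    finally have m3: "(\<integral>y. cx y * cnj (G y) \<partial>lborel) = \<mu>" .
    have "(\<integral>y. cnj (cx y) * cnj (G y) \<partial>lborel) = cnj (\<integral>y. cx y * G y \<partial>lborel)" by (rule trans[OF _ Bochner_Integration.integral_cnj]) simp
    hence m4: "(\<integral>y. cnj (cx y) * cnj (G y) \<partial>lborel) = 0" using m1 by simp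
    have X: "norm (conv ker_inv G x) \<le> C3 * c * norm x powr (- (2 + e))" if "x \<noteq> 0" for x
      using C3 m G G0 that unfolding S_def by (force simp: m1)
    have nz: "norm (velo_z G x) \<le> 2 * norm (conv ker_inv G x)" for x
    proof -
      have "norm (velo_z G x) = 1 / (8 * pi) * norm (conv ker_inv G x - cnj (conv ker_inv G x))"
        unfolding velo_z_def conv_cinv_cnj norm_mult by (simp add: norm_divide)
      also have "\<dots> \<le> 1 * (norm (conv ker_inv G x) + norm (conv ker_inv G x))"
        using le_pi norm_triangle_ineq4[of "conv ker_inv G x" "cnj (conv ker_inv G x)"]
        by (intro mult_mono) auto
      finally show ?thesis by simp
    qed
    have vz: "decays (2 + e) (2 powr (2 + e) * (A * c)) (velo_z G)"
    proof (rule decay_combine)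
      fix x
      have "norm (velo_z G x) \<le> (2 * B1) * c" using nz[of x] B1(2)[OF m G, of x] by simp
      also have "\<dots> \<le> A * c" unfolding A_def using nn B1 B2 B3 c by (intro mult_right_mono) auto
      finally show "norm (velo_z G x) \<le> A * c" .
      assume "x \<noteq> 0"
      hence "norm (velo_z G x) \<le> (2 * C3) * (c * norm x powr (- (2 + e)))" using nz[of x] X[of x] by simp
      also have "\<dots> \<le> A * (c * norm x powr (- (2 + e)))"
        unfolding A_def using nn B1 B2 B3 c by (intro mult_right_mono) auto
      finally show "norm (velo_z G x) \<le> A * c * norm x powr (- (2 + e))" by (simp add: mult.assoc)
    qed (use e in auto)
    have nb: "norm (velo_b G x) \<le> norm (conv ker_cinv G x + conv ker_strain (\<lambda>y. cnj (G y)) x)" for x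
    proof -
      have "norm (velo_b G x) = 1 / (8 * pi) * norm (conv ker_cinv G x + conv ker_strain (\<lambda>y. cnj (G y)) x)"
        unfolding velo_b_def norm_mult by (simp add: norm_divide)
      also have "\<dots> \<le> 1 * norm (conv ker_cinv G x + conv ker_strain (\<lambda>y. cnj (G y)) x)"
        using le_pi by (intro mult_right_mono) auto
      finally show ?thesis by simp
    qed
    have vb: "decays (2 + e) (2 powr (2 + e) * (A * c)) (velo_b G)"
    proof (rule decay_combine)
      fix x
      have "norm (velo_b G x) \<le> norm (conv ker_cinv G x) + norm (conv ker_strain (\<lambda>y. cnj (G y)) x)"
        using nb[of x] norm_triangle_ineq order_trans by blast
      also have "\<dots> \<le> (B2 + B3) * c" using B2(2)[OF m G, of x] B3(2)[OF m' G', of x] by (simp add: distrib_right)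
      also have "\<dots> \<le> A * c" unfolding A_def using nn B1 B2 B3 c by (intro mult_right_mono) auto
      finally show "norm (velo_b G x) \<le> A * c" .
      assume x: "x \<noteq> 0"
      have 1: "norm (conv ker_cinv G x + - 1 / (cnj (cx x))\<^sup>2 * \<mu>) \<le> C4 * c * norm x powr (- (2 + e))"
        using C4 m G G0 x unfolding S_def \<mu>_def by force
      have 2: "norm (conv ker_strain (\<lambda>y. cnj (G y)) x + 1 / (cnj (cx x))\<^sup>2 * \<mu>) \<le> C5 * c * norm x powr (- (2 + e))"
        using C5 m' G' G0' x unfolding S_def by (force simp: m3 m4)
      \<comment> \<open>The leading terms are \<mu> / (cnj z)^2 for the first convolution and its
        negative for the second.\<close>
      have "conv ker_cinv G x + conv ker_strain (\<lambda>y. cnj (G y)) x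
        = (conv ker_cinv G x + - 1 / (cnj (cx x))\<^sup>2 * \<mu>) + (conv ker_strain (\<lambda>y. cnj (G y)) x + 1 / (cnj (cx x))\<^sup>2 * \<mu>)"
        by simp
      hence "norm (conv ker_cinv G x + conv ker_strain (\<lambda>y. cnj (G y)) x) \<le> (C4 + C5) * (c * norm x powr (- (2 + e)))"
        using norm_triangle_mono[OF 1 2] by (simp add: distrib_right mult.assoc)
      also have "\<dots> \<le> A * (c * norm x powr (- (2 + e)))"
        unfolding A_def using nn B1 B2 B3 c by (intro mult_right_mono) auto
      finally show "norm (velo_b G x) \<le> A * c * norm x powr (- (2 + e))" using nb[of x] by (simp add: mult.assoc)
    qed (use e in auto)
    have far: "norm (velo G x) \<le> A * c * norm x powr (- (1 + e))" if x: "x \<noteq> 0" for x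
    proof -
      have 1: "norm (conv ker_log G x + 1 / 2 * ker_cinv (cx x) * \<mu>) \<le> C1 * c * norm x powr (- (1 + e))"
        using C1 m G G0 x unfolding S_def \<mu>_def by (force simp: m1)
      have 2: "norm (conv ker_phase (\<lambda>y. cnj (G y)) x + ker_cinv (cx x) * \<mu>) \<le> C2 * c * norm x powr (- (1 + e))"
        using C2 m' G' G0' x unfolding S_def by (force simp: m3 m4)
      \<comment> \<open>The factor 1/2 in front of the phase is exactly what makes the two terms
        with \<mu> cancel.\<close>
      have "velo G x = 1 / (4 * of_real pi) * ((conv ker_log G x + 1 / 2 * ker_cinv (cx x) * \<mu>)
         - 1 / 2 * (conv ker_phase (\<lambda>y. cnj (G y)) x + ker_cinv (cx x) * \<mu>))"
        unfolding velo_def by (simp add: algebra_simps)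
      hence "norm (velo G x) = 1 / (4 * pi) * norm ((conv ker_log G x + 1 / 2 * ker_cinv (cx x) * \<mu>)
         - 1 / 2 * (conv ker_phase (\<lambda>y. cnj (G y)) x + ker_cinv (cx x) * \<mu>))"
        by (simp add: norm_mult norm_divide)
      also have "\<dots> \<le> 1 * (norm (conv ker_log G x + 1 / 2 * ker_cinv (cx x) * \<mu>)
         + norm (1 / 2 * (conv ker_phase (\<lambda>y. cnj (G y)) x + ker_cinv (cx x) * \<mu>)))"
        using le_pi by (intro mult_mono norm_triangle_ineq4) auto
      also have "norm (1 / 2 * (conv ker_phase (\<lambda>y. cnj (G y)) x + ker_cinv (cx x) * \<mu>))
         \<le> norm (conv ker_phase (\<lambda>y. cnj (G y)) x + ker_cinv (cx x) * \<mu>)"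
        unfolding norm_mult by simp
      finally have "norm (velo G x) \<le> (C1 + C2) * (c * norm x powr (- (1 + e)))"
        using 1 2 by (simp add: distrib_right mult.assoc)
      also have "\<dots> \<le> A * (c * norm x powr (- (1 + e)))"
        unfolding A_def using nn B1 B2 B3 c by (intro mult_right_mono) auto
      finally show ?thesis by (simp add: mult.assoc)
    qed
    have v: "decays (1 + e) (2 powr (1 + e) * (5 * A * c)) (velo G)"
    proof (rule decay_combine)
      show "norm (velo G x) \<le> 5 * A * c * norm x powr (- (1 + e))" if "x \<noteq> 0" for x
      proof -
        have "A * (c * norm x powr (- (1 + e))) \<le> (5 * A) * (c * norm x powr (- (1 + e)))"
          using A0 c by (intro mult_right_mono) auto
        thus ?thesis using far[OF that] by (simp add: mult.assoc)
      qed
      fix x :: "real^2" assume x: "norm x \<le> 1"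
      \<comment> \<open>\<open>conv_bounded\<close> does not cover the logarithm and the phase. The
        value at a unit vector, bounded by the far estimate, is therefore carried to x by the
        gradient bound 2 A c over a distance of at most 2; this gives 5 = 4 + 1.\<close>
      let ?y = "axis 1 1 :: real^2"
      have "norm (velo G x - velo G ?y) \<le> (2 * (A * c)) * norm (x - ?y)"
      proof (rule differentiable_bound[OF convex_UNIV, where f' = "\<lambda>x h. velo_z G x * cx h + velo_b G x * cnj (cx h)"])
        show "(velo G has_derivative (\<lambda>h. velo_z G x * cx h + velo_b G x * cnj (cx h))) (at x within UNIV)" for x
          by (rule velo_has_derivative[OF m G q(2)])
        show "onorm (\<lambda>h. velo_z G x * cx h + velo_b G x * cnj (cx h)) \<le> 2 * (A * c)" for x
        proof (rule onorm_bound)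
          fix h
          have z: "norm (velo_z G x) \<le> A * c" "norm (velo_b G x) \<le> A * c"
          proof -
            have "norm (velo_z G x) \<le> (2 * B1) * c" using nz[of x] B1(2)[OF m G, of x] by simp
            also have "\<dots> \<le> A * c" unfolding A_def using nn B1 B2 B3 c by (intro mult_right_mono) auto
            finally show "norm (velo_z G x) \<le> A * c" .
            have "norm (velo_b G x) \<le> norm (conv ker_cinv G x) + norm (conv ker_strain (\<lambda>y. cnj (G y)) x)"
              using nb[of x] norm_triangle_ineq order_trans by blast
            also have "\<dots> \<le> (B2 + B3) * c" using B2(2)[OF m G, of x] B3(2)[OF m' G', of x] by (simp add: distrib_right)
            also have "\<dots> \<le> A * c" unfolding A_def using nn B1 B2 B3 c by (intro mult_right_mono) auto
            finally show "norm (velo_b G x) \<le> A * c" .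
          qed
          have "norm (velo_z G x * cx h + velo_b G x * cnj (cx h)) \<le> norm (velo_z G x) * norm h + norm (velo_b G x) * norm h"
            by (rule order_trans[OF norm_triangle_ineq]) (simp add: norm_mult)
          also have "\<dots> \<le> (A * c) * norm h + (A * c) * norm h"
            by (intro add_mono mult_right_mono z) auto
          finally show "norm (velo_z G x * cx h + velo_b G x * cnj (cx h)) \<le> 2 * (A * c) * norm h" by simp
        qed (use A0 c in auto)
      qed auto
      also have "norm (x - ?y) \<le> 2" using norm_triangle_ineq4[of x ?y] x by simp
      hence "(2 * (A * c)) * norm (x - ?y) \<le> (2 * (A * c)) * 2" using A0 c by (intro mult_left_mono) auto
      finally have "norm (velo G x - velo G ?y) \<le> 4 * (A * c)" by simp
      moreover have "norm (velo G ?y) \<le> A * c" using far[of ?y] by (simp add: axis_eq_0_iff)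
      moreover have "norm (velo G x) \<le> norm (velo G x - velo G ?y) + norm (velo G ?y)"
        using norm_triangle_ineq[of "velo G x - velo G ?y" "velo G ?y"] by simp
      ultimately show "norm (velo G x) \<le> 5 * A * c" by linarith
    qed (use e in auto)
    show ?thesis using v vz vb by blast
  qed
  define C where "C = 2 powr (1 + e) * (5 * A) + 2 powr (2 + e) * A + 1"
  have C: "C > 0" "2 powr (1 + e) * (5 * A) \<le> C" "2 powr (2 + e) * A \<le> C"
    using A0 by (auto simp: C_def intro!: add_nonneg_pos)
  show ?thesis
  proof (rule that[OF C(1)])
    fix G c assume adm: "admissible e c G"
    hence c: "c \<ge> 0" by (auto simp: admissible_def dest: decays_nonneg)
    have "2 powr (1 + e) * (5 * A * c) \<le> C * c" "2 powr (2 + e) * (A * c) \<le> C * c"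
      using mult_right_mono[OF C(2) c] mult_right_mono[OF C(3) c] by (simp_all add: mult_ac)
    thus "decays (1 + e) (C * c) (velo G) \<and> decays (2 + e) (C * c) (velo_z G) \<and> decays (2 + e) (C * c) (velo_b G)"
      using main[OF adm] decays_mono by blast
  qed
qed

section \<open>Advection, the vortex and the Gaussian corrector\<close>

text \<open>Both real partial derivatives integrate to 0, and the two coordinate directions
  determine the Wirtinger coefficients.\<close>

lemma wirtinger_integral_zero:
  assumes U: "\<And>x. (U has_derivative (\<lambda>h. a x * cx h + b x * cnj (cx h))) (at x)"
    and ac: "continuous_on UNIV a" and bc: "continuous_on UNIV b" and e: "e > 0"
    and dU: "decays (1 + e) B U" and da: "decays (2 + e) B a" and db: "decays (2 + e) B b"
  shows "(\<integral>x. a x \<partial>lborel) = 0" "(\<integral>x. b x \<partial>lborel) = 0"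
proof -
  have B: "B \<ge> 0" by (rule decays_nonneg[OF dU])
  have m[measurable]: "a \<in> borel_measurable borel" "b \<in> borel_measurable borel"
    by (intro borel_measurable_continuous_onI ac bc)+
  have ia: "integrable lborel a" and ib: "integrable lborel b"
    by (rule integrable_of_dec[of _ "2 + e" B]; use e decaysD[OF da] decaysD[OF db] in simp)+
  have z: "(\<integral>x. a x * cx v + b x * cnj (cx v) \<partial>lborel) = 0" if v: "norm v = 1" for v
  proof (rule integral_directional_derivative_zero[OF U _ v e])
    show "(\<lambda>x. a x * cx v + b x * cnj (cx v)) \<in> borel_measurable borel" by measurable
    show "norm (U x) \<le> 2 * B * dec (1 + e) x" for x
      using decaysD[OF dU, of x] mult_nonneg_nonneg[OF B, of "dec (1 + e) x"] by simp
    show "norm (a x * cx v + b x * cnj (cx v)) \<le> 2 * B * dec (2 + e) x" for x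
      using decaysD[OF da, of x] decaysD[OF db, of x] v
      by (intro order_trans[OF norm_triangle_ineq]) (simp add: norm_mult)
  qed
  have "(\<integral>x. a x * cx v + b x * cnj (cx v) \<partial>lborel) = (\<integral>x. a x \<partial>lborel) * cx v + (\<integral>x. b x \<partial>lborel) * cnj (cx v)" for v
    using ia ib by simp
  hence "(\<integral>x. a x \<partial>lborel) * cx v + (\<integral>x. b x \<partial>lborel) * cnj (cx v) = 0" if "norm v = 1" for v
    using z[OF that] by simp
  from this[of "axis 1 1"] this[of "axis 2 1"]
  have 1: "(\<integral>x. a x \<partial>lborel) + (\<integral>x. b x \<partial>lborel) = 0"
    and 2: "(\<integral>x. a x \<partial>lborel) * \<i> - (\<integral>x. b x \<partial>lborel) * \<i> = 0" by auto
  have "((\<integral>x. a x \<partial>lborel) - (\<integral>x. b x \<partial>lborel)) * \<i> = 0" using 2 by (simp add: left_diff_distrib)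
  hence 3: "(\<integral>x. a x \<partial>lborel) = (\<integral>x. b x \<partial>lborel)" by simp
  show "(\<integral>x. a x \<partial>lborel) = 0" using 1 unfolding 3[symmetric] by (simp flip: mult_2)
  thus "(\<integral>x. b x \<partial>lborel) = 0" using 3 by simp
qed

text \<open>The planar vector field \<open>U\<close> is divergence free when \<open>Re a = 0\<close>.\<close>

definition field_deriv :: "(real^2 \<Rightarrow> complex) \<Rightarrow> (real^2 \<Rightarrow> complex) \<Rightarrow> (real^2 \<Rightarrow> complex) \<Rightarrow> bool" where
  "field_deriv U a b \<longleftrightarrow> (\<forall>x. (U has_derivative (\<lambda>h. a x * cx h + b x * cnj (cx h))) (at x)) \<and>
     continuous_on UNIV a \<and> continuous_on UNIV b"

text \<open>This is W . grad U, for the field U with Wirtinger derivatives a and b.\<close>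

definition advect :: "(real^2 \<Rightarrow> complex) \<Rightarrow> (real^2 \<Rightarrow> complex) \<Rightarrow> (real^2 \<Rightarrow> complex) \<Rightarrow> real^2 \<Rightarrow> complex" where
  "advect a b W x = a x * W x + b x * cnj (W x)"

lemma field_deriv_continuous: "field_deriv U a b \<Longrightarrow> continuous_on UNIV U"
  unfolding field_deriv_def by (auto intro: wirtinger_continuous)

lemma decays_mult:
  assumes "decays p A f" "decays q B g"
  shows "decays (p + q) (A * B) (\<lambda>x. f x * g x)"
  unfolding decays_def
proof
  fix x
  have "norm (f x * g x) \<le> (A * dec p x) * (B * dec q x)"
    unfolding norm_mult by (rule mult_mono) (use assms decays_nonneg[OF assms(1)] in \<open>auto simp: decays_def\<close>)
  also have "\<dots> = A * B * (dec p x * dec q x)" by simp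
  finally show "norm (f x * g x) \<le> A * B * dec (p + q) x" unfolding dec_mult .
qed

lemma decays_add:
  assumes "decays q A f" "decays q B g"
  shows "decays q (A + B) (\<lambda>x. f x + g x)"
  unfolding decays_def
  by (intro allI order_trans[OF norm_triangle_ineq]) (use decaysD[OF assms(1)] decaysD[OF assms(2)] in \<open>simp add: distrib_right add_mono\<close>)

lemma decays_cmult:
  assumes "decays q A f"
  shows "decays q (norm c * A) (\<lambda>x. c * f x)"
  using assms unfolding decays_def by (simp add: norm_mult mult.assoc mult_left_mono)

lemma decays_weaken:
  assumes "decays q A f" "p \<le> q" "A \<le> B"
  shows "decays p B f"
  unfolding decays_def
proof
  fix x
  have "norm (f x) \<le> A * dec q x" by (rule decaysD[OF assms(1)])
  also have "\<dots> \<le> B * dec p x" using assms decays_nonneg[OF assms(1)] by (intro mult_mono dec_mono) auto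
  finally show "norm (f x) \<le> B * dec p x" .
qed

lemma decays_add_weaken:
  assumes "decays p A f" "decays q B g" "r \<le> p" "r \<le> q" "A + B \<le> C"
  shows "decays r C (\<lambda>x. f x + g x)"
  by (rule decays_weaken[OF decays_add[OF decays_weaken[OF assms(1,3) order_refl] decays_weaken[OF assms(2,4) order_refl]] order_refl assms(5)])

lemma decays_cx: "decays (- 1) 1 cx" "decays (- 1) 1 (\<lambda>x. cnj (cx x))"
  by (auto simp: decays_def dec_def)

lemma decays_uminus_1_mult:
  assumes "decays q A f"
  shows "decays (q - 1) A (\<lambda>x. cx x * f x)" "decays (q - 1) A (\<lambda>x. cnj (cx x) * f x)"
  using decays_mult[OF decays_cx(1) assms] decays_mult[OF decays_cx(2) assms] by simp_all

lemma div_form_integral_zero: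
  assumes U: "field_deriv U a b" and W: "field_deriv W c d" and div: "\<And>x. Re (c x) = 0" and e: "e > 0"
    and dU: "decays p A U" "decays (p + 1) A a" "decays (p + 1) A b"
    and dW: "decays r B W" "decays (r + 1) B c" "decays (r + 1) B d" and pr: "p + r = 1 + e"
  shows "(\<integral>x. advect a b W x \<partial>lborel) = 0"
proof -
  have B: "A * B \<ge> 0" using decays_nonneg[OF dU(1)] decays_nonneg[OF dW(1)] by simp
  note Ud = U[unfolded field_deriv_def, THEN conjunct1, rule_format]
  note Wd = W[unfolded field_deriv_def, THEN conjunct1, rule_format]
  have cont: "continuous_on UNIV U" "continuous_on UNIV W" "continuous_on UNIV a" "continuous_on UNIV b"
    "continuous_on UNIV c" "continuous_on UNIV d"
    using field_deriv_continuous[OF U] field_deriv_continuous[OF W] U W unfolding field_deriv_def by blast+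
  text \<open>As \<open>div W = 0\<close>, the field \<open>advect a b W\<close> is the \<open>z\<close>-derivative of \<open>U W\<close> plus the
    conjugate derivative of \<open>U cnj W\<close>.\<close>
  have 1: "(\<integral>x. a x * W x + U x * c x \<partial>lborel) = 0"
  proof (rule wirtinger_integral_zero(1)[where e = e and B = "2 * (A * B)"])
    show "((\<lambda>x. U x * W x) has_derivative
       (\<lambda>h. (a x * W x + U x * c x) * cx h + (b x * W x + U x * d x) * cnj (cx h))) (at x)" for x
      by (rule has_derivative_eq_rhs[OF has_derivative_mult[OF Ud Wd]]) (simp add: algebra_simps)
    show "decays (1 + e) (2 * (A * B)) (\<lambda>x. U x * W x)"
      by (rule decays_weaken[OF decays_mult[OF dU(1) dW(1)]]) (use pr B in auto)
    show "decays (2 + e) (2 * (A * B)) (\<lambda>x. a x * W x + U x * c x)"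
      by (rule decays_add_weaken[OF decays_mult[OF dU(2) dW(1)] decays_mult[OF dU(1) dW(2)]])
         (use pr B in auto)
    show "decays (2 + e) (2 * (A * B)) (\<lambda>x. b x * W x + U x * d x)"
      by (rule decays_add_weaken[OF decays_mult[OF dU(3) dW(1)] decays_mult[OF dU(1) dW(3)]])
         (use pr B in auto)
  qed (intro continuous_intros cont e)+
  have 2: "(\<integral>x. b x * cnj (W x) + U x * cnj (c x) \<partial>lborel) = 0"
  proof (rule wirtinger_integral_zero(2)[where e = e and B = "2 * (A * B)"])
    have Wc: "((\<lambda>x. cnj (W x)) has_derivative (\<lambda>h. cnj (c x * cx h + d x * cnj (cx h)))) (at x)" for x
      by (rule bounded_linear.has_derivative[OF bounded_linear_cnj Wd])
    show "((\<lambda>x. U x * cnj (W x)) has_derivative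
       (\<lambda>h. (a x * cnj (W x) + U x * cnj (d x)) * cx h + (b x * cnj (W x) + U x * cnj (c x)) * cnj (cx h))) (at x)" for x
      by (rule has_derivative_eq_rhs[OF has_derivative_mult[OF Ud Wc]]) (simp add: algebra_simps)
    show "decays (1 + e) (2 * (A * B)) (\<lambda>x. U x * cnj (W x))"
      by (rule decays_weaken[OF decays_mult[OF dU(1) decays_cnj[OF dW(1)]]]) (use pr B in auto)
    show "decays (2 + e) (2 * (A * B)) (\<lambda>x. b x * cnj (W x) + U x * cnj (c x))"
      by (rule decays_add_weaken[OF decays_mult[OF dU(3) decays_cnj[OF dW(1)]] decays_mult[OF dU(1) decays_cnj[OF dW(2)]]])
         (use pr B in auto)
    show "decays (2 + e) (2 * (A * B)) (\<lambda>x. a x * cnj (W x) + U x * cnj (d x))"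
      by (rule decays_add_weaken[OF decays_mult[OF dU(2) decays_cnj[OF dW(1)]] decays_mult[OF dU(1) decays_cnj[OF dW(3)]]])
         (use pr B in auto)
  qed (intro continuous_intros cont e)+
  have int: "integrable lborel f" if "continuous_on UNIV f" "decays (2 + e) (2 * (A * B)) f" for f
    by (rule integrable_of_dec[of _ "2 + e" "2 * (A * B)"]) (use that e in \<open>auto simp: decays_def intro: borel_measurable_continuous_onI\<close>)
  have i1: "integrable lborel (\<lambda>x. a x * W x + U x * c x)"
    by (rule int, intro continuous_intros cont,
        rule decays_add_weaken[OF decays_mult[OF dU(2) dW(1)] decays_mult[OF dU(1) dW(2)]])
         (use pr B in auto)
  have i2: "integrable lborel (\<lambda>x. b x * cnj (W x) + U x * cnj (c x))"
    by (rule int, intro continuous_intros cont,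
        rule decays_add_weaken[OF decays_mult[OF dU(3) decays_cnj[OF dW(1)]] decays_mult[OF dU(1) decays_cnj[OF dW(2)]]])
         (use pr B in auto)
  have "advect a b W x = (a x * W x + U x * c x) + (b x * cnj (W x) + U x * cnj (c x))" for x
  proof -
    have "c x + cnj (c x) = 0" using div[of x] by (simp add: complex_add_cnj)
    hence "U x * (c x + cnj (c x)) = 0" by simp
    hence "U x * c x + U x * cnj (c x) = 0" by (simp only: distrib_left)
    thus ?thesis unfolding advect_def by (simp add: algebra_simps)
  qed
  thus ?thesis using i1 i2 1 2 by simp
qed

text \<open>The polarised advection term. Its symmetry in the two fields is what makes the
  underlying tensor symmetric and hence the torque zero; a single \<open>advect\<close> term need
  not have this property.\<close>

definition interact :: "(real^2 \<Rightarrow> complex) \<Rightarrow> (real^2 \<Rightarrow> complex) \<Rightarrow> (real^2 \<Rightarrow> complex) \<Rightarrow>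
    (real^2 \<Rightarrow> complex) \<Rightarrow> (real^2 \<Rightarrow> complex) \<Rightarrow> (real^2 \<Rightarrow> complex) \<Rightarrow> real^2 \<Rightarrow> complex" where
  "interact U a b W c d x = advect a b W x + advect c d U x"

lemma advect_decays:
  assumes "decays p A a" "decays p A b" "decays r B W"
  shows "decays (p + r) (2 * (A * B)) (advect a b W)"
  unfolding advect_def[abs_def]
  using decays_add[OF decays_mult[OF assms(1,3)] decays_mult[OF assms(2) decays_cnj[OF assms(3)]]] by simp

lemma advect_continuous:
  "continuous_on UNIV a \<Longrightarrow> continuous_on UNIV b \<Longrightarrow> continuous_on UNIV W \<Longrightarrow> continuous_on UNIV (advect a b W)"
  unfolding advect_def[abs_def] by (intro continuous_intros)

text \<open>The divergence identity is applied to cnj z U in place of U. Differentiating cnj z along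
  W produces the extra term U cnj W, and the factor cnj z lowers the exponent p by one.\<close>

lemma weighted_advect_integral:
  assumes U: "field_deriv U a b" and W: "field_deriv W c d" and div: "\<And>x. Re (c x) = 0" and e: "e > 0"
    and dU: "decays p A U" "decays (p + 1) A a" "decays (p + 1) A b"
    and dW: "decays r B W" "decays (r + 1) B c" "decays (r + 1) B d" and pr: "p + r = 2 + e"
  shows "(\<integral>x. cnj (cx x) * advect a b W x + U x * cnj (W x) \<partial>lborel) = 0"
proof -
  have A: "A \<ge> 0" and B: "B \<ge> 0" using decays_nonneg[OF dU(1)] decays_nonneg[OF dW(1)] by auto
  note Ud = U[unfolded field_deriv_def, THEN conjunct1, rule_format]
  have cont: "continuous_on UNIV U" "continuous_on UNIV a" "continuous_on UNIV b"
    using field_deriv_continuous[OF U] U unfolding field_deriv_def by blast+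
  have zd: "((\<lambda>x. cnj (cx x)) has_derivative (\<lambda>h. cnj (cx h))) (at x)" for x
    by (intro bounded_linear.has_derivative[OF bounded_linear_cnj] bounded_linear.has_derivative[OF bounded_linear_cx] has_derivative_ident)
  have "(\<integral>x. advect (\<lambda>x. cnj (cx x) * a x) (\<lambda>x. cnj (cx x) * b x + U x) W x \<partial>lborel) = 0"
  proof (rule div_form_integral_zero[OF _ W div e _ _ _ dW])
    show "field_deriv (\<lambda>x. cnj (cx x) * U x) (\<lambda>x. cnj (cx x) * a x) (\<lambda>x. cnj (cx x) * b x + U x)"
      unfolding field_deriv_def
    proof (intro conjI allI)
      show "((\<lambda>x. cnj (cx x) * U x) has_derivative
         (\<lambda>h. cnj (cx x) * a x * cx h + (cnj (cx x) * b x + U x) * cnj (cx h))) (at x)" for x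
        by (rule has_derivative_eq_rhs[OF has_derivative_mult[OF zd Ud]]) (simp add: algebra_simps)
    qed (intro continuous_intros cont)+
    show "decays (p - 1) (2 * A) (\<lambda>x. cnj (cx x) * U x)"
      by (rule decays_weaken[OF decays_uminus_1_mult(2)[OF dU(1)]]) (use A in auto)
    show "decays (p - 1 + 1) (2 * A) (\<lambda>x. cnj (cx x) * a x)"
      by (rule decays_weaken[OF decays_uminus_1_mult(2)[OF dU(2)]]) (use A in auto)
    show "decays (p - 1 + 1) (2 * A) (\<lambda>x. cnj (cx x) * b x + U x)"
      by (rule decays_add_weaken[OF decays_uminus_1_mult(2)[OF dU(3)] dU(1)]) (use A in auto)
    show "p - 1 + r = 1 + e" using pr by simp
  qed
  thus ?thesis unfolding advect_def by (simp add: algebra_simps)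
qed

lemma interact_moments:
  assumes U: "field_deriv U a b" and W: "field_deriv W c d" and div: "\<And>x. Re (a x) = 0" "\<And>x. Re (c x) = 0" and e: "e > 0"
    and dU: "decays p A U" "decays (p + 1) A a" "decays (p + 1) A b"
    and dW: "decays r B W" "decays (r + 1) B c" "decays (r + 1) B d" and pr: "p + r = 2 + e"
  shows "(\<integral>x. interact U a b W c d x \<partial>lborel) = 0"
    and "Im (\<integral>x. cnj (cx x) * interact U a b W c d x \<partial>lborel) = 0"
    and "decays (3 + e) (4 * (A * B)) (interact U a b W c d)"
    and "continuous_on UNIV (interact U a b W c d)"
proof -
  have cont: "continuous_on UNIV U" "continuous_on UNIV W" "continuous_on UNIV a" "continuous_on UNIV b"
    "continuous_on UNIV c" "continuous_on UNIV d"
    using field_deriv_continuous[OF U] field_deriv_continuous[OF W] U W unfolding field_deriv_def by blast+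
  have dec1: "decays (3 + e) (2 * (A * B)) (advect a b W)"
    by (rule decays_weaken[OF advect_decays[OF dU(2,3) dW(1)]]) (use pr in auto)
  have dec2: "decays (3 + e) (2 * (A * B)) (advect c d U)"
    by (rule decays_weaken[OF advect_decays[OF dW(2,3) dU(1)]]) (use pr in \<open>auto simp: mult.commute\<close>)
  show "decays (3 + e) (4 * (A * B)) (interact U a b W c d)"
    unfolding interact_def[abs_def] using decays_add[OF dec1 dec2] by simp
  show "continuous_on UNIV (interact U a b W c d)"
    unfolding interact_def[abs_def] by (intro continuous_intros advect_continuous cont)
  have cA: "continuous_on UNIV (advect a b W)" "continuous_on UNIV (advect c d U)"
    by (intro advect_continuous cont)+
  have int: "integrable lborel f" if "continuous_on UNIV f" "decays q C f" "q > 2" for f q C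
    by (rule integrable_of_dec[of _ q C]) (use that in \<open>auto simp: decays_def intro: borel_measurable_continuous_onI\<close>)
  have i: "integrable lborel (advect a b W)" "integrable lborel (advect c d U)"
    using int[OF cA(1) dec1] int[OF cA(2) dec2] e by auto
  \<comment> \<open>For the total force there is one power to spare: p + r = 1 + (1 + e), so 1 + e
    takes the place of e.\<close>
  have 1: "(\<integral>x. advect a b W x \<partial>lborel) = 0"
    by (rule div_form_integral_zero[OF U W div(2), of "1 + e" p A r B]) (use e pr dU dW in auto)
  have 2: "(\<integral>x. advect c d U x \<partial>lborel) = 0"
    by (rule div_form_integral_zero[OF W U div(1), of "1 + e" r B p A]) (use e pr dU dW in auto)
  show "(\<integral>x. interact U a b W c d x \<partial>lborel) = 0"
    unfolding interact_def using i 1 2 by simp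
  have iz: "integrable lborel (\<lambda>x. cnj (cx x) * advect a b W x)" "integrable lborel (\<lambda>x. cnj (cx x) * advect c d U x)"
    by (rule int[OF _ decays_uminus_1_mult(2)[OF dec1]], intro continuous_intros cA, use e in simp)
       (rule int[OF _ decays_uminus_1_mult(2)[OF dec2]], intro continuous_intros cA, use e in simp)
  have iu: "integrable lborel (\<lambda>x. U x * cnj (W x))" "integrable lborel (\<lambda>x. W x * cnj (U x))"
    by (rule int[OF _ decays_mult[OF dU(1) decays_cnj[OF dW(1)]]], intro continuous_intros cont, use pr e in simp)
       (rule int[OF _ decays_mult[OF dW(1) decays_cnj[OF dU(1)]]], intro continuous_intros cont, use pr e in simp)
  have w1: "(\<integral>x. cnj (cx x) * advect a b W x \<partial>lborel) + (\<integral>x. U x * cnj (W x) \<partial>lborel) = 0"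
    using weighted_advect_integral[OF U W div(2) e dU dW pr] iz iu by simp
  have w2: "(\<integral>x. cnj (cx x) * advect c d U x \<partial>lborel) + (\<integral>x. W x * cnj (U x) \<partial>lborel) = 0"
    using weighted_advect_integral[OF W U div(1) e dW dU] pr iz iu by (simp add: add.commute)
  \<comment> \<open>The sum U cnj W + W cnj U is real. This is the symmetry of the stress tensor,
    and it removes the imaginary part.\<close>
  have "(\<integral>x. W x * cnj (U x) \<partial>lborel) = cnj (\<integral>x. U x * cnj (W x) \<partial>lborel)"
    by (rule trans[OF _ Bochner_Integration.integral_cnj]) (simp add: mult.commute)
  hence "Im (\<integral>x. U x * cnj (W x) \<partial>lborel) + Im (\<integral>x. W x * cnj (U x) \<partial>lborel) = 0" by simp
  moreover have "Im (\<integral>x. cnj (cx x) * advect a b W x \<partial>lborel) + Im (\<integral>x. U x * cnj (W x) \<partial>lborel) = 0"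
    using arg_cong[OF w1, of Im] by simp
  moreover have "Im (\<integral>x. cnj (cx x) * advect c d U x \<partial>lborel) + Im (\<integral>x. W x * cnj (U x) \<partial>lborel) = 0"
    using arg_cong[OF w2, of Im] by simp
  moreover have "(\<integral>x. cnj (cx x) * interact U a b W c d x \<partial>lborel)
     = (\<integral>x. cnj (cx x) * advect a b W x \<partial>lborel) + (\<integral>x. cnj (cx x) * advect c d U x \<partial>lborel)"
    unfolding interact_def distrib_left using iz by simp
  ultimately show "Im (\<integral>x. cnj (cx x) * interact U a b W c d x \<partial>lborel) = 0" by simp
qed

lemma velo_field_deriv:
  assumes "G \<in> borel_measurable borel" "decays q c G" "q > 3"
  shows "field_deriv (velo G) (velo_z G) (velo_b G)"
  using velo_has_derivative[OF assms] velo_deriv_continuous[OF assms] by (simp add: field_deriv_def)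

section \<open>The regularised point vortex\<close>

definition rho :: "real^2 \<Rightarrow> complex" where "rho x = 1 + cx x * cnj (cx x)"

definition vortex :: "real^2 \<Rightarrow> complex" where "vortex x = \<i> * cx x / rho x"
definition vortex_z :: "real^2 \<Rightarrow> complex" where "vortex_z x = \<i> / (rho x)\<^sup>2"
definition vortex_b :: "real^2 \<Rightarrow> complex" where "vortex_b x = - \<i> * (cx x)\<^sup>2 / (rho x)\<^sup>2"

lemma rho_real: "rho x = of_real (1 + (norm x)\<^sup>2)"
  by (simp add: rho_def flip: complex_norm_square)

lemma rho_ge: "1 + (norm x)\<^sup>2 \<ge> 1" "1 + (norm x)\<^sup>2 > 0"
  using zero_le_power2[of "norm x"] by linarith+

lemma rho_nonzero[simp]: "rho x \<noteq> 0"
  unfolding rho_real of_real_eq_0_iff using rho_ge(1)[of x] by linarith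

lemma norm_rho: "norm (rho x) = 1 + (norm x)\<^sup>2"
  unfolding rho_real norm_of_real using rho_ge(2)[of x] by linarith

lemma cnj_rho[simp]: "cnj (rho x) = rho x"
  by (simp add: rho_real)

lemma rho_has_derivative: "(rho has_derivative (\<lambda>h. cnj (cx x) * cx h + cx x * cnj (cx h))) (at x)"
proof -
  have z: "(cx has_derivative cx) (at x)"
    using bounded_linear.has_derivative[OF bounded_linear_cx has_derivative_ident] .
  have zc: "((\<lambda>x. cnj (cx x)) has_derivative (\<lambda>h. cnj (cx h))) (at x)"
    by (rule bounded_linear.has_derivative[OF bounded_linear_cnj z])
  show ?thesis unfolding rho_def[abs_def]
    by (rule has_derivative_eq_rhs[OF has_derivative_add[OF has_derivative_const has_derivative_mult[OF z zc]]])
       (simp add: algebra_simps)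
qed

lemma rho_continuous: "continuous_on UNIV rho"
  unfolding rho_def[abs_def] by (intro continuous_intros)

lemma vortex_field_deriv: "field_deriv vortex vortex_z vortex_b"
  unfolding field_deriv_def
proof (intro conjI allI)
  fix x
  have z: "((\<lambda>x. \<i> * cx x) has_derivative (\<lambda>h. \<i> * cx h)) (at x)"
    by (intro has_derivative_mult_right bounded_linear.has_derivative[OF bounded_linear_cx has_derivative_ident])
  show "(vortex has_derivative (\<lambda>h. vortex_z x * cx h + vortex_b x * cnj (cx h))) (at x)"
    unfolding vortex_def[abs_def]
  proof (rule has_derivative_eq_rhs[OF has_derivative_divide'[OF z rho_has_derivative rho_nonzero]], rule ext)
    fix h
    have "\<i> * cx h * rho x - \<i> * cx x * (cnj (cx x) * cx h + cx x * cnj (cx h)) = \<i> * cx h - \<i> * (cx x)\<^sup>2 * cnj (cx h)"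
      by (simp add: rho_def algebra_simps power2_eq_square)
    thus "(\<i> * cx h * rho x - \<i> * cx x * (cnj (cx x) * cx h + cx x * cnj (cx h))) / (rho x * rho x)
       = vortex_z x * cx h + vortex_b x * cnj (cx h)"
      unfolding vortex_z_def vortex_b_def by (simp add: power2_eq_square diff_divide_distrib)
  qed
qed (auto simp: vortex_z_def[abs_def] vortex_b_def[abs_def] intro!: continuous_intros rho_continuous)

lemma Re_vortex_z: "Re (vortex_z x) = 0"
  unfolding vortex_z_def rho_real by (simp flip: of_real_power)

lemma vortex_decay: "decays 1 2 vortex" "decays 2 2 vortex_z" "decays 2 2 vortex_b"
proof -
  let ?r = "\<lambda>x. 1 + (norm x)\<^sup>2"
  have sq: "(norm x)\<^sup>2 / (?r x)\<^sup>2 \<le> 1 / ?r x" for x :: "real^2"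
    using rho_ge[of x] by (simp add: power2_eq_square divide_le_eq mult.assoc[symmetric])
  have "norm (vortex x) \<le> 2 * dec 1 x" for x
  proof -
    have "norm (vortex x) = norm x * (1 / ?r x)" by (simp add: vortex_def norm_mult norm_divide norm_rho)
    also have "\<dots> \<le> norm x * (2 * dec 2 x)" by (intro mult_left_mono dec_2_ge) auto
    also have "\<dots> \<le> 2 * dec 1 x" using norm_mult_dec_le[of x 2] by simp
    finally show ?thesis .
  qed
  moreover have "norm (vortex_z x) \<le> 2 * dec 2 x" for x
  proof -
    have "norm (vortex_z x) = 1 / (?r x)\<^sup>2" by (simp add: vortex_z_def norm_divide norm_power norm_rho)
    also have "\<dots> \<le> 1 / ?r x" using rho_ge[of x] by (intro divide_left_mono) (auto simp: power2_eq_square)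
    also have "\<dots> \<le> 2 * dec 2 x" by (rule dec_2_ge)
    finally show ?thesis .
  qed
  moreover have "norm (vortex_b x) \<le> 2 * dec 2 x" for x
  proof -
    have "norm (vortex_b x) = (norm x)\<^sup>2 / (?r x)\<^sup>2"
      by (simp add: vortex_b_def norm_mult norm_divide norm_power norm_rho)
    also have "\<dots> \<le> 1 / ?r x" by (rule sq)
    also have "\<dots> \<le> 2 * dec 2 x" by (rule dec_2_ge)
    finally show ?thesis .
  qed
  ultimately show "decays 1 2 vortex" "decays 2 2 vortex_z" "decays 2 2 vortex_b" by (simp_all add: decays_def)
qed

text \<open>The centripetal acceleration. It equals the cnj z derivative of 1/\<open>rho\<close>,
  that is, the gradient of 1/(2 \<open>rho\<close>), and so can be absorbed by a pressure.\<close>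

lemma advect_vortex: "advect vortex_z vortex_b vortex x = - cx x / (rho x)\<^sup>2"
proof -
  have "advect vortex_z vortex_b vortex x = - cx x * (1 + cx x * cnj (cx x)) / ((rho x)\<^sup>2 * rho x)"
    unfolding advect_def vortex_z_def vortex_b_def vortex_def by (simp add: field_simps power2_eq_square)
  thus ?thesis unfolding rho_def[symmetric] by simp
qed

text \<open>Minus the Laplacian of \<open>vortex\<close>, computed as -4 times the cnj z derivative
  of \<open>vortex_z\<close>.\<close>

definition vortex_source :: "real^2 \<Rightarrow> complex" where "vortex_source x = 8 * \<i> * cx x / (rho x)^3"

lemma inverse_rho_power_deriv:
  "((\<lambda>x. 1 / rho x) has_derivative (\<lambda>h. - cnj (cx x) / (rho x)\<^sup>2 * cx h + - cx x / (rho x)\<^sup>2 * cnj (cx h))) (at x)"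
  "((\<lambda>x. 1 / (rho x)\<^sup>2) has_derivative (\<lambda>h. - 2 * cnj (cx x) / (rho x)^3 * cx h + - 2 * cx x / (rho x)^3 * cnj (cx h))) (at x)"
proof -
  show 1: "((\<lambda>x. 1 / rho x) has_derivative (\<lambda>h. - cnj (cx x) / (rho x)\<^sup>2 * cx h + - cx x / (rho x)\<^sup>2 * cnj (cx h))) (at x)"
    by (rule has_derivative_eq_rhs[OF has_derivative_divide'[OF has_derivative_const rho_has_derivative rho_nonzero]])
       (simp add: fun_eq_iff field_simps power2_eq_square)
  have "((\<lambda>x. 1 / rho x * (1 / rho x)) has_derivative
     (\<lambda>h. - 2 * cnj (cx x) / (rho x)^3 * cx h + - 2 * cx x / (rho x)^3 * cnj (cx h))) (at x)"
    by (rule has_derivative_eq_rhs[OF has_derivative_mult[OF 1 1]])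
       (simp add: fun_eq_iff field_simps power2_eq_square power3_eq_cube)
  thus "((\<lambda>x. 1 / (rho x)\<^sup>2) has_derivative (\<lambda>h. - 2 * cnj (cx x) / (rho x)^3 * cx h + - 2 * cx x / (rho x)^3 * cnj (cx h))) (at x)"
    by (simp add: power2_eq_square)
qed

lemma vortex_weak_laplacian:
  assumes \<phi>: "\<phi> \<in> test_functions"
  shows "(\<integral>x. vortex x * of_real (lap \<phi> x) \<partial>lborel) = - (\<integral>x. vortex_source x * of_real (\<phi> x) \<partial>lborel)"
proof -
  have "(\<integral>x. vortex x * of_real (lap \<phi> x) \<partial>lborel) = - 4 * (\<integral>x. vortex_z x * dbar \<phi> x \<partial>lborel)"
    using laplacian_by_parts[OF \<phi>] vortex_field_deriv unfolding field_deriv_def by blast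
  also have "(\<integral>x. vortex_z x * dbar \<phi> x \<partial>lborel) = - (\<integral>x. \<i> * (- 2 * cx x / (rho x)^3) * of_real (\<phi> x) \<partial>lborel)"
  proof (rule dbar_by_parts[OF \<phi>])
    show "(vortex_z has_derivative (\<lambda>h. \<i> * (- 2 * cnj (cx x) / (rho x)^3) * cx h + \<i> * (- 2 * cx x / (rho x)^3) * cnj (cx h))) (at x)" for x
      using has_derivative_mult_right[OF inverse_rho_power_deriv(2), of \<i> x]
      unfolding vortex_z_def[abs_def] by (simp add: algebra_simps)
  qed (auto intro!: continuous_intros rho_continuous)
  also have "- 4 * - (\<integral>x. \<i> * (- 2 * cx x / (rho x)^3) * of_real (\<phi> x) \<partial>lborel)
     = (\<integral>x. 4 * (\<i> * (- 2 * cx x / (rho x)^3) * of_real (\<phi> x)) \<partial>lborel)" by (subst integral_mult_right_zero) simp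
  also have "\<dots> = (\<integral>x. - (vortex_source x * of_real (\<phi> x)) \<partial>lborel)"
    by (intro Bochner_Integration.integral_cong refl) (simp add: vortex_source_def)
  finally show ?thesis by simp
qed

lemma vortex_pressure_weak:
  assumes \<phi>: "\<phi> \<in> test_functions"
  shows "(\<integral>x. 1 / rho x * dbar \<phi> x \<partial>lborel) = - (\<integral>x. advect vortex_z vortex_b vortex x * of_real (\<phi> x) \<partial>lborel)"
  unfolding advect_vortex
  by (rule dbar_by_parts[OF \<phi> inverse_rho_power_deriv(1)]) (auto intro!: continuous_intros rho_continuous)

lemma vortex_source_continuous: "continuous_on UNIV vortex_source"
  unfolding vortex_source_def[abs_def] by (auto intro!: continuous_intros rho_continuous)

lemma inverse_rho_decay: "decays 2 2 (\<lambda>x. 1 / rho x)"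
  using dec_2_ge by (simp add: decays_def norm_divide norm_rho)

lemma vortex_source_decay: "decays 5 64 vortex_source"
proof -
  have "decays (- 1 + (2 + (2 + 2))) (1 * (2 * (2 * 2))) (\<lambda>x. cx x * (1 / rho x * (1 / rho x * (1 / rho x))))"
    by (intro decays_mult decays_cx inverse_rho_decay)
  from decays_cmult[OF this, of "8 * \<i>"] show ?thesis
    by (simp add: vortex_source_def[abs_def] norm_mult power3_eq_cube mult.assoc)
qed

text \<open>The source is the cnj z derivative of a multiple of 1/\<open>rho\<close>^2, so it exerts
  no net force. Multiplication by cnj z leaves a radial integrand, and the torque is 8 times
  \<pi>/2.\<close>

lemma vortex_source_moments:
  "(\<integral>x. vortex_source x \<partial>lborel) = 0"
  "Im (\<integral>x. cnj (cx x) * vortex_source x \<partial>lborel) = 4 * pi"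
proof -
  have d: "decays (- 1 + (2 + (2 + 2))) (1 * (2 * (2 * 2))) (\<lambda>x. cx x * (1 / rho x * (1 / rho x * (1 / rho x))))"
    "decays (- 1 + (2 + (2 + 2))) (1 * (2 * (2 * 2))) (\<lambda>x. cnj (cx x) * (1 / rho x * (1 / rho x * (1 / rho x))))"
    "decays (2 + 2) (2 * 2) (\<lambda>x. 1 / rho x * (1 / rho x))"
    by (intro decays_mult decays_cx inverse_rho_decay)+
  have "(\<integral>x. - 2 * cx x / (rho x)^3 \<partial>lborel) = 0"
  proof (rule wirtinger_integral_zero(2)[OF inverse_rho_power_deriv(2), of 1 16])
    show "decays (1 + 1) 16 (\<lambda>x. 1 / (rho x)\<^sup>2)"
      using decays_weaken[OF d(3), of 2 16] by (simp add: power2_eq_square)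
    show "decays (2 + 1) 16 (\<lambda>x. - 2 * cx x / (rho x)^3)"
      using decays_weaken[OF decays_cmult[OF d(1), of "- 2"], of 3 16] by (simp add: power3_eq_cube mult.assoc)
    show "decays (2 + 1) 16 (\<lambda>x. - 2 * cnj (cx x) / (rho x)^3)"
      using decays_weaken[OF decays_cmult[OF d(2), of "- 2"], of 3 16] by (simp add: power3_eq_cube mult.assoc)
  qed (auto intro!: continuous_intros rho_continuous)
  hence "(\<integral>x. (- 4 * \<i>) * (- 2 * cx x / (rho x)^3) \<partial>lborel) = 0" by (subst integral_mult_right_zero) simp
  thus "(\<integral>x. vortex_source x \<partial>lborel) = 0" by (simp add: vortex_source_def mult_ac)
  have "cnj (cx x) * vortex_source x = 8 * \<i> * of_real ((norm x)\<^sup>2 / (1 + (norm x)\<^sup>2)^3)" for x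
  proof -
    have "cnj (cx x) * vortex_source x = 8 * \<i> * (cx x * cnj (cx x)) / (rho x)^3" by (simp add: vortex_source_def)
    also have "cx x * cnj (cx x) = of_real ((norm x)\<^sup>2)" by (simp flip: complex_norm_square)
    finally show ?thesis unfolding rho_real by simp
  qed
  hence "(\<integral>x. cnj (cx x) * vortex_source x \<partial>lborel) = 8 * \<i> * of_real (\<integral>x. (norm x)\<^sup>2 / (1 + (norm x)\<^sup>2)^3 \<partial>(lborel :: (real^2) measure))"
    by (simp del: of_real_divide)
  also have "(\<integral>x. (norm x)\<^sup>2 / (1 + (norm x)\<^sup>2)^3 \<partial>(lborel :: (real^2) measure)) = pi / 2"
    using integral_vortex_moment by (simp add: has_bochner_integral_iff)
  finally show "Im (\<integral>x. cnj (cx x) * vortex_source x \<partial>lborel) = 4 * pi" by simp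
qed

section \<open>The Gaussian strain field\<close>

text \<open>Multiplying by \<open>a_1 + i a_2\<close> yields the bracket of the forcing times
  e^(-|x|^2): the two real strain fields are one complex one.\<close>

definition gauss :: "real^2 \<Rightarrow> complex" where "gauss x = cnj (cx x) * exp (- (cx x * cnj (cx x)))"

text \<open>The fourth power of the elementary bound (1 + |x|)^2 \<le> 8 exp(|x|^2 / 4); hence 4096
  = 8^4. The exponent 8 leaves room for all later multiplications by z.\<close>

lemma exp_decay: "decays 8 4096 (\<lambda>x. exp (- (cx x * cnj (cx x))))"
  unfolding decays_def
proof
  fix x :: "real^2"
  define s where "s = (norm x)\<^sup>2"
  have p: "1 + norm x > 0" using norm_ge_zero[of x] by linarith
  have "(1 + norm x)\<^sup>2 \<le> 2 * (1 + s)"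
    using zero_le_power2[of "1 - norm x"] by (simp add: s_def power2_eq_square algebra_simps)
  also have "\<dots> \<le> 8 * (1 + s / 4)" by (simp add: s_def)
  also have "\<dots> \<le> 8 * exp (s / 4)" by (intro mult_left_mono exp_ge_add_one_self) auto
  finally have "((1 + norm x)\<^sup>2)^4 \<le> (8 * exp (s / 4))^4" by (intro power_mono) auto
  also have "(8 * exp (s / 4))^4 = 4096 * exp s"
    by (simp add: power_mult_distrib flip: exp_of_nat_mult)
  finally have "(1 + norm x)^8 \<le> 4096 * exp s" by simp
  hence "exp (- s) \<le> 4096 / (1 + norm x)^8"
    using p by (simp add: exp_minus field_simps)
  moreover have "dec 8 x = 1 / (1 + norm x)^8" using p by (simp add: dec_def powr_minus divide_inverse)
  moreover have "norm (exp (- (cx x * cnj (cx x)))) = exp (- s)"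
    by (simp add: s_def flip: complex_norm_square)
  ultimately show "norm (exp (- (cx x * cnj (cx x)))) \<le> 4096 * dec 8 x" by simp
qed

lemma gauss_decay: "decays 7 4096 gauss"
  unfolding gauss_def[abs_def] using decays_uminus_1_mult(2)[OF exp_decay] by simp

lemma gauss_continuous: "continuous_on UNIV gauss"
  unfolding gauss_def[abs_def] by (intro continuous_intros)

text \<open>The first two integrands are, up to sign, the z-derivatives of e^(-|z|^2) and of
  \<open>gauss\<close>. As only the z-moment survives, a multiple of \<open>gauss\<close> corrects
  that moment without changing net force or torque.\<close>

lemma gauss_moments:
  "(\<integral>x. gauss x \<partial>lborel) = 0" "(\<integral>x. cnj (cx x) * gauss x \<partial>lborel) = 0" "(\<integral>x. cx x * gauss x \<partial>lborel) = of_real pi"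
proof -
  let ?E = "\<lambda>x. exp (- (cx x * cnj (cx x)))"
  have z: "(cx has_derivative cx) (at x)" for x
    using bounded_linear.has_derivative[OF bounded_linear_cx has_derivative_ident] .
  have zc: "((\<lambda>x. cnj (cx x)) has_derivative (\<lambda>h. cnj (cx h))) (at x)" for x
    by (rule bounded_linear.has_derivative[OF bounded_linear_cnj z])
  have dE: "(?E has_derivative (\<lambda>h. - gauss x * cx h + - (cx x * ?E x) * cnj (cx h))) (at x)" for x
  proof -
    have "((\<lambda>x. - (cx x * cnj (cx x))) has_derivative (\<lambda>h. - (cx x * cnj (cx h) + cx h * cnj (cx x)))) (at x)"
      by (intro has_derivative_minus has_derivative_mult z zc)
    from has_derivative_compose[OF this, of exp "\<lambda>h. ?E x * h"]
    have "(?E has_derivative (\<lambda>h. ?E x * - (cx x * cnj (cx h) + cx h * cnj (cx x)))) (at x)"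
      using DERIV_exp[of "- (cx x * cnj (cx x))"] by (simp add: has_field_derivative_def)
    thus ?thesis by (rule has_derivative_eq_rhs) (simp add: gauss_def algebra_simps)
  qed
  have "(\<integral>x. - gauss x \<partial>lborel) = 0"
  proof (rule wirtinger_integral_zero(1)[OF dE, of 1 4096])
    show "decays (1 + 1) 4096 ?E" by (rule decays_weaken[OF exp_decay]) auto
    show "decays (2 + 1) 4096 (\<lambda>x. - gauss x)"
      using decays_weaken[OF decays_cmult[OF gauss_decay, of "- 1"], of 3 4096] by simp
    show "decays (2 + 1) 4096 (\<lambda>x. - (cx x * ?E x))"
      using decays_weaken[OF decays_cmult[OF decays_uminus_1_mult(1)[OF exp_decay], of "- 1"], of 3 4096] by simp
  qed (auto intro!: continuous_intros gauss_continuous)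
  thus "(\<integral>x. gauss x \<partial>lborel) = 0" by simp
  have dG: "(gauss has_derivative (\<lambda>h. - (cnj (cx x) * gauss x) * cx h + (?E x - cx x * gauss x) * cnj (cx h))) (at x)" for x
    unfolding gauss_def[abs_def]
    by (rule has_derivative_eq_rhs[OF has_derivative_mult[OF zc dE]]) (simp add: gauss_def algebra_simps)
  have "(\<integral>x. - (cnj (cx x) * gauss x) \<partial>lborel) = 0"
  proof (rule wirtinger_integral_zero(1)[OF dG, of 1 8192])
    show "decays (1 + 1) 8192 gauss" by (rule decays_weaken[OF gauss_decay]) auto
    show "decays (2 + 1) 8192 (\<lambda>x. - (cnj (cx x) * gauss x))"
      using decays_weaken[OF decays_cmult[OF decays_uminus_1_mult(2)[OF gauss_decay], of "- 1"], of 3 8192] by simp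
    have "decays (2 + 1) 8192 (\<lambda>x. ?E x + - 1 * (cx x * gauss x))"
      by (rule decays_add_weaken[OF exp_decay decays_cmult[OF decays_uminus_1_mult(1)[OF gauss_decay]]]) auto
    thus "decays (2 + 1) 8192 (\<lambda>x. ?E x - cx x * gauss x)" by simp
  qed (auto intro!: continuous_intros gauss_continuous)
  thus "(\<integral>x. cnj (cx x) * gauss x \<partial>lborel) = 0" by simp
  have "cx x * gauss x = of_real ((norm x)\<^sup>2 * exp (- (norm x)\<^sup>2))" for x
  proof -
    have "cx x * gauss x = (cx x * cnj (cx x)) * exp (- (cx x * cnj (cx x)))" by (simp add: gauss_def)
    also have "cx x * cnj (cx x) = of_real ((norm x)\<^sup>2)" by (simp flip: complex_norm_square)
    finally show ?thesis by (simp flip: exp_of_real)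
  qed
  hence "(\<integral>x. cx x * gauss x \<partial>lborel) = of_real (\<integral>x. (norm x)\<^sup>2 * exp (- (norm x)\<^sup>2) \<partial>(lborel :: (real^2) measure))"
    by (simp del: of_real_mult)
  also have "(\<integral>x. (norm x)\<^sup>2 * exp (- (norm x)\<^sup>2) \<partial>(lborel :: (real^2) measure)) = pi"
    using integral_gaussian_moment by (simp add: has_bochner_integral_iff)
  finally show "(\<integral>x. cx x * gauss x \<partial>lborel) = of_real pi" .
qed

section \<open>The fixed point\<close>

text \<open>The quadratic terms of \<kappa> Q + v, except the self-advection of \<kappa> Q, which
  belongs to the pressure.\<close>

definition nonlin :: "real \<Rightarrow> (real^2 \<Rightarrow> complex) \<Rightarrow> real^2 \<Rightarrow> complex" where
  "nonlin \<kappa> G x = of_real \<kappa> * interact vortex vortex_z vortex_b (velo G) (velo_z G) (velo_b G) x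
     + advect (velo_z G) (velo_b G) (velo G) x"

text \<open>The projection along \<open>gauss\<close> onto fields with vanishing z-moment. At the
  fixed point the coefficient removed here is what determines the parameters
  \<open>a\<close>.\<close>

definition drop_moment :: "(real^2 \<Rightarrow> complex) \<Rightarrow> real^2 \<Rightarrow> complex" where
  "drop_moment H x = H x - (\<integral>y. cx y * H y \<partial>lborel) / of_real pi * gauss x"

lemma decays_integrable:
  assumes "continuous_on UNIV f" "decays q c f" "q > 2"
  shows "integrable lborel f"
  by (rule integrable_of_dec[of _ q c]) (use assms in \<open>auto simp: decays_def intro: borel_measurable_continuous_onI\<close>)

lemma decays_integral_le:
  assumes "continuous_on UNIV f" "decays q c f" "q > 2"
  shows "norm (integral\<^sup>L lborel f) \<le> c * integral\<^sup>L lborel (dec q)"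
  by (rule norm_integral_le_dec) (use assms in \<open>auto simp: decays_def intro: borel_measurable_continuous_onI\<close>)

lemma moments_integrable:
  assumes "continuous_on UNIV H" "decays (3 + e) c H" "e > 0"
  shows "integrable lborel H" "integrable lborel (\<lambda>x. cx x * H x)" "integrable lborel (\<lambda>x. cnj (cx x) * H x)"
proof -
  show "integrable lborel H" by (rule decays_integrable[OF assms(1,2)]) (use assms in simp)
  show "integrable lborel (\<lambda>x. cx x * H x)"
    by (rule decays_integrable[OF _ decays_uminus_1_mult(1)[OF assms(2)]], intro continuous_intros assms) (use assms in simp)
  show "integrable lborel (\<lambda>x. cnj (cx x) * H x)"
    by (rule decays_integrable[OF _ decays_uminus_1_mult(2)[OF assms(2)]], intro continuous_intros assms) (use assms in simp)
qed

text \<open>The norm of the projection is bounded by the decay constant 4096 of \<open>gauss\<close>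
  times the mass of \<open>dec (2 + e)\<close>, which controls the z-moment.\<close>

lemma drop_moment_facts:
  assumes H: "continuous_on UNIV H" "decays (3 + e) c H" and e: "0 < e" "e < 1"
  shows "continuous_on UNIV (drop_moment H)"
    and "decays (3 + e) ((1 + 4096 * integral\<^sup>L lborel (dec (2 + e))) * c) (drop_moment H)"
    and "(\<integral>x. drop_moment H x \<partial>lborel) = (\<integral>x. H x \<partial>lborel)"
    and "(\<integral>x. cx x * drop_moment H x \<partial>lborel) = 0"
    and "(\<integral>x. cnj (cx x) * drop_moment H x \<partial>lborel) = (\<integral>x. cnj (cx x) * H x \<partial>lborel)"
proof -
  have c: "c \<ge> 0" by (rule decays_nonneg[OF H(2)])
  define m where "m = (\<integral>y. cx y * H y \<partial>lborel) / of_real pi"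
  note i = moments_integrable[OF H e(1)]
  have ig: "integrable lborel gauss" "integrable lborel (\<lambda>x. cx x * gauss x)" "integrable lborel (\<lambda>x. cnj (cx x) * gauss x)"
    using moments_integrable[OF gauss_continuous, of 4 4096] gauss_decay by auto
  have e': "drop_moment H x = H x - m * gauss x" for x by (simp add: drop_moment_def m_def)
  show "continuous_on UNIV (drop_moment H)"
    unfolding drop_moment_def[abs_def] by (intro continuous_intros H gauss_continuous)
  have "norm m \<le> c * integral\<^sup>L lborel (dec (2 + e))"
  proof -
    have "norm (\<integral>y. cx y * H y \<partial>lborel) \<le> c * integral\<^sup>L lborel (dec (3 + e - 1))"
      by (rule decays_integral_le[OF _ decays_uminus_1_mult(1)[OF H(2)]], intro continuous_intros H) (use e in simp)
    moreover have "norm m \<le> norm (\<integral>y. cx y * H y \<partial>lborel)"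
      using pi_gt3 unfolding m_def norm_divide by (simp add: divide_le_eq mult_le_cancel_left1)
    ultimately show ?thesis by simp
  qed
  hence "decays (3 + e) (c + (c * integral\<^sup>L lborel (dec (2 + e))) * 4096) (\<lambda>x. H x + - m * gauss x)"
    by (intro decays_add_weaken[OF H(2) decays_cmult[OF gauss_decay]]) (use e in auto)
  thus "decays (3 + e) ((1 + 4096 * integral\<^sup>L lborel (dec (2 + e))) * c) (drop_moment H)"
    unfolding e' by (simp add: algebra_simps)
  show "(\<integral>x. drop_moment H x \<partial>lborel) = (\<integral>x. H x \<partial>lborel)"
    unfolding e' using i ig by (simp add: gauss_moments)
  have "(\<integral>x. cx x * drop_moment H x \<partial>lborel) = (\<integral>x. cx x * H x - m * (cx x * gauss x) \<partial>lborel)"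
    unfolding e' by (simp add: algebra_simps)
  also have "\<dots> = (\<integral>x. cx x * H x \<partial>lborel) - m * of_real pi"
    using i ig by (simp add: gauss_moments)
  finally show "(\<integral>x. cx x * drop_moment H x \<partial>lborel) = 0" by (simp add: m_def)
  have "(\<integral>x. cnj (cx x) * drop_moment H x \<partial>lborel) = (\<integral>x. cnj (cx x) * H x - m * (cnj (cx x) * gauss x) \<partial>lborel)"
    unfolding e' by (simp add: algebra_simps)
  also have "\<dots> = (\<integral>x. cnj (cx x) * H x \<partial>lborel)"
    using i ig by (simp add: gauss_moments)
  finally show "(\<integral>x. cnj (cx x) * drop_moment H x \<partial>lborel) = (\<integral>x. cnj (cx x) * H x \<partial>lborel)" .
qed

lemma drop_moment_diff:
  assumes H: "continuous_on UNIV H" "decays (3 + e) c H" and K: "continuous_on UNIV K" "decays (3 + e) d K" and e: "e > 0"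
  shows "drop_moment H x - drop_moment K x = drop_moment (\<lambda>x. H x - K x) x"
proof -
  have "(\<integral>y. cx y * (H y - K y) \<partial>lborel) = (\<integral>y. cx y * H y - cx y * K y \<partial>lborel)"
    by (simp add: right_diff_distrib)
  also have "\<dots> = (\<integral>y. cx y * H y \<partial>lborel) - (\<integral>y. cx y * K y \<partial>lborel)"
    using moments_integrable[OF H e] moments_integrable[OF K e] by simp
  finally have e: "(\<integral>y. cx y * (H y - K y) \<partial>lborel) = (\<integral>y. cx y * H y \<partial>lborel) - (\<integral>y. cx y * K y \<partial>lborel)" .
  show ?thesis unfolding drop_moment_def e by (simp add: algebra_simps diff_divide_distrib)
qed

lemma admissible_diff:
  assumes G: "continuous_on UNIV G" "admissible e c G" and H: "continuous_on UNIV H" "admissible e d H"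
    and D: "decays (3 + e) \<delta> (\<lambda>x. G x - H x)" and e: "e > 0"
  shows "admissible e \<delta> (\<lambda>x. G x - H x)"
proof -
  have dG: "decays (3 + e) c G" and dH: "decays (3 + e) d H" using G H by (auto simp: admissible_def)
  note i = moments_integrable[OF G(1) dG e] moments_integrable[OF H(1) dH e]
  show ?thesis using G H i D unfolding admissible_def by (simp add: right_diff_distrib borel_measurable_diff)
qed

text \<open>One constant controls both size and differences. The small factor
  \<open>\<bar>\<kappa>\<bar> + c\<close> makes the map a contraction on a small ball.\<close>

lemma nonlin_facts:
  assumes e: "0 < e" "e < 1"
  obtains D where "D > 0"
    "\<And>G c \<kappa>. admissible e c G \<Longrightarrow> continuous_on UNIV (nonlin \<kappa> G) \<and> decays (3 + e) (D * (\<bar>\<kappa>\<bar> + c) * c) (nonlin \<kappa> G)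
        \<and> (\<integral>x. nonlin \<kappa> G x \<partial>lborel) = 0 \<and> Im (\<integral>x. cnj (cx x) * nonlin \<kappa> G x \<partial>lborel) = 0"
    "\<And>G H c \<delta> \<kappa>. admissible e c G \<Longrightarrow> admissible e c H \<Longrightarrow> admissible e \<delta> (\<lambda>x. G x - H x) \<Longrightarrow>
        decays (3 + e) (D * (\<bar>\<kappa>\<bar> + c) * \<delta>) (\<lambda>x. nonlin \<kappa> G x - nonlin \<kappa> H x)"
proof -
  obtain C where C: "C > 0" and V: "\<And>G c. admissible e c G \<Longrightarrow>
      decays (1 + e) (C * c) (velo G) \<and> decays (2 + e) (C * c) (velo_z G) \<and> decays (2 + e) (C * c) (velo_b G)"
    using velo_decay[OF e] by blast
  \<comment> \<open>The term 8 C comes from the interaction with the vortex, whose decay constant is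
    2; 4 C^2 comes from the two terms in the difference of the squares.\<close>
  define D where "D = 8 * C + 4 * (C * C)"
  have D: "D > 0" using C by (simp add: D_def add_pos_pos)
  have fd: "field_deriv (velo G) (velo_z G) (velo_b G)" if "admissible e c G" for G c
    using that e velo_field_deriv[of G "3 + e" c] by (auto simp: admissible_def)
  have QV: "(\<integral>x. interact vortex vortex_z vortex_b (velo G) (velo_z G) (velo_b G) x \<partial>lborel) = 0"
      "Im (\<integral>x. cnj (cx x) * interact vortex vortex_z vortex_b (velo G) (velo_z G) (velo_b G) x \<partial>lborel) = 0"
      "decays (3 + e) (4 * (2 * (C * c))) (interact vortex vortex_z vortex_b (velo G) (velo_z G) (velo_b G))"
      "continuous_on UNIV (interact vortex vortex_z vortex_b (velo G) (velo_z G) (velo_b G))"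
    if adm: "admissible e c G" for G c
    by (rule interact_moments[OF vortex_field_deriv fd[OF adm] Re_vortex_z Re_velo_z e(1), of 1 2 "1 + e" "C * c"];
        use vortex_decay V[OF adm] in simp)+
  show ?thesis
  proof (rule that[OF D])
    fix G c \<kappa> assume adm: "admissible e c G"
    have c: "c \<ge> 0" using adm by (auto simp: admissible_def dest: decays_nonneg)
    note v = V[OF adm]
    \<comment> \<open>Two remainders decay like r^(-1-e) each, so the parameter of
      \<open>interact_moments\<close> is 2 e.\<close>
    note VV = interact_moments[OF fd[OF adm] fd[OF adm] Re_velo_z Re_velo_z, of "2 * e" "1 + e" "C * c" "1 + e" "C * c"]
    \<comment> \<open>Self-advection is half of the symmetric interaction of a field with itself, so
      the torque statement applies to it.\<close>
    have half: "advect (velo_z G) (velo_b G) (velo G) x = 1 / 2 * interact (velo G) (velo_z G) (velo_b G) (velo G) (velo_z G) (velo_b G) x" for x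
      by (simp add: interact_def)
    have VV': "(\<integral>x. advect (velo_z G) (velo_b G) (velo G) x \<partial>lborel) = 0"
      "Im (\<integral>x. cnj (cx x) * advect (velo_z G) (velo_b G) (velo G) x \<partial>lborel) = 0"
    proof -
      show "(\<integral>x. advect (velo_z G) (velo_b G) (velo G) x \<partial>lborel) = 0"
        unfolding half using VV(1) v e by simp
      have "(\<integral>x. cnj (cx x) * advect (velo_z G) (velo_b G) (velo G) x \<partial>lborel)
        = (\<integral>x. 1 / 2 * (cnj (cx x) * interact (velo G) (velo_z G) (velo_b G) (velo G) (velo_z G) (velo_b G) x) \<partial>lborel)"
        unfolding half by (simp add: mult_ac)
      also have "\<dots> = 1 / 2 * (\<integral>x. cnj (cx x) * interact (velo G) (velo_z G) (velo_b G) (velo G) (velo_z G) (velo_b G) x \<partial>lborel)"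
        by (rule integral_mult_right_zero)
      finally have eq: "(\<integral>x. cnj (cx x) * advect (velo_z G) (velo_b G) (velo G) x \<partial>lborel)
        = 1 / 2 * (\<integral>x. cnj (cx x) * interact (velo G) (velo_z G) (velo_b G) (velo G) (velo_z G) (velo_b G) x \<partial>lborel)" .
      show "Im (\<integral>x. cnj (cx x) * advect (velo_z G) (velo_b G) (velo G) x \<partial>lborel) = 0"
        unfolding eq using VV(2) v e by simp
    qed
    have ad: "decays (3 + e) (2 * ((C * c) * (C * c))) (advect (velo_z G) (velo_b G) (velo G))"
      by (rule decays_weaken[OF advect_decays[of "2 + e" _ _ _ "1 + e"]]) (use v e in auto)
    have ac: "continuous_on UNIV (advect (velo_z G) (velo_b G) (velo G))"
      using fd[OF adm] by (intro advect_continuous field_deriv_continuous[OF fd[OF adm]]) (simp_all add: field_deriv_def)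
    note q = QV[OF adm]
    have qd: "decays (3 + e) (norm (complex_of_real \<kappa>) * (4 * (2 * (C * c))))
       (\<lambda>x. of_real \<kappa> * interact vortex vortex_z vortex_b (velo G) (velo_z G) (velo_b G) x)"
      by (rule decays_cmult[OF q(3)])
    have qc: "continuous_on UNIV (\<lambda>x. of_real \<kappa> * interact vortex vortex_z vortex_b (velo G) (velo_z G) (velo_b G) x)"
      by (intro continuous_intros q(4))
    have le: "\<bar>\<kappa>\<bar> * (4 * (2 * (C * c))) + 2 * ((C * c) * (C * c)) \<le> D * (\<bar>\<kappa>\<bar> + c) * c"
      unfolding D_def using C c by (simp add: algebra_simps)
    note im = moments_integrable[OF qc qd e(1)] moments_integrable[OF ac ad e(1)]
    have dN: "decays (3 + e) (D * (\<bar>\<kappa>\<bar> + c) * c) (nonlin \<kappa> G)"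
      unfolding nonlin_def[abs_def] by (rule decays_add_weaken[OF qd ad]) (use le in auto)
    have cN: "continuous_on UNIV (nonlin \<kappa> G)" unfolding nonlin_def[abs_def] by (intro continuous_on_add qc ac)
    have zN: "(\<integral>x. nonlin \<kappa> G x \<partial>lborel) = 0"
      unfolding nonlin_def using im q VV' by simp
    have "(\<integral>x. cnj (cx x) * nonlin \<kappa> G x \<partial>lborel)
       = (\<integral>x. cnj (cx x) * (of_real \<kappa> * interact vortex vortex_z vortex_b (velo G) (velo_z G) (velo_b G) x) \<partial>lborel)
        + (\<integral>x. cnj (cx x) * advect (velo_z G) (velo_b G) (velo G) x \<partial>lborel)"
      unfolding nonlin_def distrib_left by (rule Bochner_Integration.integral_add[OF im(3) im(6)])
    also have "(\<integral>x. cnj (cx x) * (of_real \<kappa> * interact vortex vortex_z vortex_b (velo G) (velo_z G) (velo_b G) x) \<partial>lborel)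
       = of_real \<kappa> * (\<integral>x. cnj (cx x) * interact vortex vortex_z vortex_b (velo G) (velo_z G) (velo_b G) x \<partial>lborel)"
      by (subst integral_mult_right_zero[symmetric]) (simp add: mult_ac)
    finally have "Im (\<integral>x. cnj (cx x) * nonlin \<kappa> G x \<partial>lborel) = 0" using q(2) VV'(2) by simp
    thus "continuous_on UNIV (nonlin \<kappa> G) \<and> decays (3 + e) (D * (\<bar>\<kappa>\<bar> + c) * c) (nonlin \<kappa> G)
        \<and> (\<integral>x. nonlin \<kappa> G x \<partial>lborel) = 0 \<and> Im (\<integral>x. cnj (cx x) * nonlin \<kappa> G x \<partial>lborel) = 0"
      using dN cN zN by blast
  next
    fix G H c \<delta> \<kappa> assume G: "admissible e c G" and H: "admissible e c H" and W: "admissible e \<delta> (\<lambda>x. G x - H x)"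
    have c: "c \<ge> 0" "\<delta> \<ge> 0" using G W by (auto simp: admissible_def dest: decays_nonneg)
    have vd: "velo (\<lambda>y. G y - H y) x = velo G x - velo H x"
      "velo_z (\<lambda>y. G y - H y) x = velo_z G x - velo_z H x"
      "velo_b (\<lambda>y. G y - H y) x = velo_b G x - velo_b H x" for x
      using velo_diff[of G H "3 + e" c c x] G H e by (auto simp: admissible_def)
    let ?W = "\<lambda>y. G y - H y"
    \<comment> \<open>Linearity of \<open>velo\<close> and polarisation: v . grad v - w . grad w = v
      . grad (v - w) + (v - w) . grad w.\<close>
    have eq: "nonlin \<kappa> G x - nonlin \<kappa> H x = of_real \<kappa> * interact vortex vortex_z vortex_b (velo ?W) (velo_z ?W) (velo_b ?W) x
       + (advect (velo_z ?W) (velo_b ?W) (velo G) x + advect (velo_z H) (velo_b H) (velo ?W) x)" for x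
      unfolding nonlin_def interact_def advect_def vd by (simp add: algebra_simps)
    have d1: "decays (3 + e) (2 * ((C * \<delta>) * (C * c))) (advect (velo_z ?W) (velo_b ?W) (velo G))"
      by (rule decays_weaken[OF advect_decays[of "2 + e" _ _ _ "1 + e"]]) (use V[OF W] V[OF G] e in auto)
    have d2: "decays (3 + e) (2 * ((C * c) * (C * \<delta>))) (advect (velo_z H) (velo_b H) (velo ?W))"
      by (rule decays_weaken[OF advect_decays[of "2 + e" _ _ _ "1 + e"]]) (use V[OF W] V[OF H] e in auto)
    have le: "norm (complex_of_real \<kappa>) * (4 * (2 * (C * \<delta>))) + (2 * ((C * \<delta>) * (C * c)) + 2 * ((C * c) * (C * \<delta>))) \<le> D * (\<bar>\<kappa>\<bar> + c) * \<delta>"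
      unfolding D_def using C c by (simp add: algebra_simps)
    show "decays (3 + e) (D * (\<bar>\<kappa>\<bar> + c) * \<delta>) (\<lambda>x. nonlin \<kappa> G x - nonlin \<kappa> H x)"
      unfolding eq by (rule decays_add_weaken[OF decays_cmult[OF QV(3)[OF W]] decays_add[OF d1 d2] order_refl order_refl le])
  qed
qed

section \<open>Weighted sup norms and the contraction\<close>

text \<open>Division by the weight identifies the decaying continuous sources isometrically with
  bounded continuous functions, whose completeness is thereby available.\<close>

definition weighted :: "real \<Rightarrow> ((real^2) \<Rightarrow>\<^sub>C complex) \<Rightarrow> real^2 \<Rightarrow> complex" where
  "weighted q h x = of_real (dec q x) * apply_bcontfun h x"

lemma weighted_continuous: "continuous_on UNIV (weighted q h)"
  unfolding weighted_def[abs_def] by (intro continuous_intros continuous_dec) auto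

lemma weighted_decays_iff: "decays q c (weighted q h) \<longleftrightarrow> (\<forall>x. norm (apply_bcontfun h x) \<le> c)"
  unfolding decays_def weighted_def norm_mult
  by (simp add: mult.commute[of "dec q _"])

lemma weighted_dist: "decays q (dist g h) (\<lambda>x. weighted q g x - weighted q h x)"
  unfolding decays_def weighted_def right_diff_distrib[symmetric] norm_mult
  using dist_bounded[of g _ h] by (auto simp: dist_norm mult.commute intro!: mult_right_mono)

lemma weighted_dist_le:
  assumes "decays q c (\<lambda>x. weighted q g x - weighted q h x)"
  shows "dist g h \<le> c"
proof (rule dist_bound)
  fix x
  have "dec q x * norm (apply_bcontfun g x - apply_bcontfun h x) \<le> c * dec q x"
    using decaysD[OF assms, of x] unfolding weighted_def right_diff_distrib[symmetric] norm_mult by simp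
  thus "dist (apply_bcontfun g x) (apply_bcontfun h x) \<le> c"
    using dec_pos(1)[of q x] by (simp add: dist_norm mult.commute)
qed

lemma ex_weighted:
  assumes "continuous_on UNIV f" "decays q c f"
  shows "\<exists>h. weighted q h = f"
proof -
  define g where "g = (\<lambda>x. f x / complex_of_real (dec q x))"
  have "continuous_on UNIV g" unfolding g_def by (intro continuous_intros assms continuous_dec) auto
  moreover have "norm (g x) \<le> c" for x
    using decaysD[OF assms(2), of x] dec_pos(1)[of q x] by (simp add: g_def norm_divide divide_le_eq)
  hence "bounded (range g)" by (auto simp: bounded_iff)
  ultimately have "g \<in> bcontfun" by (simp add: bcontfun_def)
  then obtain h where "g = apply_bcontfun h" by (rule bcontfunE)
  hence "apply_bcontfun h x = f x / complex_of_real (dec q x)" for x by (simp add: g_def fun_eq_iff)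
  hence "weighted q h x = f x" for x by (simp add: weighted_def)
  thus ?thesis by blast
qed

text \<open>A weight of linear growth turns decay 3 + e into 2 + e, which is still integrable. All
  moments are therefore continuous in the weighted norm, and the decay bound passes to pointwise
  limits.\<close>

lemma admissible_closed:
  assumes e: "e > 0"
  shows "closed {h. admissible e R (weighted (3 + e) h)}"
  unfolding closed_sequential_limits
proof (intro allI impI, elim conjE)
  fix h l assume h: "\<forall>n. h n \<in> {h. admissible e R (weighted (3 + e) h)}" and lim: "h \<longlonglongrightarrow> l"
  let ?G = "\<lambda>n. weighted (3 + e) (h n)" and ?L = "weighted (3 + e) l"
  have adm: "admissible e R (?G n)" for n using h by simp
  have d0: "(\<lambda>n. dist (h n) l) \<longlonglongrightarrow> 0" by (rule iffD1[OF tendsto_dist_iff lim])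
  have pt: "(\<lambda>n. apply_bcontfun (h n) x) \<longlonglongrightarrow> apply_bcontfun l x" for x
    using tendsto_bcontfun_uniform_limit[OF lim] by (rule tendsto_uniform_limitI) simp
  have dL: "decays (3 + e) R ?L"
    unfolding weighted_decays_iff
  proof
    fix x
    have "norm (apply_bcontfun (h n) x) \<le> R" for n
      using adm[of n] unfolding admissible_def weighted_decays_iff by blast
    thus "norm (apply_bcontfun l x) \<le> R"
      using tendsto_norm[OF pt[of x]] by (intro LIMSEQ_le_const2) auto
  qed
  have dG: "decays (3 + e) R (?G n)" for n using adm[of n] by (simp add: admissible_def)
  have L: "(\<lambda>n. \<integral>x. w x * ?G n x \<partial>lborel) \<longlonglongrightarrow> (\<integral>x. w x * ?L x \<partial>lborel)"
    if w: "continuous_on UNIV w" "decays (- 1) 1 w" for w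
  proof (rule LIM_zero_cancel, rule Lim_null_comparison[of _ "\<lambda>n. dist (h n) l * integral\<^sup>L lborel (dec (2 + e))"])
    have i: "integrable lborel (\<lambda>x. w x * weighted (3 + e) g x)" if "decays (3 + e) R (weighted (3 + e) g)" for g
      by (rule decays_integrable[OF _ decays_mult[OF w(2) that]], intro continuous_intros w weighted_continuous) (use e in simp)
    show "\<forall>\<^sub>F n in sequentially. norm ((\<integral>x. w x * ?G n x \<partial>lborel) - (\<integral>x. w x * ?L x \<partial>lborel)) \<le> dist (h n) l * integral\<^sup>L lborel (dec (2 + e))"
    proof (intro always_eventually allI)
      fix n
      have "(\<integral>x. w x * ?G n x \<partial>lborel) - (\<integral>x. w x * ?L x \<partial>lborel) = (\<integral>x. w x * (?G n x - ?L x) \<partial>lborel)"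
        using i[OF dG] i[OF dL] by (simp add: right_diff_distrib)
      also have "norm \<dots> \<le> 1 * dist (h n) l * integral\<^sup>L lborel (dec (- 1 + (3 + e)))"
        by (rule decays_integral_le[OF _ decays_mult[OF w(2) weighted_dist]], intro continuous_intros w weighted_continuous) (use e in simp)
      finally show "norm ((\<integral>x. w x * ?G n x \<partial>lborel) - (\<integral>x. w x * ?L x \<partial>lborel)) \<le> dist (h n) l * integral\<^sup>L lborel (dec (2 + e))"
        by simp
    qed
    show "(\<lambda>n. dist (h n) l * integral\<^sup>L lborel (dec (2 + e))) \<longlonglongrightarrow> 0"
      using tendsto_mult_left_zero[OF d0] .
  qed
  \<comment> \<open>The constant 1 also has at most linear growth, so the total integral is an
    instance of the same limit.\<close>
  have one: "decays (- 1) 1 (\<lambda>x. 1)" by (simp add: decays_def dec_def)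
  have "(\<lambda>n. \<integral>x. 1 * ?G n x \<partial>lborel) \<longlonglongrightarrow> (\<integral>x. 1 * ?L x \<partial>lborel)" by (intro L one continuous_intros)
  moreover have "(\<integral>x. 1 * ?G n x \<partial>lborel) = 0" for n using adm[of n] by (simp add: admissible_def)
  ultimately have 1: "(\<integral>x. ?L x \<partial>lborel) = 0" by (simp add: LIMSEQ_const_iff)
  have "(\<lambda>n. \<integral>x. cx x * ?G n x \<partial>lborel) \<longlonglongrightarrow> (\<integral>x. cx x * ?L x \<partial>lborel)" by (intro L decays_cx continuous_intros)
  moreover have "(\<integral>x. cx x * ?G n x \<partial>lborel) = 0" for n using adm[of n] by (simp add: admissible_def)
  ultimately have 2: "(\<integral>x. cx x * ?L x \<partial>lborel) = 0" by (simp add: LIMSEQ_const_iff)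
  have "(\<lambda>n. Im (\<integral>x. cnj (cx x) * ?G n x \<partial>lborel)) \<longlonglongrightarrow> Im (\<integral>x. cnj (cx x) * ?L x \<partial>lborel)"
    by (intro tendsto_Im L decays_cx continuous_intros)
  moreover have "Im (\<integral>x. cnj (cx x) * ?G n x \<partial>lborel) = 0" for n using adm[of n] by (simp add: admissible_def)
  ultimately have 3: "Im (\<integral>x. cnj (cx x) * ?L x \<partial>lborel) = 0" by (simp add: LIMSEQ_const_iff)
  show "l \<in> {h. admissible e R (weighted (3 + e) h)}"
    using 1 2 3 dL by (simp add: admissible_def borel_measurable_continuous_onI[OF weighted_continuous])
qed

lemma source_fixed_point:
  assumes e: "0 < e" "e < 1"
  obtains \<nu> where "\<nu> > 0"
    "\<And>K \<kappa>. continuous_on UNIV K \<Longrightarrow> decays (3 + e) \<nu> K \<Longrightarrow> (\<integral>x. K x \<partial>lborel) = 0 \<Longrightarrow>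
      \<kappa> = - Im (\<integral>x. cnj (cx x) * K x \<partial>lborel) / (4 * pi) \<Longrightarrow>
      \<exists>G c \<alpha>. continuous_on UNIV G \<and> admissible e c G \<and>
        (\<forall>x. G x = K x + of_real \<kappa> * vortex_source x + nonlin \<kappa> G x + \<alpha> / of_real pi * gauss x)"
proof -
  obtain D where D: "D > 0"
    and N: "\<And>G c \<kappa>. admissible e c G \<Longrightarrow> continuous_on UNIV (nonlin \<kappa> G) \<and> decays (3 + e) (D * (\<bar>\<kappa>\<bar> + c) * c) (nonlin \<kappa> G)
        \<and> (\<integral>x. nonlin \<kappa> G x \<partial>lborel) = 0 \<and> Im (\<integral>x. cnj (cx x) * nonlin \<kappa> G x \<partial>lborel) = 0"
    and Nd: "\<And>G H c \<delta> \<kappa>. admissible e c G \<Longrightarrow> admissible e c H \<Longrightarrow> admissible e \<delta> (\<lambda>x. G x - H x) \<Longrightarrow>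
        decays (3 + e) (D * (\<bar>\<kappa>\<bar> + c) * \<delta>) (\<lambda>x. nonlin \<kappa> G x - nonlin \<kappa> H x)"
    using nonlin_facts[OF e] by blast
  define I where "I = integral\<^sup>L lborel (dec (2 + e))"
  have I: "I \<ge> 0" unfolding I_def by (rule Bochner_Integration.integral_nonneg) simp
  define E where "E = 1 + 4096 * I"
  have E: "E \<ge> 1" using I by (simp add: E_def)
  \<comment> \<open>With \<bar>\<kappa>\<bar> \<le> R the Lipschitz constant is at most E D (R + R),
    which this radius makes equal to 1/2.\<close>
  define R where "R = 1 / (4 * E * D)"
  have R: "R > 0" using D E by (simp add: R_def)
  \<comment> \<open>The data, including the Laplacian of the vortex with its decay constant 64, then
    use up half of the radius after projection; the quadratic part uses the other half.\<close>
  define \<nu> where "\<nu> = R / (2 * E * (1 + 64 * I))"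
  have \<nu>: "\<nu> > 0" using R E I by (simp add: \<nu>_def add_pos_nonneg)
  have \<nu>1: "E * (\<nu> * (1 + 64 * I)) = R / 2"
    using E I by (simp add: \<nu>_def add_nonneg_eq_0_iff)
  have \<nu>2: "\<nu> * I \<le> R"
  proof -
    have "\<nu> * I \<le> \<nu> * (1 + 64 * I)" using \<nu> I by (intro mult_left_mono) auto
    also have "\<dots> \<le> E * (\<nu> * (1 + 64 * I))" using mult_right_mono[OF E, of "\<nu> * (1 + 64 * I)"] \<nu> I by simp
    finally show ?thesis using \<nu>1 R by simp
  qed
  have RD: "E * (D * (R + R)) = 1 / 2" using E D by (simp add: R_def)
  show ?thesis
  proof (rule that[OF \<nu>])
    fix K \<kappa> assume K: "continuous_on UNIV K" "decays (3 + e) \<nu> K" and K0: "(\<integral>x. K x \<partial>lborel) = 0"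
      and \<kappa>: "\<kappa> = - Im (\<integral>x. cnj (cx x) * K x \<partial>lborel) / (4 * pi)"
    have kle: "\<bar>\<kappa>\<bar> \<le> \<nu> * I"
    proof -
      have "\<bar>Im (\<integral>x. cnj (cx x) * K x \<partial>lborel)\<bar> \<le> norm (\<integral>x. cnj (cx x) * K x \<partial>lborel)" by (rule abs_Im_le_cmod)
      also have "\<dots> \<le> \<nu> * integral\<^sup>L lborel (dec (3 + e - 1))"
        by (rule decays_integral_le[OF _ decays_uminus_1_mult(2)[OF K(2)]], intro continuous_intros K) (use e in simp)
      finally have "\<bar>Im (\<integral>x. cnj (cx x) * K x \<partial>lborel)\<bar> \<le> \<nu> * I" by (simp add: I_def)
      moreover have "\<bar>\<kappa>\<bar> \<le> \<bar>Im (\<integral>x. cnj (cx x) * K x \<partial>lborel)\<bar>"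
        unfolding \<kappa> using pi_gt3 by (simp add: abs_divide divide_le_eq mult_le_cancel_left1)
      ultimately show ?thesis by linarith
    qed
    have kR: "\<bar>\<kappa>\<bar> \<le> R" using kle \<nu>2 by linarith
    \<comment> \<open>The whole inhomogeneous term. The value of \<kappa> is chosen exactly so that
      the torque of \<open>F\<close> vanishes.\<close>
    define F where "F = (\<lambda>x. K x + of_real \<kappa> * vortex_source x)"
    have Fc: "continuous_on UNIV F" unfolding F_def by (intro continuous_intros K vortex_source_continuous)
    have dS: "decays (3 + e) (\<bar>\<kappa>\<bar> * 64) (\<lambda>x. of_real \<kappa> * vortex_source x)"
      using decays_weaken[OF decays_cmult[OF vortex_source_decay, of "of_real \<kappa>"], of "3 + e"] e by simp
    have cS: "continuous_on UNIV (\<lambda>x. of_real \<kappa> * vortex_source x)" by (intro continuous_intros vortex_source_continuous)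
    have Fd: "decays (3 + e) (\<nu> * (1 + 64 * I)) F"
      unfolding F_def by (rule decays_add_weaken[OF K(2) dS]) (use kle in \<open>auto simp: algebra_simps\<close>)
    note iF = moments_integrable[OF K e(1)] moments_integrable[OF cS dS e(1)]
    have F0: "(\<integral>x. F x \<partial>lborel) = 0"
      unfolding F_def using iF K0 vortex_source_moments by simp
    have "(\<integral>x. cnj (cx x) * F x \<partial>lborel) = (\<integral>x. cnj (cx x) * K x \<partial>lborel) + (\<integral>x. cnj (cx x) * (of_real \<kappa> * vortex_source x) \<partial>lborel)"
      unfolding F_def distrib_left by (rule Bochner_Integration.integral_add[OF iF(3) iF(6)])
    also have "(\<integral>x. cnj (cx x) * (of_real \<kappa> * vortex_source x) \<partial>lborel) = of_real \<kappa> * (\<integral>x. cnj (cx x) * vortex_source x \<partial>lborel)"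
      by (subst integral_mult_right_zero[symmetric]) (simp add: mult_ac)
    finally have F1: "Im (\<integral>x. cnj (cx x) * F x \<partial>lborel) = 0"
      using vortex_source_moments(2) by (simp add: \<kappa>)
    define T where "T = (\<lambda>G x. F x + nonlin \<kappa> G x)"
    define S where "S = {h. admissible e R (weighted (3 + e) h)}"
    have T: "continuous_on UNIV (T G)" "decays (3 + e) (\<nu> * (1 + 64 * I) + D * (R + R) * R) (T G)"
      "(\<integral>x. T G x \<partial>lborel) = 0" "Im (\<integral>x. cnj (cx x) * T G x \<partial>lborel) = 0"
      if adm: "admissible e R G" for G
    proof -
      note n = N[OF adm, of \<kappa>]
      note iN = moments_integrable[OF n[THEN conjunct1] n[THEN conjunct2, THEN conjunct1] e(1)]
      note iF' = moments_integrable[OF Fc Fd e(1)]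
      show "continuous_on UNIV (T G)" unfolding T_def using n by (intro continuous_intros Fc) auto
      have "D * (\<bar>\<kappa>\<bar> + R) * R \<le> D * (R + R) * R"
        using D R kR by (intro mult_right_mono mult_left_mono) auto
      thus "decays (3 + e) (\<nu> * (1 + 64 * I) + D * (R + R) * R) (T G)"
        unfolding T_def using n by (intro decays_add_weaken[OF Fd]) auto
      show "(\<integral>x. T G x \<partial>lborel) = 0" unfolding T_def using iN iF' n F0 by simp
      show "Im (\<integral>x. cnj (cx x) * T G x \<partial>lborel) = 0"
        unfolding T_def distrib_left using iN iF' n F1 by simp
    qed
    have P: "continuous_on UNIV (drop_moment (T G))" "admissible e R (drop_moment (T G))" if adm: "admissible e R G" for G
    proof -
      note t = T[OF adm]
      note p = drop_moment_facts[OF t(1,2) e]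
      have "E * (\<nu> * (1 + 64 * I) + D * (R + R) * R) = E * (\<nu> * (1 + 64 * I)) + (E * (D * (R + R))) * R"
        by (simp add: algebra_simps)
      also have "\<dots> = R" unfolding \<nu>1 RD by simp
      finally have "decays (3 + e) R (drop_moment (T G))" using p(2) unfolding E_def I_def by simp
      thus "continuous_on UNIV (drop_moment (T G))" "admissible e R (drop_moment (T G))"
        unfolding admissible_def using p t borel_measurable_continuous_onI[OF p(1)] by auto
    qed
    \<comment> \<open>The iteration is lifted to bounded continuous functions by choosing a preimage
      under \<open>weighted\<close>; one exists for arguments in \<open>S\<close>, which is all that
      the fixed point theorem needs.\<close>
    define \<Phi> where "\<Phi> = (\<lambda>h. SOME g. weighted (3 + e) g = drop_moment (T (weighted (3 + e) h)))"
    have \<Phi>: "weighted (3 + e) (\<Phi> h) = drop_moment (T (weighted (3 + e) h))" if "h \<in> S" for h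
    proof -
      have adm: "admissible e R (weighted (3 + e) h)" using that by (simp add: S_def)
      have "\<exists>g. weighted (3 + e) g = drop_moment (T (weighted (3 + e) h))"
        by (rule ex_weighted[of _ _ R]) (use P[OF adm] in \<open>auto simp: admissible_def\<close>)
      thus ?thesis unfolding \<Phi>_def by (rule someI_ex)
    qed
    have "\<exists>!h\<in>S. \<Phi> h = h"
    proof (rule Banach_fix)
      show "complete S" unfolding S_def complete_eq_closed by (rule admissible_closed[OF e(1)])
      have "weighted (3 + e) (const_bcontfun 0) = (\<lambda>x. 0)"
        by (simp add: weighted_def[abs_def] const_bcontfun.rep_eq)
      hence "const_bcontfun 0 \<in> S" using R by (simp add: S_def admissible_def decays_def)
      thus "S \<noteq> {}" by blast
      show "(0::real) \<le> 1 / 2" "1 / 2 < (1::real)" by simp_all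
      show "\<Phi> ` S \<subseteq> S" using \<Phi> P by (auto simp: S_def)
      fix g h assume gS: "g \<in> S" and hS: "h \<in> S"
      let ?g = "weighted (3 + e) g" and ?h = "weighted (3 + e) h"
      have ag: "admissible e R ?g" and ah: "admissible e R ?h" using gS hS by (auto simp: S_def)
      have w: "admissible e (dist g h) (\<lambda>x. ?g x - ?h x)"
        by (rule admissible_diff[OF weighted_continuous ag weighted_continuous ah weighted_dist e(1)])
      have "decays (3 + e) (D * (\<bar>\<kappa>\<bar> + R) * dist g h) (\<lambda>x. nonlin \<kappa> ?g x - nonlin \<kappa> ?h x)" by (rule Nd[OF ag ah w])
      moreover have "D * (\<bar>\<kappa>\<bar> + R) * dist g h \<le> D * (R + R) * dist g h"
        using D kR by (intro mult_right_mono mult_left_mono) auto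
      ultimately have "decays (3 + e) (D * (R + R) * dist g h) (\<lambda>x. T ?g x - T ?h x)"
        unfolding T_def using decays_mono by simp
      moreover have "continuous_on UNIV (\<lambda>x. T ?g x - T ?h x)" by (intro continuous_intros T(1) ag ah)
      ultimately have "decays (3 + e) (E * (D * (R + R) * dist g h)) (drop_moment (\<lambda>x. T ?g x - T ?h x))"
        using drop_moment_facts(2)[OF _ _ e] unfolding E_def I_def by blast
      moreover have "drop_moment (\<lambda>x. T ?g x - T ?h x) x = weighted (3 + e) (\<Phi> g) x - weighted (3 + e) (\<Phi> h) x" for x
        unfolding \<Phi>[OF gS] \<Phi>[OF hS] by (rule drop_moment_diff[symmetric, OF T(1,2)[OF ag] T(1,2)[OF ah] e(1)])
      ultimately have "decays (3 + e) (E * (D * (R + R) * dist g h)) (\<lambda>x. weighted (3 + e) (\<Phi> g) x - weighted (3 + e) (\<Phi> h) x)"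
        unfolding decays_def by simp
      hence "dist (\<Phi> g) (\<Phi> h) \<le> E * (D * (R + R) * dist g h)" by (rule weighted_dist_le)
      also have "\<dots> = (E * (D * (R + R))) * dist g h" by simp
      finally show "dist (\<Phi> g) (\<Phi> h) \<le> 1 / 2 * dist g h" unfolding RD .
    qed
    then obtain h where h: "h \<in> S" "\<Phi> h = h" by blast
    define G where "G = weighted (3 + e) h"
    have GT: "G = drop_moment (T G)" using \<Phi>[OF h(1)] h(2) by (simp add: G_def)
    \<comment> \<open>The moment removed by the projection, with opposite sign, is the complex
      parameter \<alpha>.\<close>
    have "G x = K x + of_real \<kappa> * vortex_source x + nonlin \<kappa> G x + (- (\<integral>y. cx y * T G y \<partial>lborel)) / of_real pi * gauss x" for x
      using fun_cong[OF GT, of x] unfolding drop_moment_def T_def F_def by simp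
    moreover have "continuous_on UNIV G" "admissible e R G"
      using h(1) weighted_continuous by (auto simp: G_def S_def)
    ultimately show "\<exists>G c \<alpha>. continuous_on UNIV G \<and> admissible e c G \<and>
        (\<forall>x. G x = K x + of_real \<kappa> * vortex_source x + nonlin \<kappa> G x + \<alpha> / of_real pi * gauss x)" by blast
  qed
qed

section \<open>Solution of the Navier--Stokes system\<close>

text \<open>Comparison of the weight 1 + |x|^q with (1 + |x|)^q. The factor 2^q has to be paid when
  passing from the given norm to \<open>decays\<close>.\<close>

lemma weight_le_dec:
  assumes "q > 0"
  shows "1 \<le> 2 powr q * dec q x * weight q x"
proof -
  have p: "1 + norm x > 0" using norm_ge_zero[of x] by linarith
  have "(1 + norm x) powr q \<le> 2 powr q * weight q x"
  proof (cases "norm x \<le> 1")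
    case True
    hence "(1 + norm x) powr q \<le> 2 powr q" using assms p by (intro powr_mono2) auto
    also have "\<dots> \<le> 2 powr q * weight q x" by (simp add: weight_def)
    finally show ?thesis .
  next
    case False
    hence "(1 + norm x) powr q \<le> (2 * norm x) powr q" using assms p by (intro powr_mono2) auto
    also have "\<dots> = 2 powr q * norm x powr q" by (simp add: powr_mult)
    also have "\<dots> \<le> 2 powr q * weight q x" by (simp add: weight_def)
    finally show ?thesis .
  qed
  moreover have "dec q x * (1 + norm x) powr q = 1" using p by (simp add: dec_def flip: powr_add)
  ultimately have "1 \<le> dec q x * (2 powr q * weight q x)"
    using mult_left_mono[of "(1 + norm x) powr q" "2 powr q * weight q x" "dec q x"] by simp
  thus ?thesis by (simp add: mult_ac)
qed

lemma B0_decays: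
  assumes k: "k \<in> B0 q" and le: "B0_norm q k \<le> \<nu>" and q: "q > 0"
  shows "decays q (2 powr q * \<nu>) (\<lambda>x. cx (k x))"
  unfolding decays_def
proof
  fix x
  have w: "weight q x > 0" for x by (simp add: weight_def add_pos_nonneg)
  have "bounded (range (\<lambda>x. weight q x *\<^sub>R k x))" using k by (simp add: B0_def)
  then obtain b where b: "\<And>x. norm (weight q x *\<^sub>R k x) \<le> b" unfolding bounded_iff by blast
  \<comment> \<open>Membership in \<open>B0\<close> is essential here: only for a set bounded above
    does the real-valued supremum bound its elements.\<close>
  have "bdd_above (range (\<lambda>x. weight q x * norm (k x)))"
    using b w by (intro bdd_aboveI[of _ b]) (auto simp: less_imp_le abs_of_pos)
  hence "weight q x * norm (k x) \<le> B0_norm q k" unfolding B0_norm_def by (intro cSUP_upper) auto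
  hence 1: "weight q x * norm (k x) \<le> \<nu>" using le by linarith
  have "norm (k x) \<le> (2 powr q * dec q x * weight q x) * norm (k x)"
    using mult_right_mono[OF weight_le_dec[OF q, of x], of "norm (k x)"] by simp
  also have "\<dots> = 2 powr q * dec q x * (weight q x * norm (k x))" by simp
  also have "\<dots> \<le> 2 powr q * dec q x * \<nu>" using 1 by (intro mult_left_mono) auto
  finally show "norm (cx (k x)) \<le> 2 powr q * \<nu> * dec q x" by (simp add: mult_ac)
qed

section \<open>Translation between complex fields and real vector fields\<close>

lemma wedge_eq: "wedge x y = Im (cnj (cx x) * cx y)"
  by (simp add: wedge_def)

definition of_cx :: "complex \<Rightarrow> real^2" where "of_cx z = vector [Re z, Im z]"

lemma of_cx_nth[simp]: "of_cx z $ 1 = Re z" "of_cx z $ 2 = Im z"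
  by (simp_all add: of_cx_def)

lemma cx_of_cx[simp]: "cx (of_cx z) = z"
  by (simp add: complex_eq_iff)

lemma gauss_eq: "gauss x = of_real (exp (- (norm x)\<^sup>2)) * cnj (cx x)"
proof -
  have "cx x * cnj (cx x) = of_real ((norm x)\<^sup>2)" by (simp flip: complex_norm_square)
  thus ?thesis unfolding gauss_def by (simp flip: exp_of_real)
qed

lemma cx_forcing: "cx (forcing k (of_cx \<alpha>) x) = cx (k x) + \<alpha> / of_real pi * gauss x"
proof -
  have "\<alpha> * cnj (cx x) = Complex (Re \<alpha> * x $ 1 + Im \<alpha> * x $ 2) (Im \<alpha> * x $ 1 - Re \<alpha> * x $ 2)"
    by (simp add: complex_eq_iff)
  moreover have "cx (Re \<alpha> *\<^sub>R vector [x $ 1, - (x $ 2)] + Im \<alpha> *\<^sub>R vector [x $ 2, x $ 1])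
     = Complex (Re \<alpha> * x $ 1 + Im \<alpha> * x $ 2) (Im \<alpha> * x $ 1 - Re \<alpha> * x $ 2)"
    by (simp add: complex_eq_iff)
  ultimately have e: "cx (Re \<alpha> *\<^sub>R vector [x $ 1, - (x $ 2)] + Im \<alpha> *\<^sub>R vector [x $ 2, x $ 1]) = \<alpha> * cnj (cx x)" by simp
  show ?thesis unfolding forcing_def cx_add[of "k x"] cx_simps(1) of_cx_nth e gauss_eq
    by (simp add: scaleR_conv_of_real)
qed

lemma cx_e_theta:
  assumes "x \<noteq> 0"
  shows "cx (e_theta x) = \<i> * cx x / of_real (norm x)"
proof -
  have z: "Complex (x $ 1) (x $ 2) = cx x" by (simp add: cx_def)
  have "cx (e_theta x) = \<i> * cis (polar_angle x)"
    by (simp add: e_theta_def complex_eq_iff)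
  also have "cis (polar_angle x) = sgn (cx x)"
    unfolding polar_angle_def z using assms by (simp add: cis_Arg)
  finally show ?thesis by (simp add: sgn_eq)
qed

lemma component_Ck1:
  assumes "field_deriv U a b"
  shows "Ck 1 (\<lambda>x. of_cx (U x) $ i)"
    and "partial j (\<lambda>x. of_cx (U x) $ i) x = of_cx (a x * cx (axis j 1) + b x * cnj (cx (axis j 1))) $ i"
proof -
  have d: "((\<lambda>x. of_cx (U x) $ i) has_derivative (\<lambda>h. of_cx (a x * cx h + b x * cnj (cx h)) $ i)) (at x)" for x
  proof -
    have "(U has_derivative (\<lambda>h. a x * cx h + b x * cnj (cx h))) (at x)" using assms by (simp add: field_deriv_def)
    hence "((\<lambda>x. Re (U x)) has_derivative (\<lambda>h. Re (a x * cx h + b x * cnj (cx h)))) (at x)"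
      "((\<lambda>x. Im (U x)) has_derivative (\<lambda>h. Im (a x * cx h + b x * cnj (cx h)))) (at x)"
      by (rule bounded_linear.has_derivative[OF bounded_linear_Re], rule bounded_linear.has_derivative[OF bounded_linear_Im])
    thus ?thesis using exhaust_2[of i] by auto
  qed
  show p: "partial j (\<lambda>x. of_cx (U x) $ i) x = of_cx (a x * cx (axis j 1) + b x * cnj (cx (axis j 1))) $ i" for j x
    by (rule partial_eqI[OF d])
  have "continuous_on UNIV a" "continuous_on UNIV b" using assms by (auto simp: field_deriv_def)
  hence c: "continuous_on UNIV (\<lambda>x. a x * cx (axis j 1) + b x * cnj (cx (axis j 1)))" for j by (intro continuous_intros)
  have "continuous_on UNIV (partial j (\<lambda>x. of_cx (U x) $ i))" for j
  proof -
    have "partial j (\<lambda>x. of_cx (U x) $ i) = (\<lambda>x. of_cx (a x * cx (axis j 1) + b x * cnj (cx (axis j 1))) $ i)"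
      by (rule ext) (rule p)
    thus ?thesis using exhaust_2[of i] continuous_on_Re[OF c[of j]] continuous_on_Im[OF c[of j]] by auto
  qed
  moreover have "(\<lambda>x. of_cx (U x) $ i) differentiable (at x)" for x using d unfolding differentiable_def by blast
  ultimately show "Ck 1 (\<lambda>x. of_cx (U x) $ i)" unfolding One_nat_def by simp
qed

lemma convection_eq:
  assumes "field_deriv U a b"
  shows "convection (\<lambda>x. of_cx (U x)) i x = of_cx (advect a b U x) $ i"
proof -
  have "convection (\<lambda>x. of_cx (U x)) i x = Re (U x) * of_cx (a x + b x) $ i + Im (U x) * of_cx (\<i> * (a x - b x)) $ i"
    unfolding convection_def sum_2 component_Ck1(2)[OF assms] by (simp add: algebra_simps)
  thus ?thesis using exhaust_2[of i] by (auto simp: advect_def algebra_simps)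
qed

lemma regular_distr_of_cx:
  assumes "integrable lborel (\<lambda>x. F x * of_real (\<phi> x))"
  shows "regular_distr (\<lambda>x. of_cx (F x) $ i) \<phi> = of_cx (\<integral>x. F x * of_real (\<phi> x) \<partial>lborel) $ i"
  using exhaust_2[of i] assms unfolding regular_distr_def
  by (auto simp flip: integral_Re integral_Im)

text \<open>The two momentum equations are the real and imaginary parts of one complex equation in
  which the gradient of \<phi> is 2 \<open>dbar \<phi>\<close>. The pressure enters with a plus sign
  because moving the derivative in - grad p onto \<phi> changes the sign.\<close>

lemma weak_system:
  assumes U: "field_deriv U a b" and div: "\<And>x. Re (a x) = 0" and p: "continuous_on UNIV p"
    and F: "continuous_on UNIV (\<lambda>x. cx (f x))"
    and eq: "\<And>\<phi>. \<phi> \<in> test_functions \<Longrightarrow>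
      (\<integral>x. U x * of_real (lap \<phi> x) \<partial>lborel) + 2 * (\<integral>x. of_real (p x) * dbar \<phi> x \<partial>lborel)
        - (\<integral>x. advect a b U x * of_real (\<phi> x) \<partial>lborel) = (\<integral>x. cx (f x) * of_real (\<phi> x) \<partial>lborel)"
  shows "navier_stokes_solution f (\<lambda>x. of_cx (U x)) p"
proof -
  have c: "continuous_on UNIV U" "continuous_on UNIV a" "continuous_on UNIV b"
    using field_deriv_continuous[OF U] U by (simp_all add: field_deriv_def)
  have Ud: "\<And>x. (U has_derivative (\<lambda>h. a x * cx h + b x * cnj (cx h))) (at x)" using U by (simp add: field_deriv_def)
  have pc: "continuous_on UNIV (\<lambda>x. complex_of_real (p x))" by (intro continuous_intros p)
  have f: "of_cx (cx (f x)) $ i = f x $ i" for x i using exhaust_2[of i] by auto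
  have mom: "distr_laplacian (regular_distr (\<lambda>x. of_cx (U x) $ i)) \<phi> - distr_partial i (regular_distr p) \<phi>
        - regular_distr (convection (\<lambda>x. of_cx (U x)) i) \<phi> = regular_distr (\<lambda>x. f x $ i) \<phi>"
    if \<phi>: "\<phi> \<in> test_functions" for \<phi> i
  proof -
    note \<phi>' = test_function_partial[OF \<phi>] and \<phi>'' = test_function_partial[OF test_function_partial[OF \<phi>]]
    have il: "integrable lborel (\<lambda>x. U x * of_real (partial j (partial j \<phi>) x))" for j
      by (rule test_function_integrable[OF \<phi>'' c(1)])
    have "(\<integral>x. U x * of_real (lap \<phi> x) \<partial>lborel)
       = (\<integral>x. U x * of_real (partial 1 (partial 1 \<phi>) x) \<partial>lborel) + (\<integral>x. U x * of_real (partial 2 (partial 2 \<phi>) x) \<partial>lborel)"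
      unfolding lap_def of_real_add distrib_left by (rule Bochner_Integration.integral_add[OF il il])
    hence L: "distr_laplacian (regular_distr (\<lambda>x. of_cx (U x) $ i)) \<phi> = of_cx (\<integral>x. U x * of_real (lap \<phi> x) \<partial>lborel) $ i"
      unfolding distr_laplacian_def sum_2 distr_partial_def minus_minus regular_distr_of_cx[OF il]
      using exhaust_2[of i] by auto
    have ip: "integrable lborel (\<lambda>x. of_real (p x) * complex_of_real (partial j \<phi> x))" for j
      by (rule test_function_integrable[OF \<phi>' pc])
    have ep: "(\<integral>x. of_real (p x) * complex_of_real (partial j \<phi> x) \<partial>lborel) = of_real (\<integral>x. p x * partial j \<phi> x \<partial>lborel)" for j
      unfolding of_real_mult[symmetric] by (rule integral_complex_of_real)
    have "2 * (\<integral>x. of_real (p x) * dbar \<phi> x \<partial>lborel)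
       = (\<integral>x. 2 * (of_real (p x) * dbar \<phi> x) \<partial>lborel)" by (rule integral_mult_right_zero[symmetric])
    also have "\<dots> = (\<integral>x. of_real (p x) * complex_of_real (partial 1 \<phi> x) + \<i> * (of_real (p x) * complex_of_real (partial 2 \<phi> x)) \<partial>lborel)"
      by (intro Bochner_Integration.integral_cong refl) (simp add: dbar_def algebra_simps)
    also have "\<dots> = of_real (\<integral>x. p x * partial 1 \<phi> x \<partial>lborel) + \<i> * of_real (\<integral>x. p x * partial 2 \<phi> x \<partial>lborel)"
      using ip by (simp add: ep del: of_real_mult)
    finally have P: "distr_partial i (regular_distr p) \<phi> = - of_cx (2 * (\<integral>x. of_real (p x) * dbar \<phi> x \<partial>lborel)) $ i"
      unfolding distr_partial_def regular_distr_def using exhaust_2[of i] by auto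
    have "convection (\<lambda>x. of_cx (U x)) i = (\<lambda>x. of_cx (advect a b U x) $ i)"
      by (rule ext) (rule convection_eq[OF U])
    hence C: "regular_distr (convection (\<lambda>x. of_cx (U x)) i) \<phi> = of_cx (\<integral>x. advect a b U x * of_real (\<phi> x) \<partial>lborel) $ i"
      using regular_distr_of_cx[OF test_function_integrable[OF \<phi> advect_continuous[OF c(2,3,1)]]] by simp
    have R: "regular_distr (\<lambda>x. f x $ i) \<phi> = of_cx (\<integral>x. cx (f x) * of_real (\<phi> x) \<partial>lborel) $ i"
      using regular_distr_of_cx[OF test_function_integrable[OF \<phi> F], of i] unfolding f .
    show ?thesis unfolding L P C R eq[OF \<phi>, symmetric] using exhaust_2[of i] by auto
  qed
  have mass: "(\<Sum>i\<in>UNIV. distr_partial i (regular_distr (\<lambda>x. of_cx (U x) $ i)) \<phi>) = 0" if \<phi>: "\<phi> \<in> test_functions" for \<phi>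
  proof -
    note i = test_function_integrable[OF test_function_partial[OF \<phi>] c(1)]
    have i1: "integrable lborel (\<lambda>x. (a x + b x) * of_real (\<phi> x))" "integrable lborel (\<lambda>x. \<i> * (a x - b x) * of_real (\<phi> x))"
      by (rule test_function_integrable[OF \<phi>], intro continuous_intros c)+
    have "(\<Sum>i\<in>UNIV. distr_partial i (regular_distr (\<lambda>x. of_cx (U x) $ i)) \<phi>)
       = - (Re (\<integral>x. U x * of_real (partial 1 \<phi> x) \<partial>lborel) + Im (\<integral>x. U x * of_real (partial 2 \<phi> x) \<partial>lborel))"
      unfolding sum_2 distr_partial_def regular_distr_of_cx[OF i] by simp
    also have "\<dots> = Re (\<integral>x. (a x + b x) * of_real (\<phi> x) \<partial>lborel) + Im (\<integral>x. \<i> * (a x - b x) * of_real (\<phi> x) \<partial>lborel)"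
      unfolding wirtinger_by_parts[OF \<phi> Ud c(2,3)] by simp
    also have "\<dots> = (\<integral>x. Re ((a x + b x) * of_real (\<phi> x)) \<partial>lborel) + (\<integral>x. Im (\<i> * (a x - b x) * of_real (\<phi> x)) \<partial>lborel)"
      by (simp only: integral_Re[OF i1(1)] integral_Im[OF i1(2)])
    also have "\<dots> = (\<integral>x. Re ((a x + b x) * of_real (\<phi> x)) + Im (\<i> * (a x - b x) * of_real (\<phi> x)) \<partial>lborel)"
      by (rule Bochner_Integration.integral_add[symmetric, OF integrable_Re[OF i1(1)] integrable_Im[OF i1(2)]])
    \<comment> \<open>The divergence of the field is 2 Re a, which vanishes by assumption.\<close>
    also have "\<dots> = (\<integral>x. 2 * Re (a x) * \<phi> x \<partial>(lborel :: (real^2) measure))"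
      by (intro Bochner_Integration.integral_cong refl) (simp add: algebra_simps)
    finally show ?thesis by (simp add: div)
  qed
  show ?thesis
    unfolding navier_stokes_solution_def
    using component_Ck1(1)[OF U] p mom mass by simp
qed

lemma tendsto_dec_at_infinity: "(dec 1 \<longlongrightarrow> 0) at_infinity"
proof -
  have "filterlim (\<lambda>x::real^2. 1 + norm x) at_top at_infinity"
    by (intro filterlim_tendsto_add_at_top[OF tendsto_const] filterlim_norm_at_top)
  hence "((\<lambda>x::real^2. 1 / (1 + norm x)) \<longlongrightarrow> 0) at_infinity"
    by (intro tendsto_divide_0[OF tendsto_const] filterlim_at_top_imp_at_infinity)
  thus ?thesis by (simp add: dec_1[abs_def])
qed

theorem theorem3p8:
  fixes \<epsilon> :: real
  assumes "0 < \<epsilon>" and "\<epsilon> < 1"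
  shows "\<exists>\<nu>>0. \<forall>k \<in> B0 (3 + \<epsilon>).
    B0_norm (3 + \<epsilon>) k \<le> \<nu> \<longrightarrow> (LINT x|lborel. k x) = 0 \<longrightarrow>
    (\<exists>a :: real^2. \<exists>u p.
       navier_stokes_solution (forcing k a) u p \<and>
       (u \<longlongrightarrow> 0) at_infinity \<and>
       (let M = (LINT x|lborel. wedge x (k x)) in
          M = (LINT x|lborel. wedge x (forcing k a x)) \<and>
          (\<lambda>x. norm (u x - (- M / (4 * pi * norm x)) *\<^sub>R e_theta x))
            \<in> O[at_infinity](\<lambda>x. norm x powr (-1 - \<epsilon>))))"
proof -
  obtain \<nu> where \<nu>: "\<nu> > 0" and fp: "\<And>K \<kappa>. continuous_on UNIV K \<Longrightarrow> decays (3 + \<epsilon>) \<nu> K \<Longrightarrow> (\<integral>x. K x \<partial>lborel) = 0 \<Longrightarrow>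
      \<kappa> = - Im (\<integral>x. cnj (cx x) * K x \<partial>lborel) / (4 * pi) \<Longrightarrow>
      \<exists>G c \<alpha>. continuous_on UNIV G \<and> admissible \<epsilon> c G \<and>
        (\<forall>x. G x = K x + of_real \<kappa> * vortex_source x + nonlin \<kappa> G x + \<alpha> / of_real pi * gauss x)"
    using source_fixed_point[OF assms] by blast
  obtain C where C: "C > 0" and V: "\<And>G c. admissible \<epsilon> c G \<Longrightarrow>
      decays (1 + \<epsilon>) (C * c) (velo G) \<and> decays (2 + \<epsilon>) (C * c) (velo_z G) \<and> decays (2 + \<epsilon>) (C * c) (velo_b G)"
    using velo_decay[OF assms] by blast
  show ?thesis
  \<comment> \<open>Dividing by 2^(3+\<epsilon>) compensates the loss when the norm with
    \<open>weight\<close> is compared with \<open>dec\<close>.\<close>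
  proof (intro exI[of _ "\<nu> / 2 powr (3 + \<epsilon>)"] conjI ballI impI)
    show "\<nu> / 2 powr (3 + \<epsilon>) > 0" using \<nu> by simp
    fix k assume k: "k \<in> B0 (3 + \<epsilon>)" and kn: "B0_norm (3 + \<epsilon>) k \<le> \<nu> / 2 powr (3 + \<epsilon>)"
      and k0: "(LINT x|lborel. k x) = 0"
    define K where "K = (\<lambda>x. cx (k x))"
    have kc: "continuous_on UNIV k" using k by (simp add: B0_def)
    have Kc: "continuous_on UNIV K" unfolding K_def by (intro continuous_intros kc)
    have Kd: "decays (3 + \<epsilon>) \<nu> K"
      using B0_decays[OF k kn] assms unfolding K_def by simp
    have ik: "integrable lborel k"
      by (rule integrable_of_dec[OF borel_measurable_continuous_onI[OF kc], of "3 + \<epsilon>" \<nu>])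
         (use assms decaysD[OF Kd] in \<open>auto simp: K_def\<close>)
    have K0: "(\<integral>x. K x \<partial>lborel) = 0"
      unfolding K_def using integral_bounded_linear[OF bounded_linear_cx ik] k0 by simp
    note iK = moments_integrable[OF Kc Kd assms(1)]
    define M where "M = (LINT x|lborel. wedge x (k x))"
    have M: "M = Im (\<integral>x. cnj (cx x) * K x \<partial>lborel)"
      unfolding M_def wedge_eq K_def by (rule integral_Im[OF iK(3)[unfolded K_def]])
    define \<kappa> where "\<kappa> = - M / (4 * pi)"
    obtain G c \<alpha> where Gc: "continuous_on UNIV G" and G: "admissible \<epsilon> c G"
      and Geq: "\<And>x. G x = K x + of_real \<kappa> * vortex_source x + nonlin \<kappa> G x + \<alpha> / of_real pi * gauss x"
      using fp[OF Kc Kd K0, of \<kappa>] unfolding \<kappa>_def M by blast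
    have Gm: "G \<in> borel_measurable borel" and Gd: "decays (3 + \<epsilon>) c G" and q: "3 + \<epsilon> > 3"
      using G assms by (auto simp: admissible_def)
    have cC: "C * c \<ge> 0" using C decays_nonneg[OF Gd] by simp
    define U where "U = (\<lambda>x. of_real \<kappa> * vortex x + velo G x)"
    define a where "a = (\<lambda>x. of_real \<kappa> * vortex_z x + velo_z G x)"
    define b where "b = (\<lambda>x. of_real \<kappa> * vortex_b x + velo_b G x)"
    \<comment> \<open>The gradient of \<kappa>^2 / (2 (1 + |x|^2)) is the self-advection of \<kappa>
      Q, so this part of the pressure cancels it.\<close>
    define p where "p = (\<lambda>x::real^2. press G x - \<kappa>\<^sup>2 / 2 * (1 / (1 + (norm x)\<^sup>2)))"
    define f where "f = forcing k (of_cx \<alpha>)"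
    note fV = velo_field_deriv[OF Gm Gd q]
    have dQ: "\<And>x. (vortex has_derivative (\<lambda>h. vortex_z x * cx h + vortex_b x * cnj (cx h))) (at x)"
      and cQ: "continuous_on UNIV vortex_z" "continuous_on UNIV vortex_b"
      using vortex_field_deriv by (simp_all add: field_deriv_def)
    have dV: "\<And>x. (velo G has_derivative (\<lambda>h. velo_z G x * cx h + velo_b G x * cnj (cx h))) (at x)"
      and cV: "continuous_on UNIV (velo_z G)" "continuous_on UNIV (velo_b G)"
      using fV by (simp_all add: field_deriv_def)
    note cQ0 = field_deriv_continuous[OF vortex_field_deriv] and cV0 = field_deriv_continuous[OF fV]
    have fU: "field_deriv U a b"
      unfolding field_deriv_def
    proof (intro conjI allI)
      show "(U has_derivative (\<lambda>h. a x * cx h + b x * cnj (cx h))) (at x)" for x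
        unfolding U_def
        by (rule has_derivative_eq_rhs[OF has_derivative_add[OF has_derivative_mult_right[OF dQ] dV]])
           (simp add: a_def b_def algebra_simps)
      show "continuous_on UNIV a" "continuous_on UNIV b"
        unfolding a_def b_def by (intro continuous_intros cQ cV)+
    qed
    have cf: "cx (f x) = K x + \<alpha> / of_real pi * gauss x" for x
      unfolding f_def cx_forcing K_def ..
    have ns: "navier_stokes_solution f (\<lambda>x. of_cx (U x)) p"
    proof (rule weak_system[OF fU])
      show "Re (a x) = 0" for x unfolding a_def by (simp add: Re_vortex_z Re_velo_z)
      have "1 + (norm x)\<^sup>2 \<noteq> 0" for x :: "real^2" using rho_ge(2)[of x] by linarith
      thus "continuous_on UNIV p"
        unfolding p_def by (intro continuous_intros velo_deriv_continuous[OF Gm Gd q]) auto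
      show "continuous_on UNIV (\<lambda>x. cx (f x))"
        unfolding cf by (intro continuous_intros Kc gauss_continuous)
      fix \<phi> assume \<phi>: "\<phi> \<in> test_functions"
      have lapc: "integrable lborel (\<lambda>x. W x * of_real (lap \<phi> x))" if "continuous_on UNIV W" for W :: "real^2 \<Rightarrow> complex"
      proof -
        note i = test_function_integrable[OF test_function_partial[OF test_function_partial[OF \<phi>]] that]
        show ?thesis unfolding lap_def of_real_add distrib_left
          by (rule Bochner_Integration.integrable_add[OF i i])
      qed
      have L: "(\<integral>x. U x * of_real (lap \<phi> x) \<partial>lborel)
         = of_real \<kappa> * - (\<integral>x. vortex_source x * of_real (\<phi> x) \<partial>lborel) + (\<integral>x. velo G x * of_real (lap \<phi> x) \<partial>lborel)"
      proof -
        have "(\<integral>x. U x * of_real (lap \<phi> x) \<partial>lborel)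
          = (\<integral>x. of_real \<kappa> * (vortex x * of_real (lap \<phi> x)) + velo G x * of_real (lap \<phi> x) \<partial>lborel)"
          unfolding U_def by (simp add: distrib_right mult.assoc)
        also have "\<dots> = of_real \<kappa> * (\<integral>x. vortex x * of_real (lap \<phi> x) \<partial>lborel) + (\<integral>x. velo G x * of_real (lap \<phi> x) \<partial>lborel)"
          using lapc[OF cQ0] lapc[OF cV0] by simp
        finally show ?thesis unfolding vortex_weak_laplacian[OF \<phi>] .
      qed
      have P: "2 * (\<integral>x. of_real (p x) * dbar \<phi> x \<partial>lborel)
         = 2 * (\<integral>x. of_real (press G x) * dbar \<phi> x \<partial>lborel)
           + of_real (\<kappa>\<^sup>2) * (\<integral>x. advect vortex_z vortex_b vortex x * of_real (\<phi> x) \<partial>lborel)"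
      proof -
        have e: "of_real (p x) * dbar \<phi> x = of_real (press G x) * dbar \<phi> x - of_real (\<kappa>\<^sup>2 / 2) * (1 / rho x * dbar \<phi> x)" for x
          unfolding p_def rho_real by (simp add: algebra_simps)
        have i1: "integrable lborel (\<lambda>x. of_real (press G x) * dbar \<phi> x)"
          by (intro dbar_mult_integrable[OF \<phi>] continuous_intros velo_deriv_continuous[OF Gm Gd q])
        have i2: "integrable lborel (\<lambda>x. 1 / rho x * dbar \<phi> x)"
          by (rule dbar_mult_integrable[OF \<phi>]) (auto intro!: continuous_intros rho_continuous)
        have "(\<integral>x. of_real (p x) * dbar \<phi> x \<partial>lborel)
           = (\<integral>x. of_real (press G x) * dbar \<phi> x \<partial>lborel) - of_real (\<kappa>\<^sup>2 / 2) * (\<integral>x. 1 / rho x * dbar \<phi> x \<partial>lborel)"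
          unfolding e Bochner_Integration.integral_diff[OF i1 integrable_mult_right[OF i2]] integral_mult_right_zero ..
        thus ?thesis unfolding vortex_pressure_weak[OF \<phi>] by simp
      qed
      \<comment> \<open>Expanding the quadratic term: the pure vortex part goes to the pressure, and
        all the rest is the nonlinearity contained in \<open>G\<close>.\<close>
      have A: "advect a b U x = of_real (\<kappa>\<^sup>2) * advect vortex_z vortex_b vortex x + nonlin \<kappa> G x" for x
        unfolding advect_def nonlin_def interact_def a_def b_def U_def by (simp add: algebra_simps power2_eq_square)
      have cA: "continuous_on UNIV (advect vortex_z vortex_b vortex)" by (intro advect_continuous cQ cQ0)
      have cN: "continuous_on UNIV (nonlin \<kappa> G)"
        unfolding nonlin_def[abs_def] interact_def by (intro continuous_intros advect_continuous cQ cQ0 cV cV0)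
      note ti = test_function_integrable[OF \<phi>]
      have iA: "(\<integral>x. advect a b U x * of_real (\<phi> x) \<partial>lborel)
         = of_real (\<kappa>\<^sup>2) * (\<integral>x. advect vortex_z vortex_b vortex x * of_real (\<phi> x) \<partial>lborel) + (\<integral>x. nonlin \<kappa> G x * of_real (\<phi> x) \<partial>lborel)"
        unfolding A distrib_right mult.assoc using ti[OF cA] ti[OF cN] by (simp del: of_real_power)
      have iG: "(\<integral>x. G x * of_real (\<phi> x) \<partial>lborel) = (\<integral>x. cx (f x) * of_real (\<phi> x) \<partial>lborel)
         + of_real \<kappa> * (\<integral>x. vortex_source x * of_real (\<phi> x) \<partial>lborel) + (\<integral>x. nonlin \<kappa> G x * of_real (\<phi> x) \<partial>lborel)"
      proof -
        have "G x * of_real (\<phi> x) = cx (f x) * of_real (\<phi> x) + of_real \<kappa> * (vortex_source x * of_real (\<phi> x)) + nonlin \<kappa> G x * of_real (\<phi> x)" for x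
          unfolding cf by (subst Geq) (simp add: algebra_simps)
        moreover have "continuous_on UNIV (\<lambda>x. cx (f x))" unfolding cf by (intro continuous_intros Kc gauss_continuous)
        ultimately show ?thesis using ti[OF vortex_source_continuous] ti[OF cN] ti by simp
      qed
      \<comment> \<open>The weak Laplacian of the vortex and the nonlinearity are both parts of
        \<open>G\<close>, so after the Stokes equation only the forcing remains.\<close>
      show "(\<integral>x. U x * of_real (lap \<phi> x) \<partial>lborel) + 2 * (\<integral>x. of_real (p x) * dbar \<phi> x \<partial>lborel)
        - (\<integral>x. advect a b U x * of_real (\<phi> x) \<partial>lborel) = (\<integral>x. cx (f x) * of_real (\<phi> x) \<partial>lborel)"
        unfolding L P iA using stokes_weak[OF \<phi> Gm Gd q] iG by (simp add: algebra_simps)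
    qed
    have Udec: "norm (of_cx (U x)) \<le> (\<bar>\<kappa>\<bar> * 2 + C * c) * dec 1 x" for x
    proof -
      have "decays 1 (norm (complex_of_real \<kappa>) * 2 + C * c) U"
        unfolding U_def
        by (rule decays_add_weaken[OF decays_cmult[OF vortex_decay(1)] V[OF G, THEN conjunct1]]) (use assms in auto)
      from decaysD[OF this, of x] show ?thesis by (simp flip: norm_cx)
    qed
    have lim: "((\<lambda>x. of_cx (U x)) \<longlongrightarrow> 0) at_infinity"
    proof (rule Lim_null_comparison)
      show "\<forall>\<^sub>F x in at_infinity. norm (of_cx (U x)) \<le> (\<bar>\<kappa>\<bar> * 2 + C * c) * dec 1 x"
        using Udec by (intro always_eventually) auto
      show "((\<lambda>x. (\<bar>\<kappa>\<bar> * 2 + C * c) * dec 1 x) \<longlongrightarrow> 0) at_infinity"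
        by (rule tendsto_mult_right_zero[OF tendsto_dec_at_infinity])
    qed
    \<comment> \<open>The Gaussian corrector has zero moment against cnj z, hence no torque,
      whatever \<alpha> is.\<close>
    have Mf: "M = (LINT x|lborel. wedge x (f x))"
    proof -
      have "cnj (cx x) * cx (f x) = cnj (cx x) * K x + \<alpha> / of_real pi * (cnj (cx x) * gauss x)" for x
        unfolding cf by (simp add: algebra_simps)
      moreover have "integrable lborel (\<lambda>x. cnj (cx x) * gauss x)"
        using moments_integrable(3)[OF gauss_continuous, of 4 4096] gauss_decay by simp
      ultimately have e: "(\<integral>x. cnj (cx x) * cx (f x) \<partial>lborel) = (\<integral>x. cnj (cx x) * K x \<partial>lborel)"
        and i: "integrable lborel (\<lambda>x. cnj (cx x) * cx (f x))"
        using iK(3) gauss_moments(2) by simp_all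
      show ?thesis unfolding M wedge_eq e[symmetric] by (rule integral_Im[OF i, symmetric])
    qed
    have asy: "(\<lambda>x. norm (of_cx (U x) - (- M / (4 * pi * norm x)) *\<^sub>R e_theta x)) \<in> O[at_infinity](\<lambda>x. norm x powr (-1 - \<epsilon>))"
    proof (rule bigoI)
      show "\<forall>\<^sub>F x in at_infinity. norm (norm (of_cx (U x) - (- M / (4 * pi * norm x)) *\<^sub>R e_theta x))
          \<le> (\<bar>\<kappa>\<bar> + C * c) * norm (norm x powr (-1 - \<epsilon>))"
        unfolding eventually_at_infinity
      proof (intro exI[of _ 1] allI impI)
        fix x :: "real^2" assume x: "1 \<le> norm x"
        have x0: "x \<noteq> 0" using x by auto
        let ?r = "norm x"
        have coef: "- M / (4 * pi * ?r) = \<kappa> / ?r" by (simp add: \<kappa>_def)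
        have "norm (of_cx (U x) - (- M / (4 * pi * ?r)) *\<^sub>R e_theta x)
           = norm (U x - (\<kappa> / ?r) *\<^sub>R (\<i> * cx x / of_real ?r))"
          unfolding coef norm_cx[symmetric, of "of_cx (U x) - _"] cx_diff by (simp add: cx_e_theta[OF x0])
        \<comment> \<open>Replacing the exact profile 1/r by r / (1 + r^2) costs 1 / (r (1 + r^2)),
          which is of order r^-3. The size of the error is thus governed by the Stokes velocity of
          \<open>G\<close>.\<close>
        also have "U x - (\<kappa> / ?r) *\<^sub>R (\<i> * cx x / of_real ?r) = velo G x - of_real \<kappa> * (\<i> * cx x) * of_real (1 / ?r\<^sup>2 - 1 / (1 + ?r\<^sup>2))"
          unfolding U_def vortex_def rho_real by (simp add: scaleR_conv_of_real power2_eq_square algebra_simps)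
        also have "norm \<dots> \<le> norm (velo G x) + norm (of_real \<kappa> * (\<i> * cx x) * of_real (1 / ?r\<^sup>2 - 1 / (1 + ?r\<^sup>2)))"
          by (rule norm_triangle_ineq4)
        also have "\<dots> \<le> C * c * ?r powr (-1 - \<epsilon>) + \<bar>\<kappa>\<bar> * ?r powr (-1 - \<epsilon>)"
        proof (rule add_mono)
          have "norm (velo G x) \<le> C * c * dec (1 + \<epsilon>) x" using V[OF G] by (auto dest: decaysD)
          also have "\<dots> \<le> C * c * ?r powr (- (1 + \<epsilon>))"
            using cC assms x0 by (intro mult_left_mono dec_le_powr) auto
          finally show "norm (velo G x) \<le> C * c * ?r powr (-1 - \<epsilon>)" by simp
          have "1 / ?r\<^sup>2 - 1 / (1 + ?r\<^sup>2) = 1 / (?r\<^sup>2 * (1 + ?r\<^sup>2))"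
            using x0 rho_ge(2)[of x] by (simp add: field_simps)
          hence "norm (of_real \<kappa> * (\<i> * cx x) * of_real (1 / ?r\<^sup>2 - 1 / (1 + ?r\<^sup>2))) = \<bar>\<kappa>\<bar> * (?r * (1 / (?r\<^sup>2 * (1 + ?r\<^sup>2))))"
            using rho_ge(2)[of x] by (simp add: norm_mult abs_mult del: of_real_diff of_real_divide)
          also have "\<dots> \<le> \<bar>\<kappa>\<bar> * ?r powr (-1 - \<epsilon>)"
          proof (intro mult_left_mono)
            have "?r * (1 / (?r\<^sup>2 * (1 + ?r\<^sup>2))) = 1 / (?r * (1 + ?r\<^sup>2))" using x0 by (simp add: power2_eq_square)
            also have "\<dots> \<le> 1 / (?r * ?r)"
            proof -
              have "?r * 1 \<le> ?r * ?r" using x by (intro mult_left_mono) auto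
              hence "?r \<le> 1 + ?r\<^sup>2" by (simp add: power2_eq_square)
              thus ?thesis using x0 rho_ge(2)[of x] by (intro divide_left_mono mult_left_mono mult_pos_pos) auto
            qed
            also have "\<dots> = ?r powr (- 2)" using x0 by (simp add: powr_minus power2_eq_square divide_inverse)
            \<comment> \<open>The bound r^-2 suffices because \<epsilon> < 1 and r \<ge> 1.\<close>
            also have "\<dots> \<le> ?r powr (-1 - \<epsilon>)" using x assms by (intro powr_mono) auto
            finally show "?r * (1 / (?r\<^sup>2 * (1 + ?r\<^sup>2))) \<le> ?r powr (-1 - \<epsilon>)" .
          qed simp
          finally show "norm (of_real \<kappa> * (\<i> * cx x) * of_real (1 / ?r\<^sup>2 - 1 / (1 + ?r\<^sup>2))) \<le> \<bar>\<kappa>\<bar> * ?r powr (-1 - \<epsilon>)" .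
        qed
        finally show "norm (norm (of_cx (U x) - (- M / (4 * pi * ?r)) *\<^sub>R e_theta x)) \<le> (\<bar>\<kappa>\<bar> + C * c) * norm (?r powr (-1 - \<epsilon>))"
          by (simp add: distrib_right add.commute)
      qed
    qed
    show "\<exists>a :: real^2. \<exists>u p.
       navier_stokes_solution (forcing k a) u p \<and>
       (u \<longlongrightarrow> 0) at_infinity \<and>
       (let M = (LINT x|lborel. wedge x (k x)) in
          M = (LINT x|lborel. wedge x (forcing k a x)) \<and>
          (\<lambda>x. norm (u x - (- M / (4 * pi * norm x)) *\<^sub>R e_theta x))
            \<in> O[at_infinity](\<lambda>x. norm x powr (-1 - \<epsilon>)))"
      using ns lim Mf asy unfolding f_def M_def[symmetric] Let_def
      by (intro exI[of _ "of_cx \<alpha>"] exI[of _ "\<lambda>x. of_cx (U x)"] exI[of _ p] conjI) simp_all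
  qed
qed

end
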